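(* For an oriented virtual link diagram $K$, the normalized bracket $A^{-8\,wr(K)}[[K]]\in\mathcal M$ is invariant under all Reidemeister moves for virtual diagrams (classical Reidemeister moves and detour moves) and under the $Z$-move.
   Context: Graphs. $\mathcal S$ is the collection of finite oriented graphs (up to isomorphism; multiple edges allowed; finite disjoint unions allowed; oriented circle components without vertices allowed) which are trivalent and bipartite, with every edge oriented from the first part to the second; thus every vertex is a source or a sink. A bigon is a pair of distinct vertices joined by (at least) two edges, with a chosen pair of such edges; a quadrilateral is a 4-cycle with four distinct vertices. $\mathcal T=\{t_1,t_2,\dots\}\subset\mathcal S$ is the set of connected graphs (having vertices) with neither bigons nor quadrilaterals. $\mathcal M=\mathbb Z[A,A^{-1}][t_1,t_2,\dots]$ is the commutative polynomial algebra. The map $f:\mathcal S\to\mathcal M$ is the unique map which sends disjoint unions to products, sends $t\in\mathcal T$ to $t$, sends a circle to $A^6+1+A^{-6}$, and satisfies: $f(\Gamma)=(A^3+A^{-3})f(\Gamma')$ if $\Gamma'$ is obtained by resolving a bigon (delete its two vertices and the two chosen edges, glue the two remaining external edge-ends together); $f(\Gamma)=f(\Gamma')+f(\Gamma'')$ for a quadrilateral $v_1v_2v_3v_4$ with external edge-ends $e_i$ at $v_i$, where the quadrilateral is deleted and one glues $e_1$ to $e_2$, $e_3$ to $e_4$ in $\Gamma'$, and $e_2$ to $e_3$, $e_4$ to $e_1$ in $\Gamma''$. Virtual diagrams. An oriented virtual link diagram is an oriented planar link diagram with classical (over/under) and virtual crossings. The detour move replaces an arc containing only virtual crossings by any other arc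 with the same endpoints all of whose new crossings are virtual. The $Z$-move interchanges a classical crossing with an adjacent virtual crossing: if $c$ denotes a classical crossing and $v$ a virtual crossing, both viewed as 2-strand tangles, it replaces the tangle composite $cv$ by $vc$ (the same planar picture of $c$ being used in both); equivalently $vcv$ is replaced by $c$. The sign of the classical crossing is unchanged. The writhe $wr(K)$ is the sum of the signs of the classical crossings. Bracket. At a classical crossing let $i_1,i_2$ be the incoming and $o_1,o_2$ the outgoing edge-ends, $i_k$ opposite to $o_k$. The oriented local state connects $i_1$ to $o_2$ and $i_2$ to $o_1$. The unoriented local state replaces the crossing by a sink $x$ receiving $i_1,i_2$, a source $y$ emitting $o_1,o_2$, and an edge from $y$ to $x$. A state $s$ is a choice of local state at each classical crossing; $K_s\in\mathcal S$ is the resulting abstract graph (virtual crossings ignored). Its weight $w(K_s)$ is the product over classical crossings of sign $\varepsilon$ of $A^{2\varepsilon}$ (oriented state) or $-A^{-\varepsilon}$ (unoriented state). Then $[[K]]=\sum_s w(K_s)f(K_s)\in\mathcal M$. *)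

theory Defs
  imports
    "Graph_Theory.Digraph_Isomorphism"
    "HOL-Library.Poly_Mapping"
    "HOL-Combinatorics.Orbits"
    "HOL-Combinatorics.Transposition"
begin

section \<open>Trivalent bipartite graphs\<close>

text \<open>
  An element of \<open>\<S>\<close> is a pair of a digraph (multiple arcs allowed) and the number of its
  circle components without vertices.  The label types in \<open>graph\<close> carry no meaning: they are
  countably infinite, so every finite graph has a copy there.
\<close>

type_synonym graph = "(nat \<times> bool, nat \<times> bool option) pre_digraph"
type_synonym web = "graph \<times> nat"

definition trivalent_bipartite :: "('v, 'e) pre_digraph \<Rightarrow> bool" where
  "trivalent_bipartite G \<longleftrightarrow> fin_digraph G \<and>
     (\<forall>v \<in> verts G. out_degree G v = 3 \<and> in_degree G v = 0 \<or>
                    out_degree G v = 0 \<and> in_degree G v = 3)"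

definition bigon :: "('v, 'e) pre_digraph \<Rightarrow> 'e \<Rightarrow> 'e \<Rightarrow> bool" where
  "bigon G a b \<longleftrightarrow> a \<in> arcs G \<and> b \<in> arcs G \<and> a \<noteq> b \<and>
     tail G a = tail G b \<and> head G a = head G b \<and> tail G a \<noteq> head G a"

text \<open>
  The arcs of a quadrilateral \<open>v\<^sub>1v\<^sub>2v\<^sub>3v\<^sub>4\<close> whose first vertex is a source are
  \<open>a: v\<^sub>1\<rightarrow>v\<^sub>2\<close>, \<open>b: v\<^sub>3\<rightarrow>v\<^sub>2\<close>, \<open>c: v\<^sub>3\<rightarrow>v\<^sub>4\<close>, \<open>d: v\<^sub>1\<rightarrow>v\<^sub>4\<close>.  Starting at a sink instead only
  exchanges the two resolutions.
\<close>

definition quadrilateral :: "('v, 'e) pre_digraph \<Rightarrow> 'e \<Rightarrow> 'e \<Rightarrow> 'e \<Rightarrow> 'e \<Rightarrow> bool" where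
  "quadrilateral G a b c d \<longleftrightarrow> {a, b, c, d} \<subseteq> arcs G \<and>
     tail G a = tail G d \<and> tail G b = tail G c \<and> head G a = head G b \<and> head G c = head G d \<and>
     distinct [tail G a, head G a, tail G b, head G c]"

definition prime_graph :: "('v, 'e) pre_digraph \<Rightarrow> bool" where
  "prime_graph G \<longleftrightarrow> trivalent_bipartite G \<and> connected G \<and>
     (\<forall>a b. \<not> bigon G a b) \<and> (\<forall>a b c d. \<not> quadrilateral G a b c d)"

text \<open>
  \<open>splice V E R t h n\<close> has vertices \<open>V\<close> and is assembled from the arcs \<open>E\<close> by gluing, for
  every \<open>(e, e') \<in> R\<close>, the final end of \<open>e\<close> to the initial end of \<open>e'\<close>.  Here \<open>R \<subseteq> E \<times> E\<close> is
  single-valued in both directions.  A maximal chain of glued arcs becomes one arc, named after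
  its first member; a cyclic chain becomes a circle.
\<close>

definition splice ::
  "'v set \<Rightarrow> 'e set \<Rightarrow> ('e \<times> 'e) set \<Rightarrow> ('e \<Rightarrow> 'v) \<Rightarrow> ('e \<Rightarrow> 'v) \<Rightarrow> nat \<Rightarrow> ('v, 'e) pre_digraph \<times> nat"
  where
  "splice V E R t h n =
     (\<lparr>verts = V, arcs = E - Range R, tail = t,
       head = (\<lambda>e. h (THE z. (e, z) \<in> R\<^sup>* \<and> z \<notin> Domain R))\<rparr>,
      n + card {R\<^sup>+ `` {e} | e. (e, e) \<in> R\<^sup>+})"

definition resolve :: "'e set \<Rightarrow> ('e \<times> 'e) set \<Rightarrow> ('v, 'e) pre_digraph \<times> nat \<Rightarrow> ('v, 'e) pre_digraph \<times> nat"
  where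
  "resolve B R \<Gamma> = (case \<Gamma> of (G, n) \<Rightarrow>
     splice (verts G - (tail G ` B \<union> head G ` B)) (arcs G - B) R (tail G) (head G) n)"


section \<open>The coefficient ring\<close>

text \<open>The variables are indexed by isomorphism classes; the Heawood graph shows that there is one.\<close>

definition heawood :: graph where
  "heawood = \<lparr>verts = {..<7} \<times> UNIV, arcs = {..<7} \<times> UNIV,
     tail = (\<lambda>e. (fst e, True)),
     head = (\<lambda>e. ((fst e + (case snd e of None \<Rightarrow> 3 | Some b \<Rightarrow> of_bool b)) mod 7, False))\<rparr>"

lemma fin_digraph_heawood: "fin_digraph heawood"
proof
  show "tail heawood e \<in> verts heawood" "head heawood e \<in> verts heawood"
    if "e \<in> arcs heawood" for e
    using that by (auto simp: heawood_def)
  have "finite ({..<7 :: nat} \<times> (UNIV :: bool set))"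
    and "finite ({..<7 :: nat} \<times> (UNIV :: bool option set))"
    by simp_all
  then show "finite (verts heawood)" "finite (arcs heawood)"
    by (simp_all add: heawood_def)
qed

lemma trivalent_bipartite_heawood: "trivalent_bipartite heawood"
proof -
  have UNIV_opt: "(UNIV :: bool option set) = {None, Some True, Some False}"
    by (auto simp: UNIV_option_conv UNIV_bool)
  have less_7: "i < 7 \<longleftrightarrow> i \<in> {0, 1, 2, 3, 4, 5, 6}" for i :: nat by auto
  have src: "out_degree heawood (i, True) = 3" "in_degree heawood (i, True) = 0" if "i < 7" for i
  proof -
    have "out_arcs heawood (i, True) = {(i, None), (i, Some True), (i, Some False)}"
      using that by (auto simp: out_arcs_def heawood_def UNIV_opt)
    then show "out_degree heawood (i, True) = 3" by (simp add: out_degree_def)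
    have "in_arcs heawood (i, True) = {}" by (auto simp: in_arcs_def heawood_def)
    then show "in_degree heawood (i, True) = 0" by (simp add: in_degree_def)
  qed
  have snk: "out_degree heawood (i, False) = 0" "in_degree heawood (i, False) = 3" if i: "i < 7" for i
  proof -
    have "out_arcs heawood (i, False) = {}" by (auto simp: out_arcs_def heawood_def)
    then show "out_degree heawood (i, False) = 0" by (simp add: out_degree_def)
    have "in_arcs heawood (i, False) =
        {((i + 4) mod 7, None), ((i + 6) mod 7, Some True), (i, Some False)}"
    proof (intro set_eqI iffI)
      fix e assume e: "e \<in> in_arcs heawood (i, False)"
      obtain j k where jk: "e = (j, k)" by (cases e)
      have j: "j \<in> {0, 1, 2, 3, 4, 5, 6}" and h: "(j + (case k of None \<Rightarrow> 3 | Some b \<Rightarrow> of_bool b)) mod 7 = i"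
        using e by (auto simp: in_arcs_def heawood_def jk less_7)
      consider "k = None" | "k = Some True" | "k = Some False" by (cases k) auto
      then show "e \<in> {((i + 4) mod 7, None), ((i + 6) mod 7, Some True), (i, Some False)}"
      proof cases
        case 1
        have "j = (i + 4) mod 7" using j h unfolding 1 by auto
        then show ?thesis by (simp add: jk 1)
      next
        case 2
        have "j = (i + 6) mod 7" using j h unfolding 2 by auto
        then show ?thesis by (simp add: jk 2)
      next
        case 3
        then show ?thesis using j h by (auto simp: jk)
      qed
    next
      fix e assume "e \<in> {((i + 4) mod 7, None), ((i + 6) mod 7, Some True), (i, Some False)}"
      moreover have "((i + 4) mod 7 + 3) mod 7 = i" "((i + 6) mod 7 + 1) mod 7 = i"
        using i unfolding less_7 by auto
      ultimately show "e \<in> in_arcs heawood (i, False)"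
        using i by (auto simp: in_arcs_def heawood_def)
    qed
    then show "in_degree heawood (i, False) = 3" by (simp add: in_degree_def)
  qed
  show ?thesis
    unfolding trivalent_bipartite_def
  proof (intro conjI ballI)
    show "fin_digraph heawood" by (rule fin_digraph_heawood)
    fix v assume v: "v \<in> verts heawood"
    then obtain i b where "v = (i, b)" "i < 7" by (auto simp: heawood_def)
    then show "out_degree heawood v = 3 \<and> in_degree heawood v = 0 \<or>
        out_degree heawood v = 0 \<and> in_degree heawood v = 3"
      using src[of i] snk[of i] by (cases b) auto
  qed
qed

lemma connected_heawood: "connected heawood"
proof -
  interpret fin_digraph heawood by (rule fin_digraph_heawood)
  interpret S: pair_wf_digraph "mk_symmetric heawood" by (rule wellformed_mk_symmetric)
  let ?S = "with_proj (mk_symmetric heawood)"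
  have edge: "tail heawood e \<rightarrow>\<^sup>*\<^bsub>?S\<^esub> head heawood e" "head heawood e \<rightarrow>\<^sup>*\<^bsub>?S\<^esub> tail heawood e"
    if "e \<in> arcs heawood" for e
    using that by (auto intro!: S.reachable_adjI simp: parcs_mk_symmetric)
  have down: "(i, True) \<rightarrow>\<^sup>*\<^bsub>?S\<^esub> (i, False)" "(i, False) \<rightarrow>\<^sup>*\<^bsub>?S\<^esub> (i, True)" if "i < 7" for i
    using edge[of "(i, Some False)"] that by (auto simp: heawood_def)
  have up: "(i, True) \<rightarrow>\<^sup>*\<^bsub>?S\<^esub> (Suc i, False)" "(Suc i, False) \<rightarrow>\<^sup>*\<^bsub>?S\<^esub> (i, True)" if "Suc i < 7" for i
    using edge[of "(i, Some True)"] that by (auto simp: heawood_def)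
  have base: "(i, True) \<rightarrow>\<^sup>*\<^bsub>?S\<^esub> (0, True) \<and> (0, True) \<rightarrow>\<^sup>*\<^bsub>?S\<^esub> (i, True)" if "i < 7" for i
    using that
  proof (induction i)
    case 0
    then show ?case using S.reachable_trans[OF down[of 0]] by simp
  next
    case (Suc i)
    then show ?case using up[of i] down[of "Suc i"]
      by (meson S.reachable_trans Suc_lessD)
  qed
  have all: "v \<rightarrow>\<^sup>*\<^bsub>?S\<^esub> (0, True) \<and> (0, True) \<rightarrow>\<^sup>*\<^bsub>?S\<^esub> v" if v: "v \<in> verts heawood" for v
  proof -
    obtain i b where ib: "v = (i, b)" "i < 7" using v by (auto simp: heawood_def)
    show ?thesis
      using base[of i] down[of i] ib by (cases b) (auto intro: S.reachable_trans)
  qed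
  show ?thesis
    unfolding connected_def strongly_connected_def
  proof (intro conjI ballI)
    have "(0, True) \<in> verts heawood" by (simp add: heawood_def)
    then show "verts ?S \<noteq> {}" by auto
    show "u \<rightarrow>\<^sup>*\<^bsub>?S\<^esub> v" if "u \<in> verts ?S" "v \<in> verts ?S" for u v
      using that all[of u] all[of v] by (auto intro: S.reachable_trans)
  qed
qed

lemma prime_graph_heawood: "prime_graph heawood"
proof -
  define off :: "bool option \<Rightarrow> nat" where
    "off k = (case k of None \<Rightarrow> 3 | Some b \<Rightarrow> of_bool b)" for k
  have off: "off k = 0 \<or> off k = 1 \<or> off k = 3" for k
    by (auto simp: off_def split: option.split)
  have off_inj: "off k = off l \<longleftrightarrow> k = l" for k l
    by (auto simp: off_def split: option.split)
  have [simp]: "arcs heawood = {..<7} \<times> UNIV" "tail heawood e = (fst e, True)"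
    "head heawood e = ((fst e + off (snd e)) mod 7, False)" for e
    by (simp_all add: heawood_def off_def)
  have canc: "m = k" if "(n + m) mod 7 = (n + k) mod 7" "m < 7" "k < 7" for n m k :: nat
  proof -
    have "int (n + m) mod 7 = int (n + k) mod 7"
      using that(1) by (metis of_nat_mod of_nat_numeral)
    then have "7 dvd int m - int k" by (simp add: mod_eq_dvd_iff)
    then show ?thesis using that(2,3) by presburger
  qed
  have inj: "off k = off l" if "(i + off k) mod 7 = (i + off l) mod 7" for i k l
    using canc[OF that] off[of k] off[of l] by auto
  have quad: "i = j"
    if h: "(i + off k) mod 7 = (j + off l) mod 7" "(i + off k') mod 7 = (j + off l') mod 7"
      and "off k \<noteq> off k'" and ij: "i < 7" "j < 7"
    for i j k k' l l'
  proof -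
    have "((i + off k) + (j + off l')) mod 7 = ((j + off l) + (i + off k')) mod 7"
      using h by (metis mod_add_cong)
    then have "((i + j) + (off k + off l')) mod 7 = ((i + j) + (off l + off k')) mod 7"
      by (simp only: ac_simps)
    then have "off k + off l' = off l + off k'"
      by (rule canc) (use off[of k] off[of l] off[of k'] off[of l'] in auto)
    then have "off k = off l"
      using \<open>off k \<noteq> off k'\<close> off[of k] off[of l] off[of k'] off[of l'] by auto
    then show "i = j"
      using canc[of "off k" i j] h(1) ij by (simp add: add.commute)
  qed
  have "\<not> bigon heawood a b" for a b
    using inj[of "fst a" "snd a" "snd b"] by (auto simp: bigon_def off_inj prod_eq_iff)
  moreover have "\<not> quadrilateral heawood a b c d" for a b c d
  proof
    assume q: "quadrilateral heawood a b c d"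
    then have eq: "fst d = fst a" "fst c = fst b" "fst a < 7" "fst b < 7" "fst a \<noteq> fst b"
      and h: "(fst a + off (snd a)) mod 7 = (fst b + off (snd b)) mod 7"
        "(fst a + off (snd d)) mod 7 = (fst b + off (snd c)) mod 7"
        "(fst a + off (snd a)) mod 7 \<noteq> (fst a + off (snd d)) mod 7"
      by (auto simp: quadrilateral_def)
    from h(3) have "off (snd a) \<noteq> off (snd d)" by metis
    from quad[OF h(1,2) this eq(3,4)] eq(5) show False by simp
  qed
  ultimately show ?thesis
    using trivalent_bipartite_heawood connected_heawood by (simp add: prime_graph_def)
qed

quotient_type prime_class =
  graph / partial: "\<lambda>G H. prime_graph G \<and> prime_graph H \<and> digraph_iso G H"
proof (rule part_equivpI)
  have refl: "digraph_iso heawood heawood"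
    unfolding digraph_iso_def
    by (rule exI[of _ "\<lparr>iso_verts = id, iso_arcs = id, iso_head = head heawood, iso_tail = tail heawood\<rparr>"])
      (use fin_digraph_heawood in \<open>auto simp: pre_digraph.digraph_isomorphism_def app_iso_def fin_digraph_def\<close>)
  then show "\<exists>G. prime_graph G \<and> prime_graph G \<and> digraph_iso G (G :: graph)"
    using prime_graph_heawood by blast
  have sym: "digraph_iso H G" if iso: "digraph_iso G H" for G H :: graph
  proof -
    obtain k where k: "pre_digraph.digraph_isomorphism G k" "H = app_iso k G"
      using iso by (auto simp: digraph_iso_def)
    then have "wf_digraph G" by (simp add: pre_digraph.digraph_isomorphism_def)
    then have "pre_digraph.digraph_isomorphism H (pre_digraph.inv_iso G k)"
      using k by (simp add: wf_digraph.digraph_isomorphism_invI)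
    moreover have "G = app_iso (pre_digraph.inv_iso G k) H"
      using k by (simp add: pre_digraph.app_iso_inv)
    ultimately show ?thesis unfolding digraph_iso_def by blast
  qed
  show "symp (\<lambda>G H :: graph. prime_graph G \<and> prime_graph H \<and> digraph_iso G H)"
    by (rule sympI) (use sym in blast)
  show "transp (\<lambda>G H :: graph. prime_graph G \<and> prime_graph H \<and> digraph_iso G H)"
    by (rule transpI) (use digraph_iso_trans in blast)
qed

type_synonym laurent = "int \<Rightarrow>\<^sub>0 int"
type_synonym coeff = "(prime_class \<Rightarrow>\<^sub>0 nat) \<Rightarrow>\<^sub>0 laurent"

definition A_pow :: "int \<Rightarrow> coeff" where
  "A_pow k = Poly_Mapping.single 0 (Poly_Mapping.single k 1)"

definition prime_var :: "prime_class \<Rightarrow> coeff" where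
  "prime_var t = Poly_Mapping.single (Poly_Mapping.single t 1) 1"


section \<open>The defining properties of the map \<open>f\<close>\<close>

text \<open>
  The first clause makes \<open>f\<close> a function of isomorphism classes; together the clauses determine it
  on \<open>\<S>\<close>.  The external ends \<open>e\<^sub>i\<close> at \<open>v\<^sub>i\<close> may belong to a common arc, in which case the gluing
  can close up to a circle.
\<close>

definition kuperberg_map :: "(web \<Rightarrow> coeff) \<Rightarrow> bool" where
  "kuperberg_map f \<longleftrightarrow>
     (\<forall>G H n. trivalent_bipartite G \<and> digraph_iso G H \<longrightarrow> f (G, n) = f (H, n)) \<and>
     (\<forall>G H m n. trivalent_bipartite G \<and> trivalent_bipartite H \<and> compatible G H \<and>
        verts G \<inter> verts H = {} \<and> arcs G \<inter> arcs H = {} \<longrightarrow>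
        f (union G H, m + n) = f (G, m) * f (H, n)) \<and>
     (\<forall>G. prime_graph G \<longrightarrow> f (G, 0) = prime_var (abs_prime_class G)) \<and>
     (\<forall>G. verts G = {} \<and> arcs G = {} \<longrightarrow> f (G, 1) = A_pow 6 + 1 + A_pow (- 6)) \<and>
     (\<forall>G n a b e e'. trivalent_bipartite G \<and> bigon G a b \<and>
        {e, e'} \<subseteq> arcs G - {a, b} \<and> tail G e = tail G a \<and> head G e' = head G a \<longrightarrow>
        f (G, n) = (A_pow 3 + A_pow (- 3)) * f (resolve {a, b} {(e', e)} (G, n))) \<and>
     (\<forall>G n a b c d e\<^sub>1 e\<^sub>2 e\<^sub>3 e\<^sub>4. trivalent_bipartite G \<and> quadrilateral G a b c d \<and>
        {e\<^sub>1, e\<^sub>2, e\<^sub>3, e\<^sub>4} \<subseteq> arcs G - {a, b, c, d} \<and>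
        tail G e\<^sub>1 = tail G a \<and> head G e\<^sub>2 = head G a \<and>
        tail G e\<^sub>3 = tail G c \<and> head G e\<^sub>4 = head G c \<longrightarrow>
        f (G, n) = f (resolve {a, b, c, d} {(e\<^sub>2, e\<^sub>1), (e\<^sub>4, e\<^sub>3)} (G, n)) +
                   f (resolve {a, b, c, d} {(e\<^sub>2, e\<^sub>3), (e\<^sub>4, e\<^sub>1)} (G, n)))"


section \<open>Virtual link diagrams\<close>

text \<open>
  A diagram is given by its plane 4-valent graph: each crossing \<open>c\<close>, classical or virtual, is
  passed by two strands, the passages \<open>(c, True)\<close> and \<open>(c, False)\<close>, and \<open>nxt\<close> maps a passage to
  the one that follows it along the orientation.  So each passage names the edge leaving it.
  Components without crossings are counted by \<open>circles\<close>.

  At a classical crossing \<open>(c, True)\<close> is the overpass.  The flag \<open>positive c\<close> says that the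
  directions of \<open>(c, True)\<close> and \<open>(c, False)\<close>, in this order, form a positively oriented frame of
  the plane; for a classical crossing this is the sign.  At a virtual crossing it only
  records the planar position of the two strands, whose names are arbitrary.
\<close>

type_synonym passage = "nat \<times> bool"

record vdiagram =
  crossings :: "nat set"
  virtual :: "nat \<Rightarrow> bool"
  positive :: "nat \<Rightarrow> bool"
  nxt :: "passage \<Rightarrow> passage"
  circles :: nat

definition passages :: "vdiagram \<Rightarrow> passage set" where
  "passages D = crossings D \<times> UNIV"

definition classical :: "vdiagram \<Rightarrow> nat set" where
  "classical D = {c \<in> crossings D. \<not> virtual D c}"

text \<open>
  A dart is an edge-end at a crossing: \<open>(p, True)\<close> is the outgoing and \<open>(p, False)\<close> the incoming
  end of the strand \<open>p\<close>.  With \<open>a\<close> the first and \<open>b\<close> the second strand of the positive frame, the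
  counterclockwise order at a crossing is: \<open>a\<close> out, \<open>b\<close> out, \<open>a\<close> in, \<open>b\<close> in.
\<close>

type_synonym dart = "passage \<times> bool"

definition darts :: "vdiagram \<Rightarrow> dart set" where
  "darts D = passages D \<times> UNIV"

definition cr :: "dart \<Rightarrow> nat" where "cr x = fst (fst x)"
definition over :: "dart \<Rightarrow> bool" where "over x = snd (fst x)"

definition opp :: "vdiagram \<Rightarrow> dart \<Rightarrow> dart" where
  "opp D x = (case x of (p, out) \<Rightarrow>
     if out then (nxt D p, False) else (inv (nxt D) p, True))"

definition rot :: "vdiagram \<Rightarrow> dart \<Rightarrow> dart" where
  "rot D x = (case x of ((c, b), out) \<Rightarrow> ((c, \<not> b), if b = positive D c then out else \<not> out))"

text \<open>The orbits of the following map on darts are the face boundaries, traversed with the face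
  on the right.\<close>

definition face_step :: "vdiagram \<Rightarrow> dart \<Rightarrow> dart" where
  "face_step D x = rot D (opp D x)"

definition adjacent :: "vdiagram \<Rightarrow> (nat \<times> nat) set" where
  "adjacent D = {(fst p, fst (nxt D p)) | p. p \<in> passages D}"

text \<open>
  Planarity is Euler's formula \<open>V - E + F = 2k\<close> for \<open>k\<close> connected components, where \<open>E = 2V\<close>.
\<close>

definition virtual_diagram :: "vdiagram \<Rightarrow> bool" where
  "virtual_diagram D \<longleftrightarrow> finite (crossings D) \<and> nxt D permutes passages D \<and>
     card (orbit (face_step D) ` darts D) =
       card (crossings D) + 2 * card {((adjacent D \<union> (adjacent D)\<inverse>)\<^sup>*) `` {c} | c. c \<in> crossings D}"

definition crossing_sign :: "vdiagram \<Rightarrow> nat \<Rightarrow> int" where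
  "crossing_sign D c = (if positive D c then 1 else - 1)"

definition writhe :: "vdiagram \<Rightarrow> int" where
  "writhe D = (\<Sum>c\<in>classical D. crossing_sign D c)"

text \<open>Relabelling of crossings; at a virtual crossing the names of the strands may be exchanged.\<close>

definition diagram_iso :: "(passage \<Rightarrow> passage) \<Rightarrow> vdiagram \<Rightarrow> vdiagram \<Rightarrow> bool" where
  "diagram_iso h D D' \<longleftrightarrow> bij_betw h (passages D) (passages D') \<and> circles D = circles D' \<and>
     (\<forall>c \<in> crossings D. \<forall>b.
        h (nxt D (c, b)) = nxt D' (h (c, b)) \<and>
        fst (h (c, b)) = fst (h (c, True)) \<and>
        virtual D' (fst (h (c, b))) = virtual D c \<and>
        positive D' (fst (h (c, b))) = (positive D c = snd (h (c, True))) \<and>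
        (\<not> virtual D c \<longrightarrow> snd (h (c, b)) = b))"

definition isotopic :: "vdiagram \<Rightarrow> vdiagram \<Rightarrow> bool" where
  "isotopic D D' \<longleftrightarrow> (\<exists>h. diagram_iso h D D')"


section \<open>Moves\<close>

text \<open>
  \<open>erase X D\<close> forgets the crossings in \<open>X\<close>: both strands pass through without meeting.  A
  component that loses all its crossings becomes a circle.
\<close>

definition erase :: "nat set \<Rightarrow> vdiagram \<Rightarrow> vdiagram" where
  "erase X D = D\<lparr>
     crossings := crossings D - X,
     nxt := (\<lambda>p. (nxt D ^^ (LEAST i. 0 < i \<and> fst ((nxt D ^^ i) p) \<notin> X)) p),
     circles := circles D + card {S \<in> orbit (nxt D) ` passages D. fst ` S \<subseteq> X}\<rparr>"

text \<open>In the first two moves \<open>D'\<close> arises from \<open>D\<close> by removing a monogon or a bigon.\<close>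

definition reidemeister1 :: "vdiagram \<Rightarrow> vdiagram \<Rightarrow> bool" where
  "reidemeister1 D D' \<longleftrightarrow> (\<exists>x \<in> darts D.
     face_step D x = x \<and> cr x \<in> classical D \<and> isotopic (erase {cr x} D) D')"

definition bigon_face :: "vdiagram \<Rightarrow> dart \<Rightarrow> dart \<Rightarrow> bool" where
  "bigon_face D x y \<longleftrightarrow> x \<in> darts D \<and> face_step D x = y \<and> face_step D y = x \<and> cr x \<noteq> cr y"

text \<open>One strand runs over the other at both crossings: the edge of \<open>x\<close> is over or under at both
  of its ends, and the edge of \<open>y\<close> is then on the other level.\<close>

definition reidemeister2 :: "vdiagram \<Rightarrow> vdiagram \<Rightarrow> bool" where
  "reidemeister2 D D' \<longleftrightarrow> (\<exists>x y.
     bigon_face D x y \<and> {cr x, cr y} \<subseteq> classical D \<and> over x = over (opp D x) \<and>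
     isotopic (erase {cr x, cr y} D) D')"

text \<open>
  A triangular face, one side of which is over at both ends.  This is the top strand, and
  whichever way the two other strands cross, the three strands lie on three levels.  Moving a
  strand across the opposite crossing interchanges the two passages on every side of the
  triangle and preserves all signs.
\<close>

definition swap_edge :: "vdiagram \<Rightarrow> dart \<Rightarrow> passage \<Rightarrow> passage" where
  "swap_edge D x = Transposition.transpose (fst x) (fst (opp D x))"

definition reidemeister3 :: "vdiagram \<Rightarrow> vdiagram \<Rightarrow> bool" where
  "reidemeister3 D D' \<longleftrightarrow> (\<exists>x y z. x \<in> darts D \<and>
     face_step D x = y \<and> face_step D y = z \<and> face_step D z = x \<and>
     distinct [cr x, cr y, cr z] \<and> {cr x, cr y, cr z} \<subseteq> classical D \<and>
     over x \<and> over (opp D x) \<and>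
     (let s = swap_edge D x \<circ> swap_edge D y \<circ> swap_edge D z
      in isotopic (D\<lparr>nxt := s \<circ> nxt D \<circ> s\<rparr>) D'))"

text \<open>
  \<open>virtual_arc D X e\<close>: some arc of \<open>D\<close> has only virtual crossings, \<open>X\<close> is the set of these
  crossings, and in \<open>erase X D\<close> the arc lies on the edge leaving \<open>r\<close> if \<open>e = Some r\<close>, and on a
  circle if \<open>e = None\<close>.  An arc without crossings is allowed.
\<close>

definition virtual_arc :: "vdiagram \<Rightarrow> nat set \<Rightarrow> passage option \<Rightarrow> bool" where
  "virtual_arc D X e \<longleftrightarrow> X \<subseteq> crossings D \<and> (\<forall>c\<in>X. virtual D c) \<and>
     (case e of
        Some r \<Rightarrow> r \<in> passages D \<and> fst r \<notin> X \<and>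
          (\<exists>j k. X = (\<lambda>i. fst ((nxt D ^^ i) r)) ` {j<..j + k} \<and>
                 (\<forall>i\<in>{0<..j + k}. fst ((nxt D ^^ i) r) \<in> X))
      | None \<Rightarrow> X = {} \<and> 0 < circles D \<or>
          (\<exists>p k. p \<in> passages D \<and> X = (\<lambda>i. fst ((nxt D ^^ i) p)) ` {..<k} \<and>
                 fst ` orbit (nxt D) p \<subseteq> X))"

text \<open>
  Two diagrams differ by a detour if they become equal when a virtual arc is taken out of each,
  where the two arcs have the same end points.
\<close>

definition detour :: "vdiagram \<Rightarrow> vdiagram \<Rightarrow> bool" where
  "detour D D' \<longleftrightarrow> (\<exists>X X' e h. virtual_arc D X e \<and> virtual_arc D' X' (map_option h e) \<and>
     diagram_iso h (erase X D) (erase X' D'))"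

text \<open>
  Z-move at a classical crossing \<open>cr x\<close> and a virtual crossing \<open>cr y\<close> that span a bigon.  On each
  of the two strands the order of the crossings is interchanged.  As the planar picture of the
  classical crossing stays, the strand that was over becomes the one that is under, and the
  sign is preserved; the position of the two strands at the virtual crossing is reversed as
  well.  Hence the passages on one edge of the bigon are replaced by those of the other edge in
  opposite order.
\<close>

definition z_move :: "vdiagram \<Rightarrow> vdiagram \<Rightarrow> bool" where
  "z_move D D' \<longleftrightarrow> (\<exists>x y.
     bigon_face D x y \<and> cr x \<in> classical D \<and> cr y \<in> crossings D - classical D \<and>
     (let s = Transposition.transpose (fst x) (fst y) \<circ>
              Transposition.transpose (fst (opp D x)) (fst (opp D y))
      in isotopic (D\<lparr>nxt := s \<circ> nxt D \<circ> s\<rparr>) D'))"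

definition virtual_move :: "vdiagram \<Rightarrow> vdiagram \<Rightarrow> bool" where
  "virtual_move D D' \<longleftrightarrow> isotopic D D' \<or> reidemeister1 D D' \<or> reidemeister2 D D' \<or>
     reidemeister3 D D' \<or> detour D D' \<or> z_move D D'"


section \<open>The bracket\<close>

text \<open>
  A state is the set \<open>U\<close> of classical crossings with the unoriented local state.  The source and
  the sink replacing \<open>c \<in> U\<close> are \<open>(c, True)\<close> and \<open>(c, False)\<close>, joined by the arc \<open>(c, None)\<close>;
  the arc \<open>(c, Some b)\<close> is the edge of the diagram leaving the passage \<open>(c, b)\<close>.
  At a virtual crossing the strands go straight on, at the other classical ones they turn.
\<close>

definition state_graph :: "vdiagram \<Rightarrow> nat set \<Rightarrow> web" where
  "state_graph D U = splice (U \<times> UNIV)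
     (crossings D \<times> range Some \<union> U \<times> {None})
     {((c, Some b), (c', Some (b' = virtual D c'))) | c b c' b'.
        c \<in> crossings D \<and> nxt D (c, b) = (c', b') \<and> c' \<notin> U}
     (\<lambda>(c, i). (c, True))
     (\<lambda>(c, i). (case i of None \<Rightarrow> c | Some b \<Rightarrow> fst (nxt D (c, b)), False))
     (circles D)"

definition bracket :: "(web \<Rightarrow> coeff) \<Rightarrow> vdiagram \<Rightarrow> coeff" where
  "bracket f D = (\<Sum>U\<in>Pow (classical D).
     (\<Prod>c\<in>classical D. if c \<in> U then - A_pow (- crossing_sign D c)
                        else A_pow (2 * crossing_sign D c)) *
     f (state_graph D U))"

definition normalized_bracket :: "(web \<Rightarrow> coeff) \<Rightarrow> vdiagram \<Rightarrow> coeff" where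
  "normalized_bracket f D = A_pow (- 8 * writhe D) * bracket f D"

end

theory Submission
  imports Defs
begin

text \<open>
  A net is a multiset of generators (wires, trivalent sources and sinks, crossings) whose ends carry
  labels, each label being used once as a start and once as an end.  Gluing equal labels gives a web,
  and expanding the crossings by the two local states gives the value of the net.  This value
  depends on the labels only up to injective renaming, and subnets may be rewritten by Kuperberg's
  bigon, square and circle relations.  So every move becomes an identity between small nets: a kink
  contributes \<open>A\<^sup>8\<close> to the power of its sign, the second move follows from the bigon and square
  relations, and in the third move the top strand slides across the third crossing in each of its
  local states.  Virtual crossings are pairs of wires, so detours do not change the net up to
  relabelling; for the Z-move, a crossing slides along the edges of the bigon.
\<close>


section \<open>Splicing\<close>

text \<open>The obstacle is that gluing is global: loose ends of a small piece may be joined to each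
  other elsewhere, so a resolution can close up to a circle or merge long chains. Chain
  manipulations are concentrated in \<open>splice_absorb\<close>, which removes intermediate edges
  from a gluing and keeps count of the circles. It serves to contract a wire, to split off a loop,
  to read a state graph from a net and to erase virtual crossings. With d = A^6 + 1 + A^-6 and b =
  A^3 + A^-3, two identities make the moves work: d + 1 = b^2 cancels the unwanted term of the
  antiparallel second move, and A^(4e) + A^(-2e) = A^e b for e = 1 or -1 cancels it when a strand
  slides over a trivalent vertex. The exponent 8 of the normalization comes from A^2 d - A^-1 b =
  A^8. The Z-move turns an overpass into an underpass. It is admissible because the two local states
  and their weights treat both strands of a crossing alike and see only the sign; the same symmetry
  makes the names of the strands immaterial.\<close>

lemma digraph_isoI:
  assumes "wf_digraph G" "inj_on \<psi> (verts G)" "inj_on \<phi> (arcs G)"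
    and "verts H = \<psi> ` verts G" "arcs H = \<phi> ` arcs G"
    and "\<And>a. a \<in> arcs G \<Longrightarrow> tail H (\<phi> a) = \<psi> (tail G a)"
    and "\<And>a. a \<in> arcs G \<Longrightarrow> head H (\<phi> a) = \<psi> (head G a)"
  shows "digraph_iso G H"
  unfolding digraph_iso_def
proof (rule exI[of _ "\<lparr>iso_verts = \<psi>, iso_arcs = \<phi>, iso_head = head H, iso_tail = tail H\<rparr>"])
  show "pre_digraph.digraph_isomorphism G
      \<lparr>iso_verts = \<psi>, iso_arcs = \<phi>, iso_head = head H, iso_tail = tail H\<rparr> \<and>
    H = app_iso \<lparr>iso_verts = \<psi>, iso_arcs = \<phi>, iso_head = head H, iso_tail = tail H\<rparr> G"
    using assms by (auto simp: pre_digraph.digraph_isomorphism_def app_iso_def)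
qed

lemma digraph_isoE:
  assumes "digraph_iso G H"
  obtains \<psi> \<phi> where "wf_digraph G" "inj_on \<psi> (verts G)" "inj_on \<phi> (arcs G)"
    and "verts H = \<psi> ` verts G" "arcs H = \<phi> ` arcs G"
    and "\<And>a. a \<in> arcs G \<Longrightarrow> tail H (\<phi> a) = \<psi> (tail G a)"
    and "\<And>a. a \<in> arcs G \<Longrightarrow> head H (\<phi> a) = \<psi> (head G a)"
  using assms unfolding digraph_iso_def
  by (auto simp: pre_digraph.digraph_isomorphism_def)

lemma digraph_iso_refl: "wf_digraph G \<Longrightarrow> digraph_iso G G"
  by (rule digraph_isoI[of G id id]) auto

lemma digraph_iso_sym:
  assumes "digraph_iso G H" shows "digraph_iso H G"
proof -
  obtain k where k: "pre_digraph.digraph_isomorphism G k" "H = app_iso k G"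
    using assms by (auto simp: digraph_iso_def)
  then have "wf_digraph G" by (simp add: pre_digraph.digraph_isomorphism_def)
  then have "pre_digraph.digraph_isomorphism H (pre_digraph.inv_iso G k)"
    using k by (simp add: wf_digraph.digraph_isomorphism_invI)
  moreover have "G = app_iso (pre_digraph.inv_iso G k) H"
    using k by (simp add: pre_digraph.app_iso_inv)
  ultimately show ?thesis unfolding digraph_iso_def by blast
qed

lemma trivalent_bipartite_iso:
  assumes iso: "digraph_iso G H" and G: "trivalent_bipartite G"
  shows "trivalent_bipartite H"
proof -
  interpret G: fin_digraph G using G by (simp add: trivalent_bipartite_def)
  obtain k where k: "G.digraph_isomorphism k" "H = app_iso k G"
    using iso by (auto simp: digraph_iso_def)
  then have "fin_digraph H" using G.fin_digraphI_app_iso by blast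
  then show ?thesis
    using G k by (auto simp: trivalent_bipartite_def G.in_degree_app_iso_eq G.out_degree_app_iso_eq)
qed

definition web_iso :: "('v, 'e) pre_digraph \<times> nat \<Rightarrow> ('w, 'd) pre_digraph \<times> nat \<Rightarrow> bool" where
  "web_iso \<Gamma> \<Delta> \<longleftrightarrow> digraph_iso (fst \<Gamma>) (fst \<Delta>) \<and> snd \<Gamma> = snd \<Delta>"

lemma web_iso_sym: "web_iso \<Gamma> \<Delta> \<Longrightarrow> web_iso \<Delta> \<Gamma>"
  by (auto simp: web_iso_def digraph_iso_sym)

lemma web_iso_trans: "web_iso \<Gamma> \<Delta> \<Longrightarrow> web_iso \<Delta> \<Theta> \<Longrightarrow> web_iso \<Gamma> \<Theta>"
  unfolding web_iso_def by (metis digraph_iso_trans)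

text \<open>Well-formed input for \<open>splice\<close>: the gluing is a finite partial injection,
  and every end that stays free lies at a vertex. Edges in \<open>Range R\<close> have a glued start
  and those in \<open>Domain R\<close> a glued end, so \<open>t\<close> and \<open>h\<close> are
  constrained only off these sets.\<close>

definition gluing :: "'v set \<Rightarrow> 'e set \<Rightarrow> ('e \<times> 'e) set \<Rightarrow> ('e \<Rightarrow> 'v) \<Rightarrow> ('e \<Rightarrow> 'v) \<Rightarrow> bool" where
  "gluing V E R t h \<longleftrightarrow> finite E \<and> R \<subseteq> E \<times> E \<and> single_valued R \<and> single_valued (R\<inverse>) \<and>
     t ` (E - Range R) \<subseteq> V \<and> h ` (E - Domain R) \<subseteq> V"

text \<open>Pigeonhole: if the chain from \<open>e\<close> never stopped, the successor map would
  inject the finite set of edges reached from \<open>e\<close> into that set without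
  \<open>e\<close>, which has no predecessor.\<close>

lemma chain_end_exists:
  assumes "finite E" "R \<subseteq> E \<times> E" "single_valued R" "single_valued (R\<inverse>)" "e \<notin> Range R"
  shows "\<exists>z. (e, z) \<in> R\<^sup>* \<and> z \<notin> Domain R"
proof (rule ccontr)
  assume no: "\<not> ?thesis"
  define C where "C = R\<^sup>* `` {e}"
  define g where "g u = (THE v. (u, v) \<in> R)" for u
  have g: "(u, g u) \<in> R" if "u \<in> C" for u
    unfolding g_def
    by (rule theI') (use no that assms(3) in \<open>auto simp: C_def dest: single_valuedD\<close>)
  have "C \<subseteq> insert e E"
    unfolding C_def using assms(2) by (auto elim: rtranclE)
  then have fin: "finite C" using assms(1) finite_subset by blast
  have "inj_on g C"
    by (rule inj_onI) (metis g assms(4) converse_iff single_valuedD)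
  moreover have "g ` C \<subseteq> C - {e}"
    using g assms(5) unfolding C_def by (fastforce intro: rtrancl_into_rtrancl)
  ultimately have "card C \<le> card (C - {e})" using fin by (metis card_inj_on_le finite_Diff)
  moreover have "e \<in> C" by (simp add: C_def)
  ultimately show False using fin by (metis card_Diff1_less not_le)
qed

lemma chain_end_unique:
  assumes "single_valued R" "(e, z) \<in> R\<^sup>*" "z \<notin> Domain R" "(e, z') \<in> R\<^sup>*" "z' \<notin> Domain R"
  shows "z' = z"
  using single_valued_confluent[OF assms(1,2,4)] assms(3,5) by (metis DomainI converse_rtranclE)

lemma chain_end_eqI:
  assumes "single_valued R" "(e, z) \<in> R\<^sup>*" "z \<notin> Domain R"
  shows "(THE z. (e, z) \<in> R\<^sup>* \<and> z \<notin> Domain R) = z"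
proof (rule the_equality)
  show "(e, z) \<in> R\<^sup>* \<and> z \<notin> Domain R" using assms by simp
  show "z' = z" if "(e, z') \<in> R\<^sup>* \<and> z' \<notin> Domain R" for z'
    using chain_end_unique[OF assms] that by simp
qed

lemma gluing_chain_end:
  assumes "gluing V E R t h" "e \<in> E - Range R"
  obtains z where "(e, z) \<in> R\<^sup>*" "z \<in> E - Domain R"
    "(THE z. (e, z) \<in> R\<^sup>* \<and> z \<notin> Domain R) = z"
proof -
  obtain z where z: "(e, z) \<in> R\<^sup>*" "z \<notin> Domain R"
    using assms chain_end_exists[of E R e] by (auto simp: gluing_def)
  moreover have "z \<in> E" using z assms by (auto simp: gluing_def elim: rtranclE)
  moreover have "(THE z. (e, z) \<in> R\<^sup>* \<and> z \<notin> Domain R) = z"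
    using z assms chain_end_eqI[of R e z] by (auto simp: gluing_def)
  ultimately show ?thesis using that by blast
qed

lemma wf_digraph_splice:
  assumes "gluing V E R t h"
  shows "wf_digraph (fst (splice V E R t h n))"
proof
  fix e assume "e \<in> arcs (fst (splice V E R t h n))"
  then have e: "e \<in> E - Range R" by (simp add: splice_def)
  show "tail (fst (splice V E R t h n)) e \<in> verts (fst (splice V E R t h n))"
    using e assms by (auto simp: splice_def gluing_def)
  obtain z where "z \<in> E - Domain R" "(THE z. (e, z) \<in> R\<^sup>* \<and> z \<notin> Domain R) = z"
    using gluing_chain_end[OF assms e] by blast
  then show "head (fst (splice V E R t h n)) e \<in> verts (fst (splice V E R t h n))"
    using assms by (auto simp: splice_def gluing_def)
qed

lemma rtrancl_map_prodI: "(u, v) \<in> R\<^sup>* \<Longrightarrow> (\<phi> u, \<phi> v) \<in> (map_prod \<phi> \<phi> ` R)\<^sup>*"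
proof (induction rule: rtrancl_induct)
  case (step y z)
  then show ?case by (force intro: rtrancl_into_rtrancl)
qed simp

lemma trancl_map_prodI: "(u, v) \<in> R\<^sup>+ \<Longrightarrow> (\<phi> u, \<phi> v) \<in> (map_prod \<phi> \<phi> ` R)\<^sup>+"
proof (induction rule: trancl_induct)
  case (base y)
  then show ?case by force
next
  case (step y z)
  then show ?case by (force intro: trancl_into_trancl)
qed

lemma trancl_map_prodE:
  assumes "(\<phi> u, y) \<in> (map_prod \<phi> \<phi> ` R)\<^sup>+" "R \<subseteq> E \<times> E" "inj_on \<phi> E" "u \<in> E"
  shows "\<exists>v \<in> E. y = \<phi> v \<and> (u, v) \<in> R\<^sup>+"
  using assms(1)
proof (induction rule: trancl_induct)
  case (base y)
  then obtain a b where ab: "(a, b) \<in> R" "\<phi> u = \<phi> a" "y = \<phi> b" by auto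
  then have "u = a" using assms by (auto dest: inj_onD)
  then show ?case using ab assms by auto
next
  case (step y z)
  then obtain v where v: "v \<in> E" "y = \<phi> v" "(u, v) \<in> R\<^sup>+" by auto
  from step obtain a b where ab: "(a, b) \<in> R" "y = \<phi> a" "z = \<phi> b" by auto
  then have "v = a" using assms v by (auto dest: inj_onD)
  then show ?case using ab v assms by (auto intro: trancl_into_trancl)
qed

text \<open>Chains and cycles of the gluing are carried along by the injection
  \<open>\<phi>\<close>. Tails need to agree only where a chain begins and heads only where it ends,
  because \<open>splice\<close> reads no other values.\<close>

lemma splice_iso:
  assumes g: "gluing V E R t h" and \<psi>: "inj_on \<psi> V" and \<phi>: "inj_on \<phi> E"
    and V': "V' = \<psi> ` V" and E': "E' = \<phi> ` E" and R': "R' = map_prod \<phi> \<phi> ` R"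
    and t': "\<And>e. e \<in> E \<Longrightarrow> e \<notin> Range R \<Longrightarrow> t' (\<phi> e) = \<psi> (t e)"
    and h': "\<And>e. e \<in> E \<Longrightarrow> e \<notin> Domain R \<Longrightarrow> h' (\<phi> e) = \<psi> (h e)"
  shows "web_iso (splice V E R t h n) (splice V' E' R' t' h' n)"
proof -
  have RE: "R \<subseteq> E \<times> E" and sv: "single_valued R" "single_valued (R\<inverse>)"
    using g by (auto simp: gluing_def)
  have R'_iff: "(\<phi> u, y) \<in> R' \<longleftrightarrow> (\<exists>v. y = \<phi> v \<and> (u, v) \<in> R)"
    "(y, \<phi> u) \<in> R' \<longleftrightarrow> (\<exists>v. y = \<phi> v \<and> (v, u) \<in> R)" if "u \<in> E" for u y
  proof -
    have "u = a" if "\<phi> u = \<phi> a" "a \<in> E" for a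
      using inj_onD[OF \<phi> that(1)] that(2) \<open>u \<in> E\<close> by simp
    then show "(\<phi> u, y) \<in> R' \<longleftrightarrow> (\<exists>v. y = \<phi> v \<and> (u, v) \<in> R)"
      "(y, \<phi> u) \<in> R' \<longleftrightarrow> (\<exists>v. y = \<phi> v \<and> (v, u) \<in> R)"
      using RE unfolding R' by blast+
  qed
  have dom: "\<phi> z \<in> Domain R' \<longleftrightarrow> z \<in> Domain R" "\<phi> z \<in> Range R' \<longleftrightarrow> z \<in> Range R" if "z \<in> E" for z
    using R'_iff[OF that] by (simp_all add: Domain_iff Range_iff)
  have sv': "single_valued R'"
  proof (rule single_valuedI)
    fix x y z assume xyz: "(x, y) \<in> R'" "(x, z) \<in> R'"
    then obtain u where "u \<in> E" "x = \<phi> u" using RE unfolding R' by auto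
    then show "y = z" using xyz R'_iff(1)[of u] sv(1) by (auto dest: single_valuedD)
  qed
  have circ: "R'\<^sup>+ `` {\<phi> e} = \<phi> ` (R\<^sup>+ `` {e})" if "e \<in> E" for e
  proof (intro set_eqI iffI)
    fix y assume "y \<in> R'\<^sup>+ `` {\<phi> e}"
    then show "y \<in> \<phi> ` (R\<^sup>+ `` {e})"
      using trancl_map_prodE[of \<phi> e y R E] RE \<phi> that unfolding R' by auto
  next
    fix y assume "y \<in> \<phi> ` (R\<^sup>+ `` {e})"
    then show "y \<in> R'\<^sup>+ `` {\<phi> e}"
      using trancl_map_prodI[of e _ R \<phi>] unfolding R' by auto
  qed
  have inE: "v \<in> E" if "(u, v) \<in> R\<^sup>+" for u v
    using that RE by (auto elim: tranclE)
  have "{R'\<^sup>+ `` {e} | e. (e, e) \<in> R'\<^sup>+} = image \<phi> ` {R\<^sup>+ `` {e} | e. (e, e) \<in> R\<^sup>+}"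
  proof (intro set_eqI iffI)
    fix S assume "S \<in> {R'\<^sup>+ `` {e} | e. (e, e) \<in> R'\<^sup>+}"
    then obtain y where y: "S = R'\<^sup>+ `` {y}" "(y, y) \<in> R'\<^sup>+" by auto
    then have "y \<in> Range R'" by (metis RangeI tranclE)
    then obtain e where e: "e \<in> E" "y = \<phi> e" using RE unfolding R' by auto
    have "(e, e) \<in> R\<^sup>+"
      using circ[OF e(1)] y(2) e inE \<phi> by (auto dest: inj_onD)
    then show "S \<in> image \<phi> ` {R\<^sup>+ `` {e} | e. (e, e) \<in> R\<^sup>+}"
      using circ[OF e(1)] y(1) e by auto
  next
    fix S assume "S \<in> image \<phi> ` {R\<^sup>+ `` {e} | e. (e, e) \<in> R\<^sup>+}"
    then obtain e where e: "S = \<phi> ` (R\<^sup>+ `` {e})" "(e, e) \<in> R\<^sup>+" by auto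
    then have "S = R'\<^sup>+ `` {\<phi> e}" "(\<phi> e, \<phi> e) \<in> R'\<^sup>+"
      using circ[of e] inE[of e e] by auto
    then show "S \<in> {R'\<^sup>+ `` {e} | e. (e, e) \<in> R'\<^sup>+}" by blast
  qed
  moreover have "inj_on (image \<phi>) {R\<^sup>+ `` {e} | e. (e, e) \<in> R\<^sup>+}"
    by (rule inj_on_subset[OF inj_on_image_Pow[OF \<phi>]]) (auto simp: inE)
  ultimately have "card {R'\<^sup>+ `` {e} | e. (e, e) \<in> R'\<^sup>+} = card {R\<^sup>+ `` {e} | e. (e, e) \<in> R\<^sup>+}"
    by (simp add: card_image)
  moreover have "digraph_iso (fst (splice V E R t h n)) (fst (splice V' E' R' t' h' n))"
  proof (rule digraph_isoI[of _ \<psi> \<phi>])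
    show "wf_digraph (fst (splice V E R t h n))" by (rule wf_digraph_splice[OF g])
    show "inj_on \<psi> (verts (fst (splice V E R t h n)))" using \<psi> by (simp add: splice_def)
    show "inj_on \<phi> (arcs (fst (splice V E R t h n)))"
      using \<phi> by (auto simp: splice_def intro: inj_on_subset)
    show "verts (fst (splice V' E' R' t' h' n)) = \<psi> ` verts (fst (splice V E R t h n))"
      by (simp add: splice_def V')
    show "arcs (fst (splice V' E' R' t' h' n)) = \<phi> ` arcs (fst (splice V E R t h n))"
      using dom(2) by (simp add: splice_def E') blast
    fix e assume "e \<in> arcs (fst (splice V E R t h n))"
    then have e: "e \<in> E - Range R" by (simp add: splice_def)
    then show "tail (fst (splice V' E' R' t' h' n)) (\<phi> e) = \<psi> (tail (fst (splice V E R t h n)) e)"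
      using t' by (simp add: splice_def)
    obtain z where z: "(e, z) \<in> R\<^sup>*" "z \<in> E - Domain R" "(THE z. (e, z) \<in> R\<^sup>* \<and> z \<notin> Domain R) = z"
      using gluing_chain_end[OF g e] by blast
    have "(THE z. (\<phi> e, z) \<in> R'\<^sup>* \<and> z \<notin> Domain R') = \<phi> z"
      by (rule chain_end_eqI[OF sv']) (use z dom rtrancl_map_prodI R' in auto)
    then show "head (fst (splice V' E' R' t' h' n)) (\<phi> e) = \<psi> (head (fst (splice V E R t h n)) e)"
      using z h' by (simp add: splice_def)
  qed
  ultimately show ?thesis by (simp add: web_iso_def splice_def)
qed

text \<open>When each edge has at most one successor, a path that starts on a cycle cannot leave
  it.\<close>

lemma cycle_back:
  assumes sv: "single_valued R" and e: "(e, e) \<in> R\<^sup>+" and y: "(e, y) \<in> R\<^sup>+"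
  shows "(y, e) \<in> R\<^sup>*"
proof -
  have "(e, y) \<in> R\<^sup>*" using y by simp
  then show ?thesis
  proof (induction rule: rtrancl_induct)
    case (step y z)
    have "(y, e) \<in> R\<^sup>+" using step.IH e by simp
    then obtain w where "(y, w) \<in> R" "(w, e) \<in> R\<^sup>*" by (meson tranclD)
    then show ?case using step sv by (auto dest: single_valuedD)
  qed simp
qed

text \<open>The edges in \<open>Y\<close> each have a predecessor, so none of them names a chain,
  and they can be dissolved: \<open>R'\<close> jumps over the runs through \<open>Y\<close>. Two
  corrections are needed. A cycle inside \<open>Y\<close> disappears from the gluing and is added to
  the circle count, and if a chain ends inside \<open>Y\<close>, its last edge outside
  \<open>Y\<close> takes over the head.\<close>

lemma splice_absorb:
  assumes g: "gluing V E R t h" and Y: "Y \<subseteq> Range R"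
    and R': "R' = {(u, v). (u, v) \<in> R O (R \<inter> Y \<times> UNIV)\<^sup>* \<and> u \<notin> Y \<and> v \<notin> Y}"
    and t': "\<And>e. e \<in> E - Range R \<Longrightarrow> t' e = t e"
    and h': "\<And>e. e \<in> E - Y - Domain R \<Longrightarrow> h' e = h e"
    and h'': "\<And>e z. e \<in> E - Y \<Longrightarrow> (e, z) \<in> R O (R \<inter> Y \<times> UNIV)\<^sup>* \<Longrightarrow> z \<in> Y - Domain R \<Longrightarrow> h' e = h z"
  shows "web_iso (splice V E R t h n)
      (splice V (E - Y) R' t' h' (n + card {R\<^sup>+ `` {e} | e. (e, e) \<in> R\<^sup>+ \<and> R\<^sup>+ `` {e} \<subseteq> Y}))" (is ?iso)
    and "gluing V (E - Y) R' t' h'"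
proof -
  define S where "S = R \<inter> Y \<times> UNIV"
  have fin: "finite E" and RE: "R \<subseteq> E \<times> E" and sv: "single_valued R" "single_valued (R\<inverse>)"
    using g by (auto simp: gluing_def)
  have svS: "single_valued S" "single_valued (S\<inverse>)"
    using sv unfolding S_def by (auto simp: single_valued_def)
  have R'_iff: "(u, v) \<in> R' \<longleftrightarrow> (u, v) \<in> R O S\<^sup>* \<and> u \<notin> Y \<and> v \<notin> Y" for u v
    by (simp add: R' S_def)
  have stopS: "z = v" if "(z, v) \<in> S\<^sup>*" "z \<notin> Y \<or> z \<notin> Domain R" for z v
    using that by (cases rule: converse_rtranclE) (auto simp: S_def)
  \<comment> \<open>By confluence one continuation of \<open>u\<close> through \<open>Y\<close>
    prolongs the other; neither of two that cannot be prolonged inside \<open>Y\<close> can be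
    proper.\<close>
  have comparable: "z = z'"
    if uz: "(u, z) \<in> R O S\<^sup>*" "(u, z') \<in> R O S\<^sup>*" and stop: "z \<notin> Y \<or> z \<notin> Domain R" "z' \<notin> Y \<or> z' \<notin> Domain R" for u z z'
  proof -
    obtain w where w: "(u, w) \<in> R" "(w, z) \<in> S\<^sup>*" using uz(1) by (elim relcompE) simp
    obtain w' where w': "(u, w') \<in> R" "(w', z') \<in> S\<^sup>*" using uz(2) by (elim relcompE) simp
    have "w = w'" using w w' sv(1) by (auto dest: single_valuedD)
    then show ?thesis
      using single_valued_confluent[OF svS(1) w(2)] w'(2) stopS stop by metis
  qed
  have sv'1: "single_valued R'"
    by (rule single_valuedI) (use comparable R'_iff in blast)
  have backS: "u = u'" if uv: "(u, v) \<in> R O S\<^sup>*" "(u', v) \<in> R O S\<^sup>*" and offY: "u \<notin> Y" "u' \<notin> Y" for u u' v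
  proof -
    have aux: "u' = u" if p: "(w, w') \<in> S\<^sup>*" "(u, w) \<in> R" "(u', w') \<in> R" "u \<notin> Y" "u' \<notin> Y" for u u' w w'
      using p(1)
    proof (cases rule: rtranclE)
      case base
      then show ?thesis using p sv(2) by (auto dest: single_valuedD)
    next
      case (step y)
      then have "y = u'" "y \<in> Y" using p sv(2) by (auto simp: S_def dest: single_valuedD)
      then show ?thesis using p by simp
    qed
    obtain w where w: "(u, w) \<in> R" "(w, v) \<in> S\<^sup>*" using uv(1) by (elim relcompE) simp
    obtain w' where w': "(u', w') \<in> R" "(w', v) \<in> S\<^sup>*" using uv(2) by (elim relcompE) simp
    have "(w, w') \<in> S\<^sup>* \<or> (w', w) \<in> S\<^sup>*"
      using single_valued_confluent[OF svS(2), of v w w'] w w' by (simp add: rtrancl_converse) blast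
    then show ?thesis using aux[of w w' u u'] aux[of w' w u' u] w w' offY by blast
  qed
  have sv'2: "single_valued (R'\<inverse>)"
    by (rule single_valuedI) (use backS R'_iff in blast)
  have fwd: "(u, v) \<in> R\<^sup>*" if "(u, v) \<in> R'\<^sup>*" for u v
    using that
  proof (induction rule: rtrancl_induct)
    case (step y z)
    have "S\<^sup>* \<subseteq> R\<^sup>*" unfolding S_def by (rule rtrancl_mono) auto
    then have "(y, z) \<in> R\<^sup>*" using step(2) unfolding R'_iff by (auto intro: converse_rtrancl_into_rtrancl)
    then show ?case using step by auto
  qed simp
  have R'_trancl: "R' \<subseteq> R\<^sup>+"
  proof -
    have "S\<^sup>* \<subseteq> R\<^sup>*" unfolding S_def by (rule rtrancl_mono) auto
    then show ?thesis unfolding R' S_def[symmetric] by (auto intro: rtrancl_into_trancl2)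
  qed
  \<comment> \<open>A path of \<open>R\<close> that starts outside \<open>Y\<close> is cut at its
    visits outside \<open>Y\<close> into steps of \<open>R'\<close>. If it ends inside
    \<open>Y\<close>, an unfinished last step remains, which starts at \<open>w\<close>.\<close>
  have lift: "if v \<in> Y then \<exists>w. w \<notin> Y \<and> (u, w) \<in> R'\<^sup>* \<and> (w, v) \<in> R O S\<^sup>* else (u, v) \<in> R'\<^sup>*"
    if "(u, v) \<in> R\<^sup>*" "u \<notin> Y" for u v
    using that(1)
  proof (induction rule: rtrancl_induct)
    case base
    then show ?case using that(2) by simp
  next
    case (step y z)
    obtain w where w: "w \<notin> Y" "(u, w) \<in> R'\<^sup>*" "(w, z) \<in> R O S\<^sup>*"
    proof (cases "y \<in> Y")
      case True
      then obtain w where w: "w \<notin> Y" "(u, w) \<in> R'\<^sup>*" "(w, y) \<in> R O S\<^sup>*" using step.IH by auto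
      moreover have "(y, z) \<in> S" using True step by (simp add: S_def)
      ultimately have "(w, z) \<in> R O S\<^sup>*" by (auto intro: rtrancl_into_rtrancl)
      then show ?thesis using that w by blast
    next
      case False
      then show ?thesis using that[of y] step by auto
    qed
    then show ?case using R'_iff[of w z] by (auto intro: rtrancl_into_rtrancl)
  qed
  have lift_trancl: "(u, v) \<in> R'\<^sup>+ \<longleftrightarrow> (u, v) \<in> R\<^sup>+" if uv: "u \<notin> Y" "v \<notin> Y" for u v
  proof
    assume "(u, v) \<in> R'\<^sup>+"
    then show "(u, v) \<in> R\<^sup>+" using trancl_mono_subset[OF R'_trancl] by auto
  next
    assume "(u, v) \<in> R\<^sup>+"
    then obtain y where y: "(u, y) \<in> R\<^sup>*" "(y, v) \<in> R" by (metis tranclD2)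
    show "(u, v) \<in> R'\<^sup>+"
    proof (cases "y \<in> Y")
      case True
      then obtain w where w: "w \<notin> Y" "(u, w) \<in> R'\<^sup>*" "(w, y) \<in> R O S\<^sup>*" using lift[OF y(1) uv(1)] by auto
      moreover have "(y, v) \<in> S" using True y by (simp add: S_def)
      ultimately have "(w, v) \<in> R'" unfolding R'_iff using uv by (auto intro: rtrancl_into_rtrancl)
      then show ?thesis using w by (meson rtrancl_into_trancl1)
    next
      case False
      then have "(u, y) \<in> R'\<^sup>*" using lift[OF y(1) uv(1)] by simp
      moreover have "(y, v) \<in> R'" unfolding R'_iff using y uv False by auto
      ultimately show ?thesis by (meson rtrancl_into_trancl1)
    qed
  qed
  have off: "u \<notin> Y" "v \<notin> Y" if "(u, v) \<in> R'\<^sup>+" for u v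
    using that by (meson R'_iff tranclD, meson R'_iff tranclD2)
  \<comment> \<open>Going back from \<open>v\<close> along \<open>R\<close> must leave
    \<open>Y\<close> at some time. Otherwise all ancestors of \<open>v\<close> form a finite set
    \<open>B\<close> inside \<open>Y\<close>, and the predecessor map would inject \<open>B\<close>
    together with \<open>v\<close> into \<open>B\<close>.\<close>
  have range: "v \<in> Range R' \<longleftrightarrow> v \<in> Range R" if v: "v \<notin> Y" for v
  proof
    assume "v \<in> Range R'"
    then show "v \<in> Range R"
      using R'_trancl by (metis Range_iff subsetD tranclD2)
  next
    assume vR: "v \<in> Range R"
    show "v \<in> Range R'"
    proof (rule ccontr)
      assume no: "v \<notin> Range R'"
      define B where "B = {u. (u, v) \<in> S\<^sup>+}"
      have pre: "u \<in> B" if "(u, w) \<in> R" "w = v \<or> w \<in> B" for u w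
      proof -
        have "(w, v) \<in> S\<^sup>*" using that by (auto simp: B_def)
        then have "u \<in> Y" using no v that unfolding Range_iff R'_iff by blast
        then have "(u, w) \<in> S" using that by (simp add: S_def)
        then show ?thesis using \<open>(w, v) \<in> S\<^sup>*\<close> by (simp add: B_def rtrancl_into_trancl2)
      qed
      have BY: "B \<subseteq> Y"
        unfolding B_def by (auto simp: S_def dest: tranclD)
      have BE: "B \<subseteq> E"
        using RE unfolding B_def by (auto simp: S_def dest: tranclD)
      then have finB: "finite B" using fin finite_subset by blast
      define p where "p w = (THE u. (u, w) \<in> R)" for w
      have p: "(p w, w) \<in> R" if "w = v \<or> w \<in> B" for w
      proof -
        have "w \<in> Range R" using that vR BY Y by blast
        then obtain u where "(u, w) \<in> R" by (rule RangeE)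
        then show ?thesis unfolding p_def
          by (rule theI) (use \<open>(u, w) \<in> R\<close> sv(2) in \<open>auto dest: single_valuedD\<close>)
      qed
      have "inj_on p (insert v B)"
        by (rule inj_onI) (metis p insert_iff sv(1) single_valuedD)
      moreover have "p ` insert v B \<subseteq> B" using p pre by auto
      ultimately have "card (insert v B) \<le> card B" using finB by (metis card_inj_on_le)
      moreover have "v \<notin> B" using BY v by auto
      ultimately show False using finB by simp
    qed
  qed
  have dom: "z \<in> Domain R' \<Longrightarrow> z \<in> Domain R" for z
    using R'_trancl by (metis Domain_iff subsetD tranclD)
  \<comment> \<open>A cycle of \<open>R\<close> lies inside \<open>Y\<close> or has an edge outside.
    Cycles of the second kind lose their part in \<open>Y\<close> and become the cycles of
    \<open>R'\<close>; none are merged, because two cycles with a common edge are equal.\<close>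
  have circles: "card {R\<^sup>+ `` {e} | e. (e, e) \<in> R\<^sup>+} =
      card {R\<^sup>+ `` {e} | e. (e, e) \<in> R\<^sup>+ \<and> R\<^sup>+ `` {e} \<subseteq> Y} + card {R'\<^sup>+ `` {e} | e. (e, e) \<in> R'\<^sup>+}"
  proof -
    let ?C = "{R\<^sup>+ `` {e} | e. (e, e) \<in> R\<^sup>+}" and ?CY = "{R\<^sup>+ `` {e} | e. (e, e) \<in> R\<^sup>+ \<and> R\<^sup>+ `` {e} \<subseteq> Y}"
    let ?CN = "{R\<^sup>+ `` {e} | e. (e, e) \<in> R\<^sup>+ \<and> e \<notin> Y}"
    have cyc: "R\<^sup>+ `` {e'} = R\<^sup>+ `` {e}" if ee: "(e, e) \<in> R\<^sup>+" and ee': "(e, e') \<in> R\<^sup>+" for e e'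
      using cycle_back[OF sv(1) ee] ee' by (auto intro: trancl_trans rtrancl_trancl_trancl)
    have "?C \<subseteq> Pow E" using RE by (auto dest: tranclD2)
    then have finC: "finite ?C" using fin by (meson finite_Pow_iff finite_subset)
    have "?C = ?CY \<union> ?CN"
    proof (intro set_eqI iffI)
      fix X assume "X \<in> ?C"
      then obtain e where e: "X = R\<^sup>+ `` {e}" "(e, e) \<in> R\<^sup>+" by auto
      show "X \<in> ?CY \<union> ?CN"
      proof (cases "X \<subseteq> Y")
        case False
        then obtain e' where e': "(e, e') \<in> R\<^sup>+" "e' \<notin> Y" using e by auto
        then have "R\<^sup>+ `` {e'} = X" "(e', e') \<in> R\<^sup>+" using cyc[OF e(2) e'(1)] e by auto
        then show ?thesis using e' by blast
      qed (use e in auto)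
    qed auto
    moreover have "?CY \<inter> ?CN = {}" by auto
    ultimately have "card ?C = card ?CY + card ?CN"
      using finC by (simp add: card_Un_disjoint)
    moreover have "{R'\<^sup>+ `` {e} | e. (e, e) \<in> R'\<^sup>+} = (\<lambda>X. X - Y) ` ?CN"
    proof -
      have *: "R'\<^sup>+ `` {e} = R\<^sup>+ `` {e} - Y" if "e \<notin> Y" for e
        using lift_trancl[OF that] off by blast
      show ?thesis
      proof (intro set_eqI iffI)
        fix X assume "X \<in> {R'\<^sup>+ `` {e} | e. (e, e) \<in> R'\<^sup>+}"
        then obtain e where "X = R'\<^sup>+ `` {e}" "(e, e) \<in> R'\<^sup>+" by auto
        then show "X \<in> (\<lambda>X. X - Y) ` ?CN" using *[of e] off[of e e] lift_trancl[of e e] by auto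
      next
        fix X assume "X \<in> (\<lambda>X. X - Y) ` ?CN"
        then obtain e where "X = R\<^sup>+ `` {e} - Y" "(e, e) \<in> R\<^sup>+" "e \<notin> Y" by auto
        then have "X = R'\<^sup>+ `` {e}" "(e, e) \<in> R'\<^sup>+" using *[of e] lift_trancl[of e e] by auto
        then show "X \<in> {R'\<^sup>+ `` {e} | e. (e, e) \<in> R'\<^sup>+}" by blast
      qed
    qed
    moreover have "inj_on (\<lambda>X. X - Y) ?CN"
    proof (rule inj_onI)
      fix X X' assume "X \<in> ?CN" "X' \<in> ?CN" and eq: "X - Y = X' - Y"
      then obtain e e' where e: "X = R\<^sup>+ `` {e}" "(e, e) \<in> R\<^sup>+" "e \<notin> Y"
        and e': "X' = R\<^sup>+ `` {e'}" "(e', e') \<in> R\<^sup>+" by auto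
      then have "(e', e) \<in> R\<^sup>+" using eq by auto
      then show "X = X'" using cyc[of e' e] e e' by simp
    qed
    ultimately show ?thesis by (simp add: card_image)
  qed
  have "digraph_iso (fst (splice V E R t h n)) (fst (splice V (E - Y) R' t' h' m))" for m
  proof (rule digraph_isoI[of _ id id])
    show "wf_digraph (fst (splice V E R t h n))" by (rule wf_digraph_splice[OF g])
    show "verts (fst (splice V (E - Y) R' t' h' m)) = id ` verts (fst (splice V E R t h n))"
      by (simp add: splice_def)
    show "arcs (fst (splice V (E - Y) R' t' h' m)) = id ` arcs (fst (splice V E R t h n))"
      using range Y by (auto simp: splice_def)
    fix e assume "e \<in> arcs (fst (splice V E R t h n))"
    then have e: "e \<in> E - Range R" by (simp add: splice_def)
    then have eY: "e \<notin> Y" using Y by auto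
    show "tail (fst (splice V (E - Y) R' t' h' m)) (id e) = id (tail (fst (splice V E R t h n)) e)"
      using t' e by (simp add: splice_def)
    obtain z where z: "(e, z) \<in> R\<^sup>*" "z \<in> E - Domain R" "(THE z. (e, z) \<in> R\<^sup>* \<and> z \<notin> Domain R) = z"
      using gluing_chain_end[OF g e] by blast
    have "h' (THE z. (e, z) \<in> R'\<^sup>* \<and> z \<notin> Domain R') = h z"
    proof (cases "z \<in> Y")
      case False
      then have "(e, z) \<in> R'\<^sup>*" using lift[OF z(1) eY] by simp
      then have "(THE z. (e, z) \<in> R'\<^sup>* \<and> z \<notin> Domain R') = z"
        using chain_end_eqI[OF sv'1] dom z by blast
      then show ?thesis using h'[of z] z False by simp
    next
      case True
      then obtain w where w: "w \<notin> Y" "(e, w) \<in> R'\<^sup>*" "(w, z) \<in> R O S\<^sup>*" using lift[OF z(1) eY] by auto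
      \<comment> \<open>The old chain stops inside \<open>Y\<close>, so the contracted chain stops
        at \<open>w\<close>, and \<open>h' w\<close> was prescribed to be the old head.\<close>
      have "w \<notin> Domain R'"
      proof
        assume "w \<in> Domain R'"
        then obtain v where "(w, v) \<in> R O S\<^sup>*" "v \<notin> Y" unfolding Domain_iff R'_iff by blast
        then show False using comparable[of w v z] w z True by auto
      qed
      then have "(THE z. (e, z) \<in> R'\<^sup>* \<and> z \<notin> Domain R') = w"
        using chain_end_eqI[OF sv'1] w by blast
      moreover have "w \<in> E" using w(3) RE by auto
      ultimately show ?thesis using h''[of w z] w z True unfolding S_def by simp
    qed
    then show "head (fst (splice V (E - Y) R' t' h' m)) (id e) = id (head (fst (splice V E R t h n)) e)"
      using z by (simp add: splice_def)
  qed simp_all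
  then show ?iso
    using circles by (simp add: web_iso_def splice_def)
  have "R' \<subseteq> (E - Y) \<times> (E - Y)"
  proof -
    have "R O S\<^sup>* \<subseteq> E \<times> E"
    proof
      fix p assume "p \<in> R O S\<^sup>*"
      then obtain u v w where "p = (u, v)" "(u, w) \<in> R" "(w, v) \<in> S\<^sup>*" by auto
      moreover from this(3) have "w = v \<or> v \<in> E" using RE by (cases rule: rtranclE) (auto simp: S_def)
      ultimately show "p \<in> E \<times> E" using RE by auto
    qed
    then show ?thesis using R'_iff by auto
  qed
  moreover have "t' ` (E - Y - Range R') \<subseteq> V"
    using g t' range by (auto simp: gluing_def image_subset_iff)
  moreover have "h' e \<in> V" if e: "e \<in> E - Y - Domain R'" for e
  proof (cases "e \<in> Domain R")
    case False
    then show ?thesis using g h' e by (auto simp: gluing_def image_subset_iff)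
  next
    case True
    then obtain w where w: "(e, w) \<in> R" by auto
    have "w \<notin> Range S" using w e sv(2) by (auto simp: S_def dest: single_valuedD)
    then obtain z where z: "(w, z) \<in> S\<^sup>*" "z \<notin> Domain S"
      using chain_end_exists[of E S w] fin RE svS by (auto simp: S_def)
    have ez: "(e, z) \<in> R O S\<^sup>*" using w z by auto
    have "z \<in> Y" using e ez R'_iff[of e z] by auto
    then have zD: "z \<notin> Domain R" using z by (auto simp: S_def)
    have "z \<in> E" using w z(1) RE by (auto simp: S_def elim: rtranclE)
    then have "h z \<in> V" using g zD by (auto simp: gluing_def)
    then show ?thesis using h''[of e z] ez e zD \<open>z \<in> Y\<close> unfolding S_def by simp
  qed
  ultimately show "gluing V (E - Y) R' t' h'"
    using fin sv'1 sv'2 by (auto simp: gluing_def)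
qed


section \<open>Invariance of f under isomorphism\<close>

lemma resolve_iso:
  assumes wf: "wf_digraph G" and \<psi>: "inj_on \<psi> (verts G)" and \<phi>: "inj_on \<phi> (arcs G)"
    and H: "verts H = \<psi> ` verts G" "arcs H = \<phi> ` arcs G"
      "\<And>a. a \<in> arcs G \<Longrightarrow> tail H (\<phi> a) = \<psi> (tail G a)"
      "\<And>a. a \<in> arcs G \<Longrightarrow> head H (\<phi> a) = \<psi> (head G a)"
    and B: "B \<subseteq> arcs G"
    and g: "gluing (verts G - (tail G ` B \<union> head G ` B)) (arcs G - B) R (tail G) (head G)"
    and B': "B' = \<phi> ` B" and R': "R' = map_prod \<phi> \<phi> ` R"
  shows "web_iso (resolve B R (G, n)) (resolve B' R' (H, n))"
  unfolding resolve_def prod.case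
proof (rule splice_iso[OF g, of \<psi> \<phi>])
  show "inj_on \<psi> (verts G - (tail G ` B \<union> head G ` B))" using \<psi> by (rule inj_on_subset) auto
  show "inj_on \<phi> (arcs G - B)" using \<phi> by (rule inj_on_subset) auto
  show "arcs H - B' = \<phi> ` (arcs G - B)"
    unfolding B' H using inj_on_image_set_diff[OF \<phi>, of "arcs G" B] B by simp
  have sub: "tail G ` B \<union> head G ` B \<subseteq> verts G" using B wf by (auto simp: wf_digraph_def)
  have "tail H ` B' = \<psi> ` tail G ` B" "head H ` B' = \<psi> ` head G ` B"
    unfolding B' image_image using B H by (auto intro!: image_cong)
  then show "verts H - (tail H ` B' \<union> head H ` B') = \<psi> ` (verts G - (tail G ` B \<union> head G ` B))"
    using inj_on_image_set_diff[OF \<psi>, of "verts G" "tail G ` B \<union> head G ` B"] sub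
    by (simp add: H image_Un)
qed (use H R' in auto)

text \<open>Graphs of nets have generators as vertices and labels as arcs, whereas \<open>f\<close>
  accepts only the type \<open>graph\<close>. Finite sets embed into the natural numbers, so copies
  of the required type are available.\<close>

lemma graph_copy_exists:
  fixes G :: "('v, 'e) pre_digraph"
  assumes "fin_digraph G"
  shows "\<exists>H :: graph. digraph_iso G H"
proof -
  interpret fin_digraph G by fact
  obtain a :: "'v \<Rightarrow> nat" where a: "inj_on a (verts G)" using finite_imp_inj_to_nat_seg[OF finite_verts] by blast
  obtain b :: "'e \<Rightarrow> nat" where b: "inj_on b (arcs G)" using finite_imp_inj_to_nat_seg[OF finite_arcs] by blast
  define \<psi> :: "'v \<Rightarrow> nat \<times> bool" where "\<psi> v = (a v, True)" for v
  define \<phi> :: "'e \<Rightarrow> nat \<times> bool option" where "\<phi> e = (b e, None)" for e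
  have \<psi>: "inj_on \<psi> (verts G)" and \<phi>: "inj_on \<phi> (arcs G)"
    using a b by (auto simp: \<psi>_def \<phi>_def inj_on_def)
  let ?H = "\<lparr>verts = \<psi> ` verts G, arcs = \<phi> ` arcs G,
    tail = \<psi> \<circ> tail G \<circ> the_inv_into (arcs G) \<phi>, head = \<psi> \<circ> head G \<circ> the_inv_into (arcs G) \<phi>\<rparr>"
  have "digraph_iso G ?H"
    by (rule digraph_isoI[of G \<psi> \<phi>])
      (use \<psi> \<phi> in \<open>simp_all add: the_inv_into_f_f wf_digraph_axioms\<close>)
  then show ?thesis ..
qed

lemma A_pow_add: "A_pow (m + n) = A_pow m * A_pow n"
  by (simp add: A_pow_def mult_single)

lemma A_pow_0: "A_pow 0 = 1"
  by (simp add: A_pow_def)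

lemma trivalent_bipartite_web_iso:
  "trivalent_bipartite (fst \<Gamma>) \<Longrightarrow> web_iso \<Gamma> \<Delta> \<Longrightarrow> trivalent_bipartite (fst \<Delta>)"
  by (simp add: web_iso_def trivalent_bipartite_iso[of "fst \<Gamma>"])

definition circle_value :: coeff where "circle_value = A_pow 6 + 1 + A_pow (- 6)"
definition bigon_value :: coeff where "bigon_value = A_pow 3 + A_pow (- 3)"

locale kuperberg =
  fixes f :: "web \<Rightarrow> coeff"
  assumes f: "kuperberg_map f"
begin

text \<open>Extends \<open>f\<close> to graphs over arbitrary types of vertices and arcs by
  evaluating an isomorphic copy; \<open>val_copy\<close> shows that the choice does not matter for
  trivalent bipartite graphs.\<close>

definition val :: "('v, 'e) pre_digraph \<times> nat \<Rightarrow> coeff" where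
  "val \<Gamma> = f (SOME G. digraph_iso (fst \<Gamma>) G, snd \<Gamma>)"

lemma f_iso: "trivalent_bipartite G \<Longrightarrow> digraph_iso G H \<Longrightarrow> f (G, n) = f (H, n)"
  using f by (auto simp: kuperberg_map_def)

lemmas f_union = f[unfolded kuperberg_map_def, THEN conjunct2, THEN conjunct1, rule_format]

lemmas f_circle = f[unfolded kuperberg_map_def, THEN conjunct2, THEN conjunct2, THEN conjunct2,
    THEN conjunct1, rule_format, folded circle_value_def]

lemmas f_bigon = f[unfolded kuperberg_map_def, THEN conjunct2, THEN conjunct2, THEN conjunct2,
    THEN conjunct2, THEN conjunct1, rule_format, folded bigon_value_def]

lemmas f_quadrilateral = f[unfolded kuperberg_map_def, THEN conjunct2, THEN conjunct2, THEN conjunct2,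
    THEN conjunct2, THEN conjunct2, rule_format]

lemma val_copy:
  assumes G: "trivalent_bipartite G" and H: "digraph_iso G H"
  shows "val (G, n) = f (H, n)"
proof -
  let ?H = "SOME H :: graph. digraph_iso G H"
  have iso: "digraph_iso G ?H" using H by (rule someI)
  then have "digraph_iso ?H H" using digraph_iso_trans[OF digraph_iso_sym H] by blast
  then show ?thesis using f_iso trivalent_bipartite_iso[OF iso G] by (simp add: val_def)
qed

lemma val_web:
  fixes \<Gamma> :: web
  assumes "trivalent_bipartite (fst \<Gamma>)"
  shows "val \<Gamma> = f \<Gamma>"   using val_copy[OF assms digraph_iso_refl, of "snd \<Gamma>"] assms
  by (simp add: trivalent_bipartite_def fin_digraph_def)

lemma val_iso:
  assumes G: "trivalent_bipartite (fst \<Gamma>)" and iso: "web_iso \<Gamma> \<Delta>"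
  shows "val \<Gamma> = val \<Delta>"
proof -
  have iso': "digraph_iso (fst \<Gamma>) (fst \<Delta>)" using iso by (simp add: web_iso_def)
  then have \<Delta>: "trivalent_bipartite (fst \<Delta>)" by (rule trivalent_bipartite_iso) (rule G)
  then obtain H :: graph where H: "digraph_iso (fst \<Delta>) H"
    using graph_copy_exists[of "fst \<Delta>"] by (auto simp: trivalent_bipartite_def)
  show ?thesis
    using val_copy[OF \<Delta> H] val_copy[OF G digraph_iso_trans[OF iso' H]] iso
    by (metis prod.collapse web_iso_def)
qed

lemma val_circle:
  assumes G: "trivalent_bipartite G"
  shows "val (G, Suc n) = circle_value * val (G, n)"
proof -
  obtain H :: graph where H: "digraph_iso G H"
    using G graph_copy_exists[of G] by (auto simp: trivalent_bipartite_def)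
  then have triv: "trivalent_bipartite H" by (rule trivalent_bipartite_iso) (rule G)
  \<comment> \<open>The circle is a disjoint union with a graph without vertices. It borrows the
    functions \<open>tail H\<close> and \<open>head H\<close>, since \<open>compatible\<close>
    compares them as functions.\<close>
  let ?E = "\<lparr>verts = {}, arcs = {}, tail = tail H, head = head H\<rparr>"
  have "trivalent_bipartite ?E"
    by (auto simp: trivalent_bipartite_def fin_digraph_def wf_digraph_def fin_digraph_axioms_def)
  then have "f (union H ?E, n + 1) = f (H, n) * f (?E, 1)"
    using f_union[of H ?E n 1] triv by (simp add: compatible_def)
  moreover have "union H ?E = H" by (simp add: union_def)
  moreover have "f (?E, 1) = circle_value"
    using f_circle[of ?E] by simp
  ultimately show ?thesis using val_copy[OF G H] by (simp add: mult.commute)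
qed

text \<open>The relation is read off on a copy of type \<open>graph\<close>. The assumptions
  \<open>g\<close> and \<open>triv\<close> about the resolved graph allow the resolution to be
  carried to the copy and its value to be brought back.\<close>

lemma val_bigon:
  assumes G: "trivalent_bipartite G" and b: "bigon G a b"
    and e: "{e, e'} \<subseteq> arcs G - {a, b}" "tail G e = tail G a" "head G e' = head G a"
    and g: "gluing (verts G - (tail G ` {a, b} \<union> head G ` {a, b})) (arcs G - {a, b}) {(e', e)} (tail G) (head G)"
    and triv: "trivalent_bipartite (fst (resolve {a, b} {(e', e)} (G, n)))"
  shows "val (G, n) = bigon_value * val (resolve {a, b} {(e', e)} (G, n))"
proof -
  obtain H :: graph where H: "digraph_iso G H"
    using G graph_copy_exists[of G] by (auto simp: trivalent_bipartite_def)
  from H obtain \<psi> \<phi> where iso: "wf_digraph G" "inj_on \<psi> (verts G)" "inj_on \<phi> (arcs G)"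
    "verts H = \<psi> ` verts G" "arcs H = \<phi> ` arcs G"
    "\<And>a. a \<in> arcs G \<Longrightarrow> tail H (\<phi> a) = \<psi> (tail G a)"
    "\<And>a. a \<in> arcs G \<Longrightarrow> head H (\<phi> a) = \<psi> (head G a)"
    by (elim digraph_isoE) blast
  have inV: "tail G x \<in> verts G" "head G x \<in> verts G" if "x \<in> arcs G" for x
    using iso(1) that by (auto simp: wf_digraph_def)
  have "bigon H (\<phi> a) (\<phi> b)"
    using b iso inV[of a] by (auto simp: bigon_def inj_on_eq_iff)
  moreover have "{\<phi> e, \<phi> e'} \<subseteq> arcs H - {\<phi> a, \<phi> b}"
    "tail H (\<phi> e) = tail H (\<phi> a)" "head H (\<phi> e') = head H (\<phi> a)"
    using e b iso by (auto simp: inj_on_eq_iff bigon_def)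
  ultimately have "f (H, n) = bigon_value * f (resolve {\<phi> a, \<phi> b} {(\<phi> e', \<phi> e)} (H, n))"
    using f_bigon[of H "\<phi> a" "\<phi> b" "\<phi> e" "\<phi> e'" n] trivalent_bipartite_iso[OF H G] by simp
  moreover have res: "web_iso (resolve {a, b} {(e', e)} (G, n)) (resolve {\<phi> a, \<phi> b} {(\<phi> e', \<phi> e)} (H, n))"
    by (rule resolve_iso[OF iso _ g]) (use b in \<open>auto simp: bigon_def\<close>)
  moreover have "trivalent_bipartite (fst (resolve {\<phi> a, \<phi> b} {(\<phi> e', \<phi> e)} (H, n)))"
    using trivalent_bipartite_web_iso[OF triv res] .
  ultimately show ?thesis
    using val_copy[OF G H] val_iso[OF triv res] val_web[of "resolve {\<phi> a, \<phi> b} {(\<phi> e', \<phi> e)} (H, n)"] by simp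
qed

lemma val_quadrilateral:
  fixes G :: "('v, 'e) pre_digraph"
  assumes G: "trivalent_bipartite G" and q: "quadrilateral G a b c d"
    and e: "{e1, e2, e3, e4} \<subseteq> arcs G - {a, b, c, d}" "tail G e1 = tail G a" "head G e2 = head G a"
      "tail G e3 = tail G c" "head G e4 = head G c"
    and R: "R1 = {(e2, e1), (e4, e3)}" "R2 = {(e2, e3), (e4, e1)}"
    and g: "\<And>R. R \<in> {R1, R2} \<Longrightarrow> gluing (verts G - (tail G ` {a, b, c, d} \<union> head G ` {a, b, c, d}))
        (arcs G - {a, b, c, d}) R (tail G) (head G)"
    and triv: "\<And>R. R \<in> {R1, R2} \<Longrightarrow> trivalent_bipartite (fst (resolve {a, b, c, d} R (G, n)))"
  shows "val (G, n) = val (resolve {a, b, c, d} R1 (G, n)) + val (resolve {a, b, c, d} R2 (G, n))"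
proof -
  obtain H :: graph where H: "digraph_iso G H"
    using G graph_copy_exists[of G] by (auto simp: trivalent_bipartite_def)
  from H obtain \<psi> \<phi> where iso: "wf_digraph G" "inj_on \<psi> (verts G)" "inj_on \<phi> (arcs G)"
    "verts H = \<psi> ` verts G" "arcs H = \<phi> ` arcs G"
    "\<And>a. a \<in> arcs G \<Longrightarrow> tail H (\<phi> a) = \<psi> (tail G a)"
    "\<And>a. a \<in> arcs G \<Longrightarrow> head H (\<phi> a) = \<psi> (head G a)"
    by (elim digraph_isoE) blast
  have inV: "tail G x \<in> verts G" "head G x \<in> verts G" if "x \<in> arcs G" for x
    using iso(1) that by (auto simp: wf_digraph_def)
  have abcd: "a \<in> arcs G" "b \<in> arcs G" "c \<in> arcs G" "d \<in> arcs G"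
    using q by (auto simp: quadrilateral_def)
  have "quadrilateral H (\<phi> a) (\<phi> b) (\<phi> c) (\<phi> d)"
    using q abcd inV inj_on_eq_iff[OF iso(2)] by (auto simp: quadrilateral_def iso)
  moreover have "{\<phi> e1, \<phi> e2, \<phi> e3, \<phi> e4} \<subseteq> arcs H - {\<phi> a, \<phi> b, \<phi> c, \<phi> d}"
    using e(1) abcd inj_on_eq_iff[OF iso(3)] by (simp add: iso)
  moreover have "tail H (\<phi> e1) = tail H (\<phi> a)" "head H (\<phi> e2) = head H (\<phi> a)"
      "tail H (\<phi> e3) = tail H (\<phi> c)" "head H (\<phi> e4) = head H (\<phi> c)"
    using e abcd iso by auto
  ultimately have fH: "f (H, n) = f (resolve {\<phi> a, \<phi> b, \<phi> c, \<phi> d} {(\<phi> e2, \<phi> e1), (\<phi> e4, \<phi> e3)} (H, n)) +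
      f (resolve {\<phi> a, \<phi> b, \<phi> c, \<phi> d} {(\<phi> e2, \<phi> e3), (\<phi> e4, \<phi> e1)} (H, n))"
    using f_quadrilateral[of H "\<phi> a" "\<phi> b" "\<phi> c" "\<phi> d" "\<phi> e1" "\<phi> e2" "\<phi> e3" "\<phi> e4" n]
      trivalent_bipartite_iso[OF H G] by simp
  have res: "val (resolve {a, b, c, d} R (G, n)) =
      f (resolve {\<phi> a, \<phi> b, \<phi> c, \<phi> d} (map_prod \<phi> \<phi> ` R) (H, n))" if R: "R \<in> {R1, R2}" for R
  proof -
    have res: "web_iso (resolve {a, b, c, d} R (G, n))
        (resolve {\<phi> a, \<phi> b, \<phi> c, \<phi> d} (map_prod \<phi> \<phi> ` R) (H, n))"
      by (rule resolve_iso[OF iso _ g[OF R]]) (use abcd in auto)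
    moreover from this have "trivalent_bipartite (fst (resolve {\<phi> a, \<phi> b, \<phi> c, \<phi> d} (map_prod \<phi> \<phi> ` R) (H, n)))"
      by (rule trivalent_bipartite_web_iso[OF triv[OF R]])
    ultimately show ?thesis
      using val_iso[OF triv[OF R]] val_web[of "resolve {\<phi> a, \<phi> b, \<phi> c, \<phi> d} (map_prod \<phi> \<phi> ` R) (H, n)"]
      by metis
  qed
  have "val (resolve {a, b, c, d} R1 (G, n)) =
      f (resolve {\<phi> a, \<phi> b, \<phi> c, \<phi> d} {(\<phi> e2, \<phi> e1), (\<phi> e4, \<phi> e3)} (H, n))"
    "val (resolve {a, b, c, d} R2 (G, n)) =
      f (resolve {\<phi> a, \<phi> b, \<phi> c, \<phi> d} {(\<phi> e2, \<phi> e3), (\<phi> e4, \<phi> e1)} (H, n))"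
    using res[of R1] res[of R2] unfolding R by simp_all
  then show ?thesis
    by (simp only: val_copy[OF G H] fH)
qed

end


section \<open>Nets\<close>

text \<open>Labels stand for arcs. \<open>Wire a b\<close> continues the end of arc \<open>a\<close>
  by the start of arc \<open>b\<close>. In \<open>Crossing e m i j k l\<close> the strands run from
  \<open>i\<close> to \<open>k\<close> and from \<open>j\<close> to \<open>l\<close>,
  \<open>e\<close> is the sign, and \<open>m\<close> is reserved for the inner edge of the
  unoriented state. Vertices carry multisets because webs are abstract graphs without a cyclic order
  at the vertices.\<close>

datatype 'l gen =
    is_Wire: Wire 'l 'l
  | is_Source: Source "'l multiset"
  | is_Sink: Sink "'l multiset"
  | is_Crossing: Crossing int 'l 'l 'l 'l 'l

text \<open>The inner label of a crossing occurs among its starts and among its ends. Thus no other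
  generator can use it, and both local states of a closed net are closed again.\<close>

primrec starts :: "'l gen \<Rightarrow> 'l multiset" where
  "starts (Wire a b) = {#b#}"
| "starts (Source A) = A"
| "starts (Sink A) = {#}"
| "starts (Crossing e m i j k l) = {#k, l, m#}"

primrec ends :: "'l gen \<Rightarrow> 'l multiset" where
  "ends (Wire a b) = {#a#}"
| "ends (Source A) = {#}"
| "ends (Sink A) = A"
| "ends (Crossing e m i j k l) = {#i, j, m#}"

primrec trivalent :: "'l gen \<Rightarrow> bool" where
  "trivalent (Wire a b) = True"
| "trivalent (Source A) = (size A = 3)"
| "trivalent (Sink A) = (size A = 3)"
| "trivalent (Crossing e m i j k l) = True"

definition starts_of :: "'l gen multiset \<Rightarrow> 'l multiset" where
  "starts_of N = \<Sum>\<^sub># (image_mset starts N)"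

definition ends_of :: "'l gen multiset \<Rightarrow> 'l multiset" where
  "ends_of N = \<Sum>\<^sub># (image_mset ends N)"

definition no_dup :: "'a multiset \<Rightarrow> bool" where
  "no_dup A \<longleftrightarrow> (\<forall>x. count A x \<le> 1)"

definition closed :: "'l gen multiset \<Rightarrow> bool" where
  "closed N \<longleftrightarrow> starts_of N = ends_of N \<and> no_dup (starts_of N) \<and> no_dup (ends_of N) \<and> (\<forall>g \<in># N. trivalent g)"

definition pure :: "'l gen multiset \<Rightarrow> bool" where
  "pure N \<longleftrightarrow> (\<forall>g \<in># N. \<not> is_Crossing g)"

lemma starts_of_simps [simp]:
  "starts_of {#} = {#}" "starts_of (add_mset g N) = starts g + starts_of N"
  "starts_of (M + N) = starts_of M + starts_of N"
  by (simp_all add: starts_of_def)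

lemma ends_of_simps [simp]:
  "ends_of {#} = {#}" "ends_of (add_mset g N) = ends g + ends_of N"
  "ends_of (M + N) = ends_of M + ends_of N"
  by (simp_all add: ends_of_def)

lemma pure_simps [simp]:
  "pure {#}" "pure (add_mset g N) \<longleftrightarrow> \<not> is_Crossing g \<and> pure N"
  "pure (M + N) \<longleftrightarrow> pure M \<and> pure N"
  by (auto simp: pure_def)

lemma no_dup_add_mset [simp]: "no_dup (add_mset x A) \<longleftrightarrow> x \<notin># A \<and> no_dup A"
proof -
  have "count (add_mset x A) y \<le> 1 \<longleftrightarrow> (y = x \<longrightarrow> x \<notin># A) \<and> count A y \<le> 1" for y
    by (auto simp: not_in_iff)
  then show ?thesis unfolding no_dup_def by blast
qed

lemma no_dup_empty [simp]: "no_dup {#}"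
  by (simp add: no_dup_def)

lemma no_dup_unionD: "no_dup (A + B) \<Longrightarrow> no_dup A \<and> no_dup B \<and> set_mset A \<inter> set_mset B = {}"
proof -
  assume h: "no_dup (A + B)"
  have h': "count A x + count B x \<le> 1" for x using h by (simp add: no_dup_def)
  have "count A x \<le> 1" "count B x \<le> 1" "count A x = 0 \<or> count B x = 0" for x
    using h'[of x] by linarith+
  then show ?thesis unfolding no_dup_def by (auto simp: count_eq_zero_iff)
qed

lemma no_dup_iff_mset_set: "no_dup A \<longleftrightarrow> A = mset_set (set_mset A)"
proof
  assume nd: "no_dup A"
  show "A = mset_set (set_mset A)"
  proof (rule multiset_eqI)
    fix x
    have "count A x \<le> 1" using nd by (simp add: no_dup_def)
    then show "count A x = count (mset_set (set_mset A)) x"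
      by (cases "x \<in># A") (simp_all add: count_mset_set' not_in_iff le_antisym Suc_leI)
  qed
next
  assume "A = mset_set (set_mset A)"
  then have "count A x = (if x \<in># A then 1 else 0)" for x
    by (metis count_mset_set' finite_set_mset)
  then show "no_dup A" unfolding no_dup_def by simp
qed

lemma size_no_dup: "no_dup A \<Longrightarrow> card (set_mset A) = size A"
  by (metis no_dup_iff_mset_set size_mset_set)

lemma no_dup_image_mset: "no_dup A \<Longrightarrow> inj_on \<phi> (set_mset A) \<Longrightarrow> no_dup (image_mset \<phi> A)"
  by (metis image_mset_mset_set no_dup_iff_mset_set set_image_mset)

lemma in_starts_of: "l \<in># starts_of N \<longleftrightarrow> (\<exists>g \<in># N. l \<in># starts g)"
  by (auto simp: starts_of_def)

lemma in_ends_of: "l \<in># ends_of N \<longleftrightarrow> (\<exists>g \<in># N. l \<in># ends g)"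
  by (auto simp: ends_of_def)

lemma starts_unique:
  assumes "no_dup (starts_of N)" "g \<in># N" "g' \<in># N" "l \<in># starts g" "l \<in># starts g'"
  shows "g = g'"
proof (rule ccontr)
  assume "g \<noteq> g'"
  obtain N' where N': "N = add_mset g N'" using multi_member_split[OF assms(2)] by blast
  then have "g' \<in># N'" using assms(3) \<open>g \<noteq> g'\<close> by auto
  then have "l \<in># starts_of N'" using assms(5) by (auto simp: in_starts_of)
  then show False using assms(1,4) no_dup_unionD[of "starts g" "starts_of N'"] by (auto simp: N')
qed

lemma ends_unique:
  assumes "no_dup (ends_of N)" "g \<in># N" "g' \<in># N" "l \<in># ends g" "l \<in># ends g'"
  shows "g = g'"
proof (rule ccontr)
  assume "g \<noteq> g'"
  obtain N' where N': "N = add_mset g N'" using multi_member_split[OF assms(2)] by blast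
  then have "g' \<in># N'" using assms(3) \<open>g \<noteq> g'\<close> by auto
  then have "l \<in># ends_of N'" using assms(5) by (auto simp: in_ends_of)
  then show False using assms(1,4) no_dup_unionD[of "ends g" "ends_of N'"] by (auto simp: N')
qed

definition out_gen :: "'l gen multiset \<Rightarrow> 'l \<Rightarrow> 'l gen" where
  "out_gen N l = (THE g. g \<in># N \<and> l \<in># starts g)"

definition in_gen :: "'l gen multiset \<Rightarrow> 'l \<Rightarrow> 'l gen" where
  "in_gen N l = (THE g. g \<in># N \<and> l \<in># ends g)"

definition wires :: "'l gen multiset \<Rightarrow> ('l \<times> 'l) set" where
  "wires N = {(a, b). Wire a b \<in># N}"

definition vertices :: "'l gen multiset \<Rightarrow> 'l gen set" where
  "vertices N = {g \<in> set_mset N. is_Source g \<or> is_Sink g}"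

text \<open>The source and sink generators serve as the vertices themselves: in a closed net each
  has three labels that no other generator has in the same role, so equal generators cannot occur
  twice. The count starts at 0 since cycles of wires are found by \<open>splice\<close>.\<close>

definition net_web :: "'l gen multiset \<Rightarrow> ('l gen, 'l) pre_digraph \<times> nat" where
  "net_web N = splice (vertices N) (set_mset (starts_of N)) (wires N) (out_gen N) (in_gen N) 0"

lemma out_gen_eq: "no_dup (starts_of N) \<Longrightarrow> g \<in># N \<Longrightarrow> l \<in># starts g \<Longrightarrow> out_gen N l = g"
  unfolding out_gen_def by (rule the_equality) (auto intro: starts_unique)

lemma in_gen_eq: "no_dup (ends_of N) \<Longrightarrow> g \<in># N \<Longrightarrow> l \<in># ends g \<Longrightarrow> in_gen N l = g"
  unfolding in_gen_def by (rule the_equality) (auto intro: ends_unique)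

lemma closedD:
  assumes "closed N"
  shows "no_dup (starts_of N)" "no_dup (ends_of N)" "ends_of N = starts_of N"
  using assms by (auto simp: closed_def)

lemma vertex_or_wire_out:
  assumes "pure N" "l \<in># starts_of N"
  shows "l \<in> Range (wires N) \<or> (\<exists>A. Source A \<in># N \<and> l \<in># A)"
proof -
  obtain g where "g \<in># N" "l \<in># starts g" using assms(2) by (auto simp: in_starts_of)
  then show ?thesis using assms(1) by (cases g) (auto simp: wires_def pure_def)
qed

lemma vertex_or_wire_in:
  assumes "pure N" "l \<in># ends_of N"
  shows "l \<in> Domain (wires N) \<or> (\<exists>A. Sink A \<in># N \<and> l \<in># A)"
proof -
  obtain g where "g \<in># N" "l \<in># ends g" using assms(2) by (auto simp: in_ends_of)
  then show ?thesis using assms(1) by (cases g) (auto simp: wires_def pure_def)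
qed

lemma wire_labels:
  assumes "closed N" "(a, b) \<in> wires N"
  shows "a \<in># starts_of N" "b \<in># starts_of N"
proof -
  have "Wire a b \<in># N" using assms(2) by (simp add: wires_def)
  then have "a \<in># ends_of N" "b \<in># starts_of N" by (force simp: in_ends_of in_starts_of)+
  then show "a \<in># starts_of N" "b \<in># starts_of N" using closedD(3)[OF assms(1)] by simp_all
qed

lemma gluing_net:
  assumes "pure N" "closed N"
  shows "gluing (vertices N) (set_mset (starts_of N)) (wires N) (out_gen N) (in_gen N)"
  unfolding gluing_def
proof (intro conjI)
  note cl = closedD[OF assms(2)]
  show "wires N \<subseteq> set_mset (starts_of N) \<times> set_mset (starts_of N)"
    using wire_labels[OF assms(2)] by auto
  have w: "out_gen N b = Wire a b" "in_gen N a = Wire a b" if "(a, b) \<in> wires N" for a b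
    using that out_gen_eq[OF cl(1), of "Wire a b" b] in_gen_eq[OF cl(2), of "Wire a b" a]
    by (simp_all add: wires_def)
  show "single_valued (wires N)"
  proof (rule single_valuedI)
    show "y = z" if "(x, y) \<in> wires N" "(x, z) \<in> wires N" for x y z
      using w(2)[OF that(1)] w(2)[OF that(2)] by simp
  qed
  show "single_valued ((wires N)\<inverse>)"
  proof (rule single_valuedI)
    show "y = z" if "(x, y) \<in> (wires N)\<inverse>" "(x, z) \<in> (wires N)\<inverse>" for x y z
      using w(1)[of y x] w(1)[of z x] that by simp
  qed
  show "out_gen N ` (set_mset (starts_of N) - Range (wires N)) \<subseteq> vertices N"
  proof (intro image_subsetI)
    fix l assume "l \<in> set_mset (starts_of N) - Range (wires N)"
    then obtain A where "Source A \<in># N" "l \<in># A" using vertex_or_wire_out[OF assms(1), of l] by auto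
    then show "out_gen N l \<in> vertices N"
      using out_gen_eq[OF cl(1), of "Source A" l] by (simp add: vertices_def)
  qed
  show "in_gen N ` (set_mset (starts_of N) - Domain (wires N)) \<subseteq> vertices N"
  proof (intro image_subsetI)
    fix l assume "l \<in> set_mset (starts_of N) - Domain (wires N)"
    then obtain A where "Sink A \<in># N" "l \<in># A" using vertex_or_wire_in[OF assms(1), of l] cl(3) by auto
    then show "in_gen N l \<in> vertices N"
      using in_gen_eq[OF cl(2), of "Sink A" l] by (simp add: vertices_def)
  qed
qed simp

section \<open>Renaming of labels\<close>

lemma starts_map_gen [simp]: "starts (map_gen \<phi> g) = image_mset \<phi> (starts g)"
  by (cases g) auto

lemma ends_map_gen [simp]: "ends (map_gen \<phi> g) = image_mset \<phi> (ends g)"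
  by (cases g) auto

lemma trivalent_map_gen [simp]: "trivalent (map_gen \<phi> g) = trivalent g"
  by (cases g) auto

lemma is_gen_map_gen [simp]:
  "is_Crossing (map_gen \<phi> g) = is_Crossing g" "is_Source (map_gen \<phi> g) = is_Source g"
  "is_Sink (map_gen \<phi> g) = is_Sink g"
  by (cases g; simp)+

abbreviation rename :: "('l \<Rightarrow> 'k) \<Rightarrow> 'l gen multiset \<Rightarrow> 'k gen multiset" where
  "rename \<phi> N \<equiv> image_mset (map_gen \<phi>) N"

lemma starts_of_rename [simp]: "starts_of (rename \<phi> N) = image_mset \<phi> (starts_of N)"
  by (induction N) auto

lemma ends_of_rename [simp]: "ends_of (rename \<phi> N) = image_mset \<phi> (ends_of N)"
  by (induction N) auto

lemma pure_rename [simp]: "pure (rename \<phi> N) = pure N"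
  by (simp add: pure_def)

lemma wires_rename: "wires (rename \<phi> N) = map_prod \<phi> \<phi> ` wires N"
proof -
  have "Wire x y \<in># rename \<phi> N \<longleftrightarrow> (\<exists>a b. x = \<phi> a \<and> y = \<phi> b \<and> Wire a b \<in># N)" for x y
  proof
    assume "Wire x y \<in># rename \<phi> N"
    then obtain g where "g \<in># N" "map_gen \<phi> g = Wire x y" by auto
    then show "\<exists>a b. x = \<phi> a \<and> y = \<phi> b \<and> Wire a b \<in># N" by (cases g) auto
  qed force
  then show ?thesis by (force simp: wires_def)
qed

lemma vertices_rename: "vertices (rename \<phi> N) = map_gen \<phi> ` vertices N"
  by (auto simp: vertices_def)

lemma out_gen_rename:
  assumes "no_dup (starts_of N)" "no_dup (image_mset \<phi> (starts_of N))" "l \<in># starts_of N"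
  shows "out_gen (rename \<phi> N) (\<phi> l) = map_gen \<phi> (out_gen N l)"
proof -
  obtain g where g: "g \<in># N" "l \<in># starts g" using assms(3) by (auto simp: in_starts_of)
  then have "out_gen (rename \<phi> N) (\<phi> l) = map_gen \<phi> g"
    by (intro out_gen_eq) (use assms(2) in auto)
  then show ?thesis using out_gen_eq[OF assms(1) g] by simp
qed

lemma in_gen_rename:
  assumes "no_dup (ends_of N)" "no_dup (image_mset \<phi> (ends_of N))" "l \<in># ends_of N"
  shows "in_gen (rename \<phi> N) (\<phi> l) = map_gen \<phi> (in_gen N l)"
proof -
  obtain g where g: "g \<in># N" "l \<in># ends g" using assms(3) by (auto simp: in_ends_of)
  then have "in_gen (rename \<phi> N) (\<phi> l) = map_gen \<phi> g"
    by (intro in_gen_eq) (use assms(2) in auto)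
  then show ?thesis using in_gen_eq[OF assms(1) g] by simp
qed

text \<open>A vertex is determined by any one of its labels. Injectivity is asked separately for
  starts and for ends, because contracting a wire identifies two labels of which one remains only as
  a start and the other only as an end.\<close>

lemma inj_on_map_gen_vertices:
  assumes "no_dup (starts_of N)" "no_dup (ends_of N)"
    and "inj_on \<phi> (set_mset (starts_of N))" "inj_on \<phi> (set_mset (ends_of N))"
    and "\<forall>g \<in># N. trivalent g"
  shows "inj_on (map_gen \<phi>) (vertices N)"
proof (rule inj_onI)
  fix g h assume "g \<in> vertices N" "h \<in> vertices N" and eq: "map_gen \<phi> g = map_gen \<phi> h"
  then have gh: "g \<in># N" "h \<in># N" "is_Source g \<or> is_Sink g" by (auto simp: vertices_def)
  show "g = h"
  proof (cases "is_Source g")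
    case True
    then obtain A where A: "g = Source A" by (auto simp: is_Source_def)
    then have "size A = 3" using gh assms(5) by auto
    then obtain l where l: "l \<in># starts g" using A by (cases A) auto
    have "\<phi> ` set_mset (starts g) = \<phi> ` set_mset (starts h)"
      using arg_cong[OF eq, of "\<lambda>g. set_mset (starts g)"] by simp
    then have "\<phi> l \<in> \<phi> ` set_mset (starts h)" using l by blast
    then obtain l' where l': "l' \<in># starts h" "\<phi> l = \<phi> l'" by auto
    moreover have "l \<in># starts_of N" "l' \<in># starts_of N"
      using gh(1,2) l l'(1) by (auto simp: in_starts_of)
    ultimately have "l = l'" using inj_onD[OF assms(3)] by blast
    then show ?thesis using starts_unique[OF assms(1) gh(1,2), of l] l l' by simp
  next
    case False
    then obtain A where A: "g = Sink A" using gh by (auto simp: is_Sink_def)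
    then have "size A = 3" using gh assms(5) by auto
    then obtain l where l: "l \<in># ends g" using A by (cases A) auto
    have "\<phi> ` set_mset (ends g) = \<phi> ` set_mset (ends h)"
      using arg_cong[OF eq, of "\<lambda>g. set_mset (ends g)"] by simp
    then have "\<phi> l \<in> \<phi> ` set_mset (ends h)" using l by blast
    then obtain l' where l': "l' \<in># ends h" "\<phi> l = \<phi> l'" by auto
    moreover have "l \<in># ends_of N" "l' \<in># ends_of N"
      using gh(1,2) l l'(1) by (auto simp: in_ends_of)
    ultimately have "l = l'" using inj_onD[OF assms(4)] by blast
    then show ?thesis using ends_unique[OF assms(2) gh(1,2), of l] l l' by simp
  qed
qed

lemma closed_rename:
  assumes "closed N" "inj_on \<phi> (set_mset (starts_of N))"
  shows "closed (rename \<phi> N)"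
  using assms no_dup_image_mset[of "starts_of N" \<phi>] by (auto simp: closed_def)

lemma net_web_rename:
  assumes "pure N" "closed N" "inj_on \<phi> (set_mset (starts_of N))"
  shows "web_iso (net_web N) (net_web (rename \<phi> N))"
  unfolding net_web_def
proof (rule splice_iso[OF gluing_net[OF assms(1,2)], of "map_gen \<phi>" \<phi>])
  note cl = closedD[OF assms(2)] closedD[OF closed_rename[OF assms(2,3)]]
  show "inj_on (map_gen \<phi>) (vertices N)"
    using inj_on_map_gen_vertices[of N \<phi>] assms cl by (simp add: closed_def)
  show "inj_on \<phi> (set_mset (starts_of N))" by fact
  show "out_gen (rename \<phi> N) (\<phi> e) = map_gen \<phi> (out_gen N e)" if "e \<in># starts_of N" for e
    using out_gen_rename[of N \<phi> e] cl that by simp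
  show "in_gen (rename \<phi> N) (\<phi> e) = map_gen \<phi> (in_gen N e)" if "e \<in># starts_of N" for e
    using in_gen_rename[of N \<phi> e] cl that by simp
qed (simp_all add: wires_rename vertices_rename)

text \<open>Without the wire, \<open>a\<close> has lost its end and \<open>b\<close> its start.
  Renaming \<open>b\<close> to \<open>a\<close> therefore joins two half-used labels into one
  complete label.\<close>

lemma closed_wire:
  assumes M: "closed (add_mset (Wire a b) N)" and ab: "a \<noteq> b"
  shows "closed (rename (id(b := a)) N)"
    and "b \<notin># starts_of N" "a \<in># starts_of N" "a \<notin># ends_of N" "b \<in># ends_of N"
    and "no_dup (starts_of N)" "no_dup (ends_of N)"
    and "no_dup (image_mset (id(b := a)) (starts_of N))" "no_dup (image_mset (id(b := a)) (ends_of N))"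
    and "inj_on (id(b := a)) (set_mset (starts_of N))" "inj_on (id(b := a)) (set_mset (ends_of N))"
proof -
  have eq: "add_mset b (starts_of N) = add_mset a (ends_of N)"
    and nd: "b \<notin># starts_of N" "no_dup (starts_of N)" and tri: "\<forall>g \<in># N. trivalent g"
    using M by (auto simp: closed_def)
  have nd': "a \<notin># ends_of N" "no_dup (ends_of N)"
    using closedD(2)[OF M] by auto
  have a: "a \<in># starts_of N" using eq ab by (metis insert_iff set_mset_add_mset_insert)
  have b: "b \<in># ends_of N" using eq ab by (metis insert_iff set_mset_add_mset_insert)
  show inj: "inj_on (id(b := a)) (set_mset (starts_of N))" "inj_on (id(b := a)) (set_mset (ends_of N))"
    using nd nd' by (auto simp: inj_on_def)
  show ndi: "no_dup (image_mset (id(b := a)) (starts_of N))" "no_dup (image_mset (id(b := a)) (ends_of N))"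
    using no_dup_image_mset nd nd' inj by blast+
  have "image_mset (id(b := a)) (add_mset b (starts_of N)) = image_mset (id(b := a)) (add_mset a (ends_of N))"
    using eq by simp
  then have "image_mset (id(b := a)) (starts_of N) = image_mset (id(b := a)) (ends_of N)"
    using ab by simp
  then show "closed (rename (id(b := a)) N)"
    using tri ndi by (simp add: closed_def)
  show "b \<notin># starts_of N" "a \<in># starts_of N" "a \<notin># ends_of N" "b \<in># ends_of N"
    "no_dup (starts_of N)" "no_dup (ends_of N)" by fact+
qed

text \<open>\<open>splice_absorb\<close> with \<open>Y = {b}\<close> dissolves the arc
  \<open>b\<close> in \<open>a\<close>. What remains is the gluing of the renamed net, and the
  generators change by \<open>map_gen\<close>.\<close>

lemma net_web_wire:
  assumes pM: "pure (add_mset (Wire a b) N)" and M: "closed (add_mset (Wire a b) N)" and ab: "a \<noteq> b"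
  shows "web_iso (net_web (add_mset (Wire a b) N)) (net_web (rename (id(b := a)) N))"
proof -
  let ?M = "add_mset (Wire a b) N" and ?\<phi> = "id(b := a)"
  let ?V = "vertices ?M" and ?E = "set_mset (starts_of ?M)" and ?R = "wires ?M"
  let ?t = "out_gen ?M" and ?h = "in_gen ?M"
  note c = closed_wire[OF M ab] and cl = closedD[OF M]
  define R' where "R' = {(u, v). (u, v) \<in> ?R O (?R \<inter> {b} \<times> UNIV)\<^sup>* \<and> u \<notin> {b} \<and> v \<notin> {b}}"
  \<comment> \<open>If \<open>b\<close> ends at a vertex, the chain that ended with \<open>b\<close>
    now ends with \<open>a\<close>, hence the head of \<open>b\<close> is given to
    \<open>a\<close>.\<close>
  define h' where "h' = ?h(a := ?h b)"
  have g: "gluing ?V ?E ?R ?t ?h" using gluing_net[OF pM M] .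
  have R: "?R = insert (a, b) (wires N)" by (auto simp: wires_def)
  have wN: "(x, y) \<in> wires N \<Longrightarrow> x \<noteq> a \<and> y \<noteq> b" for x y
    using c(2,4) by (force simp: wires_def in_starts_of in_ends_of)
  have after: "(x, z) \<in> ?R O (?R \<inter> {b} \<times> UNIV)\<^sup>* \<longleftrightarrow> (x, z) \<in> ?R \<or> x = a \<and> (b, z) \<in> wires N" for x z
  proof
    assume "(x, z) \<in> ?R O (?R \<inter> {b} \<times> UNIV)\<^sup>*"
    then obtain y where y: "(x, y) \<in> ?R" "(y, z) \<in> (?R \<inter> {b} \<times> UNIV)\<^sup>*" by (elim relcompE) simp
    from y(2) show "(x, z) \<in> ?R \<or> x = a \<and> (b, z) \<in> wires N"
    proof (cases rule: converse_rtranclE)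
      case (step w)
      then have "y = b" "(b, w) \<in> wires N" "w \<noteq> b" using ab wN by (auto simp: R)
      moreover from step(2) have "w = z"
        by (cases rule: converse_rtranclE) (use \<open>w \<noteq> b\<close> in auto)
      ultimately show ?thesis using y(1) wN by (auto simp: R)
    qed (use y in simp)
  next
    assume "(x, z) \<in> ?R \<or> x = a \<and> (b, z) \<in> wires N"
    then show "(x, z) \<in> ?R O (?R \<inter> {b} \<times> UNIV)\<^sup>*"
      by (auto simp: R intro: relcompI[where b = b])
  qed
  have R'_iff: "(u, v) \<in> R' \<longleftrightarrow> (u, v) \<in> wires N \<and> u \<noteq> b \<or> u = a \<and> (b, v) \<in> wires N" for u v
      unfolding R'_def mem_Collect_eq prod.case after using wN ab by (auto simp: R)
  have R': "R' = map_prod ?\<phi> ?\<phi> ` wires N"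
  proof -
    have "(u, v) \<in> map_prod ?\<phi> ?\<phi> ` wires N \<longleftrightarrow>
        (u, v) \<in> wires N \<and> u \<noteq> b \<or> u = a \<and> (b, v) \<in> wires N" for u v
    proof
      assume "(u, v) \<in> map_prod ?\<phi> ?\<phi> ` wires N"
      then obtain x y where "(x, y) \<in> wires N" "u = ?\<phi> x" "v = ?\<phi> y" by auto
      then show "(u, v) \<in> wires N \<and> u \<noteq> b \<or> u = a \<and> (b, v) \<in> wires N"
        using wN[of x y] by auto
    next
      assume "(u, v) \<in> wires N \<and> u \<noteq> b \<or> u = a \<and> (b, v) \<in> wires N"
      then obtain x where "(x, v) \<in> wires N" "u = ?\<phi> x" by auto
      then show "(u, v) \<in> map_prod ?\<phi> ?\<phi> ` wires N"
        using wN[of x v] by (auto intro!: rev_image_eqI[of "(x, v)"])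
    qed
    then show ?thesis by (intro set_eqI) (simp add: split_paired_all R'_iff)
  qed
  have no_cycle: "{?R\<^sup>+ `` {e} | e. (e, e) \<in> ?R\<^sup>+ \<and> ?R\<^sup>+ `` {e} \<subseteq> {b}} = {}"
  proof (intro equals0I)
    fix X assume "X \<in> {?R\<^sup>+ `` {e} | e. (e, e) \<in> ?R\<^sup>+ \<and> ?R\<^sup>+ `` {e} \<subseteq> {b}}"
    then obtain e where e: "(e, e) \<in> ?R\<^sup>+" "?R\<^sup>+ `` {e} \<subseteq> {b}" by auto
    then have "e = b" by auto
    moreover obtain y where "(e, y) \<in> ?R" using e by (meson tranclD)
    ultimately have "(b, y) \<in> ?R" "y = b" using e by auto
    then show False using ab wN by (auto simp: R)
  qed
  have aD: "a \<in> Domain ?R" by (auto simp: R)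
  have bR: "{b} \<subseteq> Range ?R" by (auto simp: R)
  have h'1: "h' e = ?h e" if "e \<in> ?E - {b} - Domain ?R" for e
    using that aD by (auto simp: h'_def)
  have h'2: "h' e = ?h z" if "(e, z) \<in> ?R O (?R \<inter> {b} \<times> UNIV)\<^sup>*" "z \<in> {b} - Domain ?R" for e z
  proof -
    have "e = a" "z = b" using that(2) that(1)[unfolded after] wN by (auto simp: R)
    then show ?thesis by (simp add: h'_def)
  qed
  have "web_iso (splice ?V ?E ?R ?t ?h 0)
     (splice ?V (?E - {b}) R' ?t h' (0 + card {?R\<^sup>+ `` {e} | e. (e, e) \<in> ?R\<^sup>+ \<and> ?R\<^sup>+ `` {e} \<subseteq> {b}}))"
    by (rule splice_absorb(1)[OF g bR R'_def refl h'1]) (use h'2 in blast)+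
  moreover have g': "gluing ?V (?E - {b}) R' ?t h'"
    by (rule splice_absorb(2)[OF g bR R'_def refl h'1]) (use h'2 in blast)+
  moreover have "web_iso (splice ?V (?E - {b}) R' ?t h' 0) (net_web (rename ?\<phi> N))"
    unfolding net_web_def
  proof (rule splice_iso[OF g', of "map_gen ?\<phi>" id])
    have E: "?E - {b} = set_mset (starts_of N)" using c(2) by auto
    have V: "?V = vertices N" by (auto simp: vertices_def)
    have tN: "?t e = out_gen N e" if "e \<in># starts_of N" for e
    proof -
      obtain g where g: "g \<in># N" "e \<in># starts g" using \<open>e \<in># starts_of N\<close> by (auto simp: in_starts_of)
      then show ?thesis using out_gen_eq[OF cl(1), of g e] out_gen_eq[OF c(6), of g e] by simp
    qed
    have hN: "?h e = in_gen N e" if "e \<in># ends_of N" for e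
    proof -
      obtain g where g: "g \<in># N" "e \<in># ends g" using \<open>e \<in># ends_of N\<close> by (auto simp: in_ends_of)
      then show ?thesis using in_gen_eq[OF cl(2), of g e] in_gen_eq[OF c(7), of g e] by simp
    qed
    have ends: "e \<in># ends_of N" if "e \<in># starts_of N" "e \<noteq> a" for e
    proof -
      have "e \<in># ends_of ?M" unfolding cl(3) using that by simp
      then show ?thesis using that by simp
    qed
    have h'_eq: "in_gen (rename ?\<phi> N) e = map_gen ?\<phi> (h' e)" if "e \<in># starts_of N" for e
    proof (cases "e = a")
      case True
      then show ?thesis using in_gen_rename[OF c(7,9,5)] hN[OF c(5)] by (simp add: h'_def)
    next
      case False
      then have "e \<noteq> b" "e \<in># ends_of N" using that c(2) ends by auto
      then show ?thesis using False in_gen_rename[OF c(7,9), of e] hN[of e] by (simp add: h'_def)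
    qed
    have t'_eq: "out_gen (rename ?\<phi> N) e = map_gen ?\<phi> (?t e)" if "e \<in># starts_of N" for e
      using out_gen_rename[OF c(6,8) that] tN[OF that] that c(2) by (auto split: if_splits)
    show "inj_on (map_gen ?\<phi>) ?V"
      unfolding V by (rule inj_on_map_gen_vertices[OF c(6,7,10,11)]) (use M in \<open>simp add: closed_def\<close>)
    show "inj_on id (?E - {b})" by simp
    show "vertices (rename ?\<phi> N) = map_gen ?\<phi> ` ?V" by (simp add: V vertices_rename)
    show "set_mset (starts_of (rename ?\<phi> N)) = id ` (?E - {b})"
      unfolding E using c(2) by (auto simp: image_iff)
    show "wires (rename ?\<phi> N) = map_prod id id ` R'" by (simp add: wires_rename R' prod.map_id)
    show "out_gen (rename ?\<phi> N) (id e) = map_gen ?\<phi> (?t e)" if "e \<in> ?E - {b}" for e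
      using t'_eq that unfolding E by simp
    show "in_gen (rename ?\<phi> N) (id e) = map_gen ?\<phi> (h' e)" if "e \<in> ?E - {b}" for e
      using h'_eq that unfolding E by simp
  qed
  ultimately show ?thesis
    unfolding no_cycle net_web_def[of ?M] by (simp add: web_iso_trans)
qed

lemma out_gen_sub:
  assumes "no_dup (starts_of (L + N))" "l \<in># starts_of N"
  shows "out_gen (L + N) l = out_gen N l"
proof -
  obtain g where g: "g \<in># N" "l \<in># starts g" using assms(2) by (auto simp: in_starts_of)
  have "no_dup (starts_of N)" using no_dup_unionD[of "starts_of L" "starts_of N"] assms(1) by simp
  then show ?thesis using out_gen_eq[of _ g l] g assms(1) by simp
qed

lemma in_gen_sub:
  assumes "no_dup (ends_of (L + N))" "l \<in># ends_of N"
  shows "in_gen (L + N) l = in_gen N l"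
proof -
  obtain g where g: "g \<in># N" "l \<in># ends g" using assms(2) by (auto simp: in_ends_of)
  have "no_dup (ends_of N)" using no_dup_unionD[of "ends_of L" "ends_of N"] assms(1) by simp
  then show ?thesis using in_gen_eq[of _ g l] g assms(1) by simp
qed

lemma closed_loop:
  assumes "closed (add_mset (Wire a a) N)"
  shows "closed N" "a \<notin># starts_of N"
  using assms by (auto simp: closed_def)

text \<open>Again \<open>splice_absorb\<close> for a single label, but now this label is a whole
  cycle of the gluing, so absorbing it raises the circle count by one.\<close>

lemma net_web_loop:
  assumes pM: "pure (add_mset (Wire a a) N)" and M: "closed (add_mset (Wire a a) N)"
  shows "web_iso (net_web (add_mset (Wire a a) N)) (fst (net_web N), Suc (snd (net_web N)))"
proof -
  let ?M = "add_mset (Wire a a) N"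
  let ?V = "vertices ?M" and ?E = "set_mset (starts_of ?M)" and ?R = "wires ?M"
  let ?t = "out_gen ?M" and ?h = "in_gen ?M"
  note cl = closedD[OF M] and cN = closed_loop[OF M] and clN = closedD[OF closed_loop(1)[OF M]]
  have g: "gluing ?V ?E ?R ?t ?h" using gluing_net[OF pM M] .
  have R: "?R = insert (a, a) (wires N)" by (auto simp: wires_def)
  have aN: "a \<notin># ends_of N" using cN clN by simp
  have wN: "x \<noteq> a \<and> y \<noteq> a" if "(x, y) \<in> wires N" for x y
    using wire_labels[OF cN(1) that] cN(2) by auto
  have after: "(x, z) \<in> ?R O (?R \<inter> {a} \<times> UNIV)\<^sup>* \<longleftrightarrow> (x, z) \<in> ?R" for x z
  proof -
    have "?R \<inter> {a} \<times> UNIV = {(a, a)}" using wN by (auto simp: R)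
    moreover have "y = z" if "(y, z) \<in> {(a, a)}\<^sup>*" for y z
      using that by (induction rule: rtrancl_induct) auto
    ultimately show ?thesis by auto
  qed
  have R': "wires N = {(u, v). (u, v) \<in> ?R O (?R \<inter> {a} \<times> UNIV)\<^sup>* \<and> u \<notin> {a} \<and> v \<notin> {a}}"
    unfolding after using wN by (auto simp: R)
  have aR: "{a} \<subseteq> Range ?R" by (auto simp: R)
  have only: "z = a" if "(a, z) \<in> ?R\<^sup>+" for z
    using that by (induction rule: trancl_induct) (use wN in \<open>auto simp: R\<close>)
  have cyc: "{?R\<^sup>+ `` {e} | e. (e, e) \<in> ?R\<^sup>+ \<and> ?R\<^sup>+ `` {e} \<subseteq> {a}} = {{a}}"
  proof (intro set_eqI iffI)
    fix X assume "X \<in> {?R\<^sup>+ `` {e} | e. (e, e) \<in> ?R\<^sup>+ \<and> ?R\<^sup>+ `` {e} \<subseteq> {a}}"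
    then show "X \<in> {{a}}" by auto
  next
    fix X assume X: "X \<in> {{a}}"
    have "(a, a) \<in> ?R\<^sup>+" by (rule r_into_trancl) (simp add: R)
    moreover from this have "?R\<^sup>+ `` {a} = {a}" using only by auto
    ultimately show "X \<in> {?R\<^sup>+ `` {e} | e. (e, e) \<in> ?R\<^sup>+ \<and> ?R\<^sup>+ `` {e} \<subseteq> {a}}"
      using X by blast
  qed
  have t: "out_gen N e = ?t e" if "e \<in> ?E - Range ?R" for e
    using out_gen_sub[of "{#Wire a a#}" N e] cl(1) that aR by auto
  have h: "in_gen N e = ?h e" if "e \<in> ?E - {a} - Domain ?R" for e
    using in_gen_sub[of "{#Wire a a#}" N e] cl(2) that clN(3) by auto
  have "web_iso (splice ?V ?E ?R ?t ?h 0)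
     (splice ?V (?E - {a}) (wires N) (out_gen N) (in_gen N)
       (0 + card {?R\<^sup>+ `` {e} | e. (e, e) \<in> ?R\<^sup>+ \<and> ?R\<^sup>+ `` {e} \<subseteq> {a}}))"
    by (rule splice_absorb(1)[OF g aR R' t h]) (simp_all add: R)
  moreover have "?V = vertices N" by (auto simp: vertices_def)
  moreover have "?E - {a} = set_mset (starts_of N)" using cN by auto
  ultimately show ?thesis unfolding cyc net_web_def by (simp add: splice_def)
qed

section \<open>Nets without crossings as trivalent bipartite graphs\<close>

lemma net_web_no_wires:
  assumes "wires N = {}"
  shows "net_web N = (\<lparr>verts = vertices N, arcs = set_mset (starts_of N),
    tail = out_gen N, head = in_gen N\<rparr>, 0)"
  unfolding net_web_def assms by (simp add: splice_def)

lemma vertex_label: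
  assumes "trivalent g" "is_Source g \<or> is_Sink g"
  obtains l where "l \<in># starts g + ends g"
  using assms by (cases g) (auto, (metis multiset_nonemptyE size_empty zero_neq_numeral)+)

lemma trivalent_bipartite_no_wires:
  assumes pN: "pure N" and N: "closed N" and w: "wires N = {}"
  shows "trivalent_bipartite (fst (net_web N))"
proof -
  note cl = closedD[OF N]
  let ?G = "fst (net_web N)"
  have G: "verts ?G = vertices N" "arcs ?G = set_mset (starts_of N)" "tail ?G = out_gen N" "head ?G = in_gen N"
    by (simp_all add: net_web_no_wires[OF w])
  have "wf_digraph ?G"
    unfolding net_web_def by (rule wf_digraph_splice[OF gluing_net[OF pN N]])
  then have "fin_digraph ?G"
    by (auto simp: fin_digraph_def fin_digraph_axioms_def G vertices_def)
  moreover have "out_degree ?G v = 3 \<and> in_degree ?G v = 0 \<or> out_degree ?G v = 0 \<and> in_degree ?G v = 3"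
    if v: "v \<in> vertices N" for v
  proof -
    have vN: "v \<in># N" "trivalent v" using v N by (auto simp: vertices_def closed_def)
    have "out_arcs ?G v = set_mset (starts v)"
    proof (intro set_eqI iffI)
      fix l assume l: "l \<in> out_arcs ?G v"
      then obtain g where g: "g \<in># N" "l \<in># starts g" by (auto simp: out_arcs_def G in_starts_of)
      then show "l \<in># starts v" using l out_gen_eq[OF cl(1) g] by (auto simp: out_arcs_def G)
    next
      fix l assume l: "l \<in># starts v"
      then show "l \<in> out_arcs ?G v"
        using out_gen_eq[OF cl(1) vN(1) l] vN by (auto simp: out_arcs_def G in_starts_of)
    qed
    moreover have "in_arcs ?G v = set_mset (ends v)"
    proof (intro set_eqI iffI)
      fix l assume l: "l \<in> in_arcs ?G v"
      then have "l \<in># ends_of N" using cl(3) by (auto simp: in_arcs_def G)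
      then obtain g where g: "g \<in># N" "l \<in># ends g" by (auto simp: in_ends_of)
      then show "l \<in># ends v" using l in_gen_eq[OF cl(2) g] by (auto simp: in_arcs_def G)
    next
      fix l assume l: "l \<in># ends v"
      then have "l \<in># ends_of N" using vN by (auto simp: in_ends_of)
      then show "l \<in> in_arcs ?G v"
        using in_gen_eq[OF cl(2) vN(1) l] cl(3) by (auto simp: in_arcs_def G)
    qed
    moreover obtain N' where "N = add_mset v N'" using multi_member_split[OF vN(1)] by blast
    then have "no_dup (starts v)" "no_dup (ends v)"
      using cl no_dup_unionD[of "starts v" "starts_of N'"] no_dup_unionD[of "ends v" "ends_of N'"] by auto
    ultimately show ?thesis
      using v vN(2) by (cases v) (auto simp: out_degree_def in_degree_def size_no_dup vertices_def)
  qed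
  ultimately show ?thesis by (simp add: trivalent_bipartite_def G)
qed

text \<open>Removing wires one at a time changes the web only by isomorphism and by circles, neither
  of which affects the degrees. So it suffices to count labels at the vertices of a net without
  wires.\<close>

lemma trivalent_bipartite_net_web:
  assumes "pure N" "closed N"
  shows "trivalent_bipartite (fst (net_web N))"
  using assms
proof (induction "size N" arbitrary: N rule: less_induct)
  case less
  show ?case
  proof (cases "wires N = {}")
    case True
    then show ?thesis using trivalent_bipartite_no_wires less.prems by blast
  next
    case False
    then obtain a b where "Wire a b \<in># N" by (auto simp: wires_def)
    then obtain N' where N': "N = add_mset (Wire a b) N'" by (meson multi_member_split)
    show ?thesis
    proof (cases "a = b")
      case True
      have "trivalent_bipartite (fst (net_web N'))"
        using less.hyps[of N'] less.prems closed_loop(1)[of a N'] unfolding N' True by simp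
      then show ?thesis
        using trivalent_bipartite_web_iso[of "(fst (net_web N'), Suc (snd (net_web N')))" "net_web N"]
          web_iso_sym[OF net_web_loop[of a N']] less.prems unfolding N' True by simp
    next
      case False
      have "trivalent_bipartite (fst (net_web (rename (id(b := a)) N')))"
        using less.hyps[of "rename (id(b := a)) N'"] less.prems closed_wire(1)[OF _ False, of N']
        unfolding N' by simp
      moreover have "web_iso (net_web N) (net_web (rename (id(b := a)) N'))"
        unfolding N' by (rule net_web_wire) (use less.prems False in \<open>simp_all add: N'\<close>)
      ultimately show ?thesis
        using trivalent_bipartite_web_iso[OF _ web_iso_sym] by metis
    qed
  qed
qed

text \<open>In a net without wires the labels are literally the arcs. Deleting the arcs
  \<open>B\<close> with their end vertices \<open>L\<close> and gluing the external ends is then the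
  same as exchanging \<open>L\<close> for wires. The relations of \<open>f\<close> for bigons and
  squares both pass to nets in this way, also when external ends coincide and a wire closes
  up.\<close>

lemma resolve_net:
  assumes M: "pure (L + N)" "closed (L + N)" "wires (L + N) = {}"
    and M': "pure (W + N)" "closed (W + N)" and W: "\<forall>g \<in># W. is_Wire g"
    and B: "set_mset (starts_of (W + N)) = set_mset (starts_of (L + N)) - B"
    and V: "out_gen (L + N) ` B \<union> in_gen (L + N) ` B = set_mset L"
    and G: "G = fst (net_web (L + N))"
  shows "gluing (verts G - (tail G ` B \<union> head G ` B)) (arcs G - B) (wires (W + N)) (tail G) (head G)"
    and "web_iso (resolve B (wires (W + N)) (G, 0)) (net_web (W + N))"
proof -
  note cl = closedD[OF M(2)] and cl' = closedD[OF M'(2)]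
  have G': "verts G = vertices (L + N)" "arcs G = set_mset (starts_of (L + N))"
    "tail G = out_gen (L + N)" "head G = in_gen (L + N)"
    by (simp_all add: G net_web_no_wires[OF M(3)])
  have V': "verts G - (tail G ` B \<union> head G ` B) = vertices (W + N)"
  proof -
    \<comment> \<open>A vertex in both \<open>L\<close> and \<open>N\<close> would make
      \<open>L\<close> and \<open>N\<close> share one of its labels in the same role, against the
      absence of duplicates.\<close>
    have "g \<notin># L" if gN: "g \<in># N" and gS: "is_Source g \<or> is_Sink g" for g
    proof
      assume "g \<in># L"
      moreover have "trivalent g" using gN M(2) by (auto simp: closed_def)
      then obtain l where "l \<in># starts g + ends g" using vertex_label[OF _ gS] by blast
      ultimately have "l \<in># starts_of L \<and> l \<in># starts_of N \<or> l \<in># ends_of L \<and> l \<in># ends_of N"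
        using gN by (auto simp: in_starts_of in_ends_of)
      then show False
        using no_dup_unionD[of "starts_of L" "starts_of N"] no_dup_unionD[of "ends_of L" "ends_of N"] cl(1,2)
        by auto
    qed
    then have "vertices (L + N) - set_mset L = vertices N" by (auto simp: vertices_def)
    moreover have "vertices (W + N) = vertices N" using W by (auto simp: vertices_def is_Wire_def)
    ultimately show ?thesis by (simp add: G' V)
  qed
  have wW: "e \<in> Range (wires (W + N))" if e: "e \<in># starts_of W" for e
  proof -
    obtain g where "g \<in># W" "e \<in># starts g" using e by (auto simp: in_starts_of)
    then show ?thesis using W by (cases g) (auto simp: wires_def)
  qed
  have wW': "e \<in> Domain (wires (W + N))" if e: "e \<in># ends_of W" for e
  proof -
    obtain g where "g \<in># W" "e \<in># ends g" using e by (auto simp: in_ends_of)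
    then show ?thesis using W by (cases g) (auto simp: wires_def)
  qed
  have t: "out_gen (W + N) e = tail G e" if "e \<in># starts_of (W + N)" "e \<notin> Range (wires (W + N))" for e
  proof -
    have "e \<in># starts_of N" using that wW by auto
    then show ?thesis using out_gen_sub[OF cl(1)] out_gen_sub[OF cl'(1)] by (simp add: G')
  qed
  have h: "in_gen (W + N) e = head G e" if "e \<in># starts_of (W + N)" "e \<notin> Domain (wires (W + N))" for e
  proof -
    have "e \<in># ends_of (W + N)" using that(1) cl'(3) by simp
    then have "e \<in># ends_of N" using that wW' by auto
    then show ?thesis using in_gen_sub[OF cl(2)] in_gen_sub[OF cl'(2)] by (simp add: G')
  qed
  have E: "arcs G - B = set_mset (starts_of (W + N))" by (simp only: B G')
  have "gluing (vertices (W + N)) (set_mset (starts_of (W + N))) (wires (W + N)) (tail G) (head G)"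
    using gluing_net[OF M'] t h by (auto simp: gluing_def image_subset_iff)
  then show g: "gluing (verts G - (tail G ` B \<union> head G ` B)) (arcs G - B) (wires (W + N)) (tail G) (head G)"
    unfolding V' E .
  show "web_iso (resolve B (wires (W + N)) (G, 0)) (net_web (W + N))"
    unfolding resolve_def prod.case net_web_def
  proof (rule splice_iso[OF g, of id id])
    show "out_gen (W + N) (id e) = id (tail G e)" if "e \<in> arcs G - B" "e \<notin> Range (wires (W + N))" for e
      using t[of e] that unfolding E by simp
    show "in_gen (W + N) (id e) = id (head G e)" if "e \<in> arcs G - B" "e \<notin> Domain (wires (W + N))" for e
      using h[of e] that unfolding E by simp
    show "vertices (W + N) = id ` (verts G - (tail G ` B \<union> head G ` B))" by (simp only: V' image_id id_apply)
    show "set_mset (starts_of (W + N)) = id ` (arcs G - B)" by (simp only: E image_id id_apply)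
  qed (simp_all add: prod.map_id)
qed

section \<open>Kuperberg's relations for nets without crossings\<close>

context kuperberg
begin

definition pval :: "'l gen multiset \<Rightarrow> coeff" where
  "pval N = val (net_web N)"

lemma pval_rename:
  assumes "pure N" "closed N" "inj_on \<phi> (set_mset (starts_of N))"
  shows "pval (rename \<phi> N) = pval N"
  using val_iso[OF trivalent_bipartite_net_web[OF assms(1,2)] net_web_rename[OF assms]]
  by (simp add: pval_def)

lemma pval_wire:
  assumes "pure N" "closed (add_mset (Wire a b) N)" "a \<noteq> b"
  shows "pval (add_mset (Wire a b) N) = pval (rename (id(b := a)) N)"
  using val_iso[OF trivalent_bipartite_net_web[OF _ assms(2)] net_web_wire[OF _ assms(2,3)]] assms(1)
  by (simp add: pval_def)

lemma pval_loop:
  assumes "pure N" "closed (add_mset (Wire a a) N)"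
  shows "pval (add_mset (Wire a a) N) = circle_value * pval N"
proof -
  have "pval (add_mset (Wire a a) N) = val (fst (net_web N), Suc (snd (net_web N)))"
    using val_iso[OF trivalent_bipartite_net_web[OF _ assms(2)] net_web_loop[OF _ assms(2)]] assms(1)
    by (simp add: pval_def)
  also have "\<dots> = circle_value * val (fst (net_web N), snd (net_web N))"
    using val_circle[OF trivalent_bipartite_net_web[OF assms(1) closed_loop(1)[OF assms(2)]]] .
  finally show ?thesis by (simp add: pval_def)
qed

lemma pval_bigon_no_wires:
  assumes N: "pure N" and M: "closed ({#Source {#a, b, c#}, Sink {#a, b, d#}#} + N)" and w: "wires N = {}"
  shows "pval ({#Source {#a, b, c#}, Sink {#a, b, d#}#} + N) = bigon_value * pval ({#Wire d c#} + N)"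
proof -
  let ?S = "Source {#a, b, c#}" and ?K = "Sink {#a, b, d#}"
  let ?L = "{#?S, ?K#}"
  let ?G = "fst (net_web (?L + N))"
  have pM: "pure (?L + N)" using N by simp
  note cl = closedD[OF M]
  have M': "closed ({#Wire d c#} + N)" using M by (auto simp: closed_def)
  have wM: "wires (?L + N) = {}" and wM': "wires ({#Wire d c#} + N) = {(d, c)}" using w by (auto simp: wires_def)
  have G: "arcs ?G = set_mset (starts_of (?L + N))" "tail ?G = out_gen (?L + N)" "head ?G = in_gen (?L + N)"
    "net_web (?L + N) = (?G, 0)"
    unfolding net_web_no_wires[OF wM] by simp_all
  have dist: "a \<noteq> b" "a \<noteq> c" "b \<noteq> c" "a \<notin># starts_of N" "b \<notin># starts_of N" "a \<noteq> d" "b \<noteq> d"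
    using cl(1,2) by auto
  have out: "out_gen (?L + N) x = ?S" if "x \<in> {a, b, c}" for x
    by (rule out_gen_eq[OF cl(1)]) (use that in auto)
  have "in": "in_gen (?L + N) x = ?K" if "x \<in> {a, b, d}" for x
    by (rule in_gen_eq[OF cl(2)]) (use that in auto)
  have "d \<in># ends_of (?L + N)" by simp
  then have d: "d \<in> arcs ?G" unfolding cl(3) G(1) .
  have "set_mset (starts_of ({#Wire d c#} + N)) = set_mset (starts_of (?L + N)) - {a, b}"
    using dist by auto
  moreover have "out_gen (?L + N) ` {a, b} \<union> in_gen (?L + N) ` {a, b} = set_mset ?L"
    using out "in" by auto
  ultimately have res: "gluing (verts ?G - (tail ?G ` {a, b} \<union> head ?G ` {a, b})) (arcs ?G - {a, b}) {(d, c)} (tail ?G) (head ?G)"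
    "web_iso (resolve {a, b} {(d, c)} (?G, 0)) (net_web ({#Wire d c#} + N))"
    using resolve_net[OF pM M wM _ M' _ _ _ refl, of "{a, b}"] N unfolding wM' by auto
  have triv: "trivalent_bipartite (fst (resolve {a, b} {(d, c)} (?G, 0)))"
    using trivalent_bipartite_web_iso[OF trivalent_bipartite_net_web[OF _ M'] web_iso_sym[OF res(2)]] N by simp
  have "val (?G, 0) = bigon_value * val (resolve {a, b} {(d, c)} (?G, 0))"
  proof (rule val_bigon[OF trivalent_bipartite_net_web[OF pM M] _ _ _ _ res(1) triv])
    show "bigon ?G a b" using out "in" dist unfolding bigon_def G(1-3) by simp
    show "{c, d} \<subseteq> arcs ?G - {a, b}" using dist d unfolding G(1) by auto
    show "tail ?G c = tail ?G a" "head ?G d = head ?G a" unfolding G(1-3) using out "in" by simp_all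
  qed
  then show ?thesis
    using val_iso[OF triv res(2)] G(4) by (simp add: pval_def)
qed

text \<open>The remaining wires of \<open>N\<close> are contracted simultaneously on both sides
  until the case without wires is reached; loops contribute the same circle factor to both
  sides.\<close>

lemma pval_bigon:
  assumes "pure N" "closed ({#Source {#a, b, c#}, Sink {#a, b, d#}#} + N)"
  shows "pval ({#Source {#a, b, c#}, Sink {#a, b, d#}#} + N) = bigon_value * pval ({#Wire d c#} + N)"
  using assms
proof (induction "size N" arbitrary: N c d rule: less_induct)
  case less
  let ?L = "{#Source {#a, b, c#}, Sink {#a, b, d#}#}"
  show ?case
  proof (cases "wires N = {}")
    case True
    then show ?thesis using pval_bigon_no_wires[OF less.prems True] by simp
  next
    case False
    then obtain x y where "Wire x y \<in># N" by (auto simp: wires_def)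
    then obtain N' where N': "N = add_mset (Wire x y) N'" by (meson multi_member_split)
    have pN': "pure N'" using less.prems by (simp add: N')
    have M: "closed (add_mset (Wire x y) (?L + N'))" using less.prems(2) by (simp add: N')
    have R: "closed (add_mset (Wire x y) ({#Wire d c#} + N'))" using M by (auto simp: closed_def)
    \<comment> \<open>\<open>y\<close> is already used as a start by the wire, so it differs from
      the starts \<open>a\<close>, \<open>b\<close>, \<open>c\<close>. Only \<open>d\<close>, an
      end, may be renamed; therefore the bigon keeps its shape and the induction generalizes
      \<open>d\<close>.\<close>
    have dist: "y \<notin> {a, b, c}" using closedD(1)[OF M] by auto
    show ?thesis
    proof (cases "x = y")
      case True
      have "pval (?L + N') = bigon_value * pval ({#Wire d c#} + N')"
        by (rule less.hyps) (use N' pN' closed_loop(1)[of x "?L + N'"] M True in auto)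
      then show ?thesis
        using pval_loop[of "?L + N'" x] pval_loop[of "{#Wire d c#} + N'" x] M R pN'
        unfolding N' True by (simp add: mult.left_commute)
    next
      case False
      let ?\<phi> = "id(y := x)"
      have ren: "rename ?\<phi> (?L + N') = {#Source {#a, b, c#}, Sink {#a, b, ?\<phi> d#}#} + rename ?\<phi> N'"
        "rename ?\<phi> ({#Wire d c#} + N') = {#Wire (?\<phi> d) c#} + rename ?\<phi> N'"
        using dist by auto
      have "pval ({#Source {#a, b, c#}, Sink {#a, b, ?\<phi> d#}#} + rename ?\<phi> N') =
          bigon_value * pval ({#Wire (?\<phi> d) c#} + rename ?\<phi> N')"
        by (rule less.hyps) (use N' pN' closed_wire(1)[OF M False] in \<open>simp_all only: ren pure_rename, simp_all\<close>)
      then show ?thesis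
        using pval_wire[OF _ M False] pval_wire[OF _ R False] pN' unfolding ren N'
        by (simp add: add_mset_commute)
    qed
  qed
qed

lemma pval_quadrilateral_no_wires:
  assumes N: "pure N" and w: "wires N = {}"
    and M: "closed ({#Source {#a, d, e1#}, Sink {#a, b, e2#}, Source {#b, c, e3#}, Sink {#c, d, e4#}#} + N)"
      (is "closed (?L + N)")
  shows "pval (?L + N) = pval ({#Wire e2 e1, Wire e4 e3#} + N) + pval ({#Wire e2 e3, Wire e4 e1#} + N)"
proof -
  let ?S = "Source {#a, d, e1#}" and ?K = "Sink {#a, b, e2#}" and ?S' = "Source {#b, c, e3#}" and ?K' = "Sink {#c, d, e4#}"
  let ?W1 = "{#Wire e2 e1, Wire e4 e3#}" and ?W2 = "{#Wire e2 e3, Wire e4 e1#}"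
  let ?R1 = "{(e2, e1), (e4, e3)}" and ?R2 = "{(e2, e3), (e4, e1)}"
  let ?G = "fst (net_web (?L + N))" and ?B = "{a, b, c, d}"
  have pM: "pure (?L + N)" using N by simp
  note cl = closedD[OF M]
  have M': "closed (?W1 + N)" "closed (?W2 + N)" using M by (auto simp: closed_def add_mset_commute)
  have wM: "wires (?L + N) = {}" and wM': "wires (?W1 + N) = ?R1" "wires (?W2 + N) = ?R2"
    using w by (auto simp: wires_def)
  have G: "arcs ?G = set_mset (starts_of (?L + N))" "tail ?G = out_gen (?L + N)" "head ?G = in_gen (?L + N)"
    "net_web (?L + N) = (?G, 0)"
    unfolding net_web_no_wires[OF wM] by simp_all
  have dist: "distinct [a, b, c, d, e1, e3]" "distinct [a, b, c, d, e2, e4]"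
    and distN: "a \<notin># starts_of N" "b \<notin># starts_of N" "c \<notin># starts_of N" "d \<notin># starts_of N"
    using cl(1,2) by auto
  have out: "out_gen (?L + N) x = ?S" if "x \<in> {a, d, e1}" for x
    by (rule out_gen_eq[OF cl(1)]) (use that in auto)
  have out': "out_gen (?L + N) x = ?S'" if "x \<in> {b, c, e3}" for x
    by (rule out_gen_eq[OF cl(1)]) (use that in auto)
  have "in": "in_gen (?L + N) x = ?K" if "x \<in> {a, b, e2}" for x
    by (rule in_gen_eq[OF cl(2)]) (use that in auto)
  have in': "in_gen (?L + N) x = ?K'" if "x \<in> {c, d, e4}" for x
    by (rule in_gen_eq[OF cl(2)]) (use that in auto)
  have "e2 \<in># ends_of (?L + N)" "e4 \<in># ends_of (?L + N)" by simp_all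
  then have e: "e2 \<in> arcs ?G" "e4 \<in> arcs ?G" unfolding cl(3) G(1) by this+
  have E: "set_mset (starts_of (?W1 + N)) = set_mset (starts_of (?L + N)) - ?B"
    "set_mset (starts_of (?W2 + N)) = set_mset (starts_of (?L + N)) - ?B"
    using dist distN by auto
  have V: "out_gen (?L + N) ` ?B \<union> in_gen (?L + N) ` ?B = set_mset ?L"
    using out out' "in" in' by auto
  have res: "gluing (verts ?G - (tail ?G ` ?B \<union> head ?G ` ?B)) (arcs ?G - ?B) ?R1 (tail ?G) (head ?G)"
    "web_iso (resolve ?B ?R1 (?G, 0)) (net_web (?W1 + N))"
    using resolve_net[OF pM M wM _ M'(1) _ E(1) V refl] N unfolding wM' by auto
  have res': "gluing (verts ?G - (tail ?G ` ?B \<union> head ?G ` ?B)) (arcs ?G - ?B) ?R2 (tail ?G) (head ?G)"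
    "web_iso (resolve ?B ?R2 (?G, 0)) (net_web (?W2 + N))"
    using resolve_net[OF pM M wM _ M'(2) _ E(2) V refl] N unfolding wM' by auto
  have triv: "trivalent_bipartite (fst (resolve ?B ?R1 (?G, 0)))"
    using trivalent_bipartite_web_iso[OF trivalent_bipartite_net_web[OF _ M'(1)] web_iso_sym[OF res(2)]] N by simp
  have triv': "trivalent_bipartite (fst (resolve ?B ?R2 (?G, 0)))"
    using trivalent_bipartite_web_iso[OF trivalent_bipartite_net_web[OF _ M'(2)] web_iso_sym[OF res'(2)]] N by simp
  have ne: "{#a, d, e1#} \<noteq> {#b, c, e3#}" "{#a, b, e2#} \<noteq> {#c, d, e4#}"
    using dist by (metis distinct_length_2_or_more insert_iff set_mset_add_mset_insert set_mset_empty empty_iff)+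
  have "val (?G, 0) = val (resolve ?B ?R1 (?G, 0)) + val (resolve ?B ?R2 (?G, 0))"
  proof (rule val_quadrilateral[OF trivalent_bipartite_net_web[OF pM M] _ _ _ _ _ _ refl refl])
    show "quadrilateral ?G a b c d"
      unfolding quadrilateral_def G(1-3)
      using out[of a] out[of d] out'[of b] out'[of c] "in"[of a] "in"[of b] in'[of c] in'[of d] ne by simp
    show "{e1, e2, e3, e4} \<subseteq> arcs ?G - ?B" using dist e unfolding G(1) by auto
    show "tail ?G e1 = tail ?G a" "head ?G e2 = head ?G a" "tail ?G e3 = tail ?G c" "head ?G e4 = head ?G c"
      unfolding G(1-3) using out out' "in" in' by simp_all
  qed (use res(1) res'(1) triv triv' in blast)+
  then show ?thesis
    using val_iso[OF triv res(2)] val_iso[OF triv' res'(2)] G(4) by (simp add: pval_def)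
qed

lemma pval_quadrilateral:
  assumes "pure N"
    and "closed ({#Source {#a, d, e1#}, Sink {#a, b, e2#}, Source {#b, c, e3#}, Sink {#c, d, e4#}#} + N)"
  shows "pval ({#Source {#a, d, e1#}, Sink {#a, b, e2#}, Source {#b, c, e3#}, Sink {#c, d, e4#}#} + N) =
    pval ({#Wire e2 e1, Wire e4 e3#} + N) + pval ({#Wire e2 e3, Wire e4 e1#} + N)"
  using assms
proof (induction "size N" arbitrary: N e1 e2 e3 e4 rule: less_induct)
  case less
  let ?L = "\<lambda>e1 e2 e3 e4. {#Source {#a, d, e1#}, Sink {#a, b, e2#}, Source {#b, c, e3#}, Sink {#c, d, e4#}#}"
  let ?W1 = "{#Wire e2 e1, Wire e4 e3#}" and ?W2 = "{#Wire e2 e3, Wire e4 e1#}"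
  show ?case
  proof (cases "wires N = {}")
    case True
    show ?thesis by (rule pval_quadrilateral_no_wires[OF less.prems(1) True less.prems(2)])
  next
    case False
    then obtain x y where "Wire x y \<in># N" by (auto simp: wires_def)
    then obtain N' where N': "N = add_mset (Wire x y) N'" by (meson multi_member_split)
    have pN': "pure N'" using less.prems by (simp add: N')
    have M: "closed (add_mset (Wire x y) (?L e1 e2 e3 e4 + N'))"
      using less.prems(2) by (simp add: N' add_mset_commute)
    have R: "closed (add_mset (Wire x y) (?W1 + N'))" "closed (add_mset (Wire x y) (?W2 + N'))"
      using M by (auto simp: closed_def add_mset_commute)
    \<comment> \<open>As for the bigon, renaming \<open>y\<close> can affect only the incoming
      external labels \<open>e2\<close> and \<open>e4\<close>.\<close>
    have dist: "y \<notin> {a, b, c, d, e1, e3}" using closedD(1)[OF M] by auto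
    show ?thesis
    proof (cases "x = y")
      case True
      have "pval (?L e1 e2 e3 e4 + N') = pval (?W1 + N') + pval (?W2 + N')"
        by (rule less.hyps) (use N' pN' closed_loop(1)[of x "?L e1 e2 e3 e4 + N'"] M True in auto)
      moreover have "pval (add_mset (Wire x y) (?L e1 e2 e3 e4 + N')) = circle_value * pval (?L e1 e2 e3 e4 + N')"
        "pval (add_mset (Wire x y) (?W1 + N')) = circle_value * pval (?W1 + N')"
        "pval (add_mset (Wire x y) (?W2 + N')) = circle_value * pval (?W2 + N')"
        using M R pN' unfolding True by (intro pval_loop; simp)+
      ultimately have "pval (add_mset (Wire x y) (?L e1 e2 e3 e4 + N')) =
          pval (add_mset (Wire x y) (?W1 + N')) + pval (add_mset (Wire x y) (?W2 + N'))"
        by (simp only: distrib_left)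
      then show ?thesis unfolding N' union_mset_add_mset_right .
    next
      case False
      define \<phi> where "\<phi> = id(y := x)"
      have \<phi>: "\<phi> a = a" "\<phi> b = b" "\<phi> c = c" "\<phi> d = d" "\<phi> e1 = e1" "\<phi> e3 = e3"
        using dist by (auto simp: \<phi>_def)
      have ren: "rename \<phi> (?L e1 e2 e3 e4 + N') = ?L e1 (\<phi> e2) e3 (\<phi> e4) + rename \<phi> N'"
        "rename \<phi> (?W1 + N') = {#Wire (\<phi> e2) e1, Wire (\<phi> e4) e3#} + rename \<phi> N'"
        "rename \<phi> (?W2 + N') = {#Wire (\<phi> e2) e3, Wire (\<phi> e4) e1#} + rename \<phi> N'"
        by (simp_all add: \<phi>)
      have "pval (?L e1 (\<phi> e2) e3 (\<phi> e4) + rename \<phi> N') =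
          pval ({#Wire (\<phi> e2) e1, Wire (\<phi> e4) e3#} + rename \<phi> N') +
          pval ({#Wire (\<phi> e2) e3, Wire (\<phi> e4) e1#} + rename \<phi> N')"
        by (rule less.hyps) (use N' pN' closed_wire(1)[OF M False, folded \<phi>_def] in \<open>simp_all only: ren pure_rename, simp_all\<close>)
      then have "pval (add_mset (Wire x y) (?L e1 e2 e3 e4 + N')) =
          pval (add_mset (Wire x y) (?W1 + N')) + pval (add_mset (Wire x y) (?W2 + N'))"
        using pval_wire[OF _ M False] pval_wire[OF _ R(1) False] pval_wire[OF _ R(2) False] pN'
        unfolding \<phi>_def[symmetric] ren by simp
      then show ?thesis unfolding N' union_mset_add_mset_right .
    qed
  qed
qed

end


section \<open>Evaluation of nets with crossings\<close>

text \<open>Both local states of a crossing have one crossing less. A relation that is linear in the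
  value of the rest thus extends from nets without crossings to all nets.\<close>

lemma crossing_induct [case_names pure crossing]:
  assumes "\<And>N. pure N \<Longrightarrow> P N"
    and "\<And>e m i j k l N. P ({#Wire i l, Wire j k#} + N) \<Longrightarrow>
      P ({#Sink {#i, j, m#}, Source {#k, l, m#}#} + N) \<Longrightarrow> P (add_mset (Crossing e m i j k l) N)"
  shows "P N"
proof (induction "size (filter_mset is_Crossing N)" arbitrary: N rule: less_induct)
  case less
  show ?case
  proof (cases "pure N")
    case False
    then obtain g where "g \<in># N" "is_Crossing g" by (auto simp: pure_def)
    then obtain e m i j k l N' where N': "N = add_mset (Crossing e m i j k l) N'"
      by (metis is_Crossing_def multi_member_split)
    show ?thesis unfolding N' by (intro assms(2) less) (simp_all add: N')
  qed (rule assms(1))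
qed

text \<open>Replaces \<open>L\<close> by \<open>L'\<close> when the labels \<open>B\<close> that
  disappear are used inside \<open>L\<close> both as start and as end. It settles nearly all side
  conditions on closedness in the local computations; choosing \<open>B\<close> empty covers a mere
  redistribution of labels.\<close>

lemma closed_reduce:
  assumes "closed (L + N)" "starts_of L = starts_of L' + B" "ends_of L = ends_of L' + B"
    and "\<forall>g \<in># L'. trivalent g"
  shows "closed (L' + N)"
proof -
  have "no_dup (B + (starts_of L' + starts_of N))" "no_dup (B + (ends_of L' + ends_of N))"
    using assms(1-3) by (simp_all add: closed_def ac_simps)
  then have "no_dup (starts_of L' + starts_of N)" "no_dup (ends_of L' + ends_of N)"
    using no_dup_unionD by blast+
  then show ?thesis using assms by (auto simp: closed_def ac_simps)
qed

lemma closed_crossing: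
  assumes "closed (add_mset (Crossing e m i j k l) N)"
  shows "closed ({#Wire i l, Wire j k#} + N)" "closed ({#Sink {#i, j, m#}, Source {#k, l, m#}#} + N)"
proof -
  have c: "closed ({#Crossing e m i j k l#} + N)" using assms by simp
  show "closed ({#Wire i l, Wire j k#} + N)"
    by (rule closed_reduce[OF c, of _ "{#m#}"]) (simp_all add: add_mset_commute)
  show "closed ({#Sink {#i, j, m#}, Source {#k, l, m#}#} + N)"
    by (rule closed_reduce[OF c, of _ "{#}"]) simp_all
qed

lemma map_gen_fresh: "\<forall>l \<in># starts g + ends g. \<phi> l = l \<Longrightarrow> map_gen \<phi> g = g"
  by (cases g) (auto intro: multiset.map_ident_strong)

lemma rename_fresh:
  assumes "\<forall>l \<in># starts_of N + ends_of N. \<phi> l = l"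
  shows "rename \<phi> N = N"
proof -
  have "\<forall>g \<in># N. map_gen \<phi> g = g"
  proof (intro ballI map_gen_fresh)
    fix g l assume "g \<in># N" "l \<in># starts g + ends g"
    then have "l \<in># starts_of N + ends_of N" by (auto simp: in_starts_of in_ends_of)
    then show "\<phi> l = l" using assms by blast
  qed
  then show ?thesis by (simp add: multiset.map_ident_strong)
qed

context kuperberg
begin

text \<open>One step of the state expansion, in continuation style: \<open>F\<close> evaluates the
  generators still to come, and the argument \<open>M\<close> collects the crossingless ones already
  produced. A fold of these steps expands all crossings and ends with \<open>pval\<close>.\<close>

definition cross_step :: "'l gen \<Rightarrow> ('l gen multiset \<Rightarrow> coeff) \<Rightarrow> 'l gen multiset \<Rightarrow> coeff" where
  "cross_step g F M = (case g of
     Crossing e m i j k l \<Rightarrow> A_pow (2 * e) * F ({#Wire i l, Wire j k#} + M) -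
       A_pow (- e) * F ({#Sink {#i, j, m#}, Source {#k, l, m#}#} + M)
   | _ \<Rightarrow> F (add_mset g M))"

definition ev :: "'l gen multiset \<Rightarrow> coeff" where
  "ev N = fold_mset cross_step pval N {#}"

text \<open>The order in which two crossings are expanded does not matter, which is what makes the
  fold over a multiset meaningful.\<close>

lemma comp_fun_commute_cross_step: "comp_fun_commute (cross_step :: 'l gen \<Rightarrow> _)"
proof
  fix g h :: "'l gen"
  show "cross_step h \<circ> cross_step g = cross_step g \<circ> cross_step h"
    by (cases g; cases h) (auto simp: fun_eq_iff cross_step_def algebra_simps add_mset_commute)
qed

lemma fold_cross_step_add_mset:
  "fold_mset cross_step F (add_mset g N) = cross_step g (fold_mset cross_step F N)"
  by (rule comp_fun_commute.fold_mset_add_mset[OF comp_fun_commute_cross_step])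

text \<open>Crossingless generators are only handed on, so they may wait in the accumulator or in
  the multiset. This turns the wires and vertices created by an expansion back into part of the
  net.\<close>

lemma fold_cross_step_pure:
  "pure P \<Longrightarrow> fold_mset cross_step F N (P + M) = fold_mset cross_step F (P + N) M"
proof (induction P arbitrary: M)
  case (add g P)
  have "fold_mset cross_step F N (add_mset g P + M) = fold_mset cross_step F N (P + add_mset g M)" by simp
  also have "\<dots> = fold_mset cross_step F (P + N) (add_mset g M)"
    using add.IH[of "add_mset g M"] add.prems by simp
  also have "\<dots> = fold_mset cross_step F (add_mset g P + N) M"
    using add.prems by (cases g) (simp_all add: fold_cross_step_add_mset cross_step_def)
  finally show ?case .
qed simp

lemma ev_pure: "pure N \<Longrightarrow> ev N = pval N"
  using fold_cross_step_pure[of N pval "{#}" "{#}"] by (simp add: ev_def)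

lemma ev_crossing:
  "ev (add_mset (Crossing e m i j k l) N) = A_pow (2 * e) * ev ({#Wire i l, Wire j k#} + N) -
     A_pow (- e) * ev ({#Sink {#i, j, m#}, Source {#k, l, m#}#} + N)"
  using fold_cross_step_pure[of "{#Wire i l, Wire j k#}" pval N "{#}"]
    fold_cross_step_pure[of "{#Sink {#i, j, m#}, Source {#k, l, m#}#}" pval N "{#}"]
  by (simp add: ev_def fold_cross_step_add_mset[of _ "Crossing e m i j k l"] cross_step_def)

text \<open>Exchanging the strands, that is \<open>i\<close>, \<open>k\<close> with
  \<open>j\<close>, \<open>l\<close>, permutes the wires of the oriented state and the legs in the
  unoriented one. Hence the value depends on the sign but not on which strand is over.\<close>

lemma ev_crossing_swap: "ev (add_mset (Crossing e m i j k l) N) = ev (add_mset (Crossing e m j i l k) N)"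
  unfolding ev_crossing by (simp add: add_mset_commute)

lemma ev_rename:
  assumes "closed N" "inj_on \<phi> (set_mset (starts_of N))"
  shows "ev (rename \<phi> N) = ev N"
  using assms
proof (induction N rule: crossing_induct)
  case (pure N)
  then show ?case using pval_rename by (simp add: ev_pure)
next
  case (crossing e m i j k l N)
  have "inj_on \<phi> (set_mset (starts_of ({#Wire i l, Wire j k#} + N)))"
    "inj_on \<phi> (set_mset (starts_of ({#Sink {#i, j, m#}, Source {#k, l, m#}#} + N)))"
    using crossing.prems(2) by (auto elim!: inj_on_subset)
  then show ?case
    using crossing.IH closed_crossing[OF crossing.prems(1)] by (simp add: ev_crossing)
qed

lemma ev_wire:
  assumes "closed (add_mset (Wire a b) N)" "a \<noteq> b"
  shows "ev (add_mset (Wire a b) N) = ev (rename (id(b := a)) N)"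
  using assms(1)
proof (induction N rule: crossing_induct)
  case (pure N)
  have "pval (add_mset (Wire a b) N) = pval (rename (id(b := a)) N)"
    by (rule pval_wire[OF pure assms(2)])
  moreover have "pure (rename (id(b := a)) N)" using pure(1) by (simp only: pure_rename)
  ultimately show ?case using pure(1) by (simp only: ev_pure pure_simps gen.disc not_False_eq_True simp_thms)
next
  case (crossing e m i j k l N)
  have c: "closed (add_mset (Crossing e m i j k l) (add_mset (Wire a b) N))"
    using crossing.prems by (simp add: add_mset_commute)
  define \<phi> where "\<phi> = id(b := a)"
  have "ev (add_mset (Wire a b) (add_mset (Crossing e m i j k l) N)) =
     A_pow (2 * e) * ev (add_mset (Wire a b) ({#Wire i l, Wire j k#} + N)) -
     A_pow (- e) * ev (add_mset (Wire a b) ({#Sink {#i, j, m#}, Source {#k, l, m#}#} + N))"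
    unfolding add_mset_commute[of "Wire a b" "Crossing e m i j k l"] ev_crossing by simp
  also have "\<dots> = A_pow (2 * e) * ev (rename \<phi> ({#Wire i l, Wire j k#} + N)) -
     A_pow (- e) * ev (rename \<phi> ({#Sink {#i, j, m#}, Source {#k, l, m#}#} + N))"
    using crossing.IH[folded \<phi>_def] closed_crossing[OF c] unfolding union_mset_add_mset_right by simp
  also have "\<dots> = ev (rename \<phi> (add_mset (Crossing e m i j k l) N))"
    by (simp add: ev_crossing)
  finally show ?case unfolding \<phi>_def .
qed

lemma ev_loop:
  assumes "closed (add_mset (Wire a a) N)"
  shows "ev (add_mset (Wire a a) N) = circle_value * ev N"
  using assms
proof (induction N rule: crossing_induct)
  case (pure N)
  then show ?case using pval_loop by (simp add: ev_pure)
next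
  case (crossing e m i j k l N)
  have c: "closed (add_mset (Crossing e m i j k l) (add_mset (Wire a a) N))"
    using crossing.prems by (simp add: add_mset_commute)
  have "ev (add_mset (Wire a a) (add_mset (Crossing e m i j k l) N)) =
     A_pow (2 * e) * ev (add_mset (Wire a a) ({#Wire i l, Wire j k#} + N)) -
     A_pow (- e) * ev (add_mset (Wire a a) ({#Sink {#i, j, m#}, Source {#k, l, m#}#} + N))"
    unfolding add_mset_commute[of "Wire a a" "Crossing e m i j k l"] ev_crossing by simp
  also have "\<dots> = circle_value * ev (add_mset (Crossing e m i j k l) N)"
    using crossing.IH closed_crossing[OF c] unfolding ev_crossing union_mset_add_mset_right
    by (simp add: algebra_simps)
  finally show ?case .
qed

text \<open>Both sides expand along the crossings of \<open>N\<close> in the same way. The second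
  conclusion supplies the closedness that the next rewriting step asks for.\<close>

lemma ev_bigon:
  assumes "closed ({#Source {#a, b, c#}, Sink {#a, b, d#}#} + N)"
  shows "ev ({#Source {#a, b, c#}, Sink {#a, b, d#}#} + N) = bigon_value * ev ({#Wire d c#} + N)" (is ?ev)
    and "closed ({#Wire d c#} + N)"
proof -
  show "closed ({#Wire d c#} + N)"
    by (rule closed_reduce[OF assms, of _ "{#a, b#}"]) (simp_all add: add_mset_commute)
  show ?ev using assms
proof (induction N rule: crossing_induct)
  case (pure N)
  then show ?case using pval_bigon[OF pure(1)] by (simp add: ev_pure)
next
  case (crossing e m i j k l N)
  let ?L = "{#Source {#a, b, c#}, Sink {#a, b, d#}#}"
  have c: "closed (add_mset (Crossing e m i j k l) (?L + N))"
    using crossing.prems unfolding union_mset_add_mset_right .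
  have c': "closed (?L + ({#Wire i l, Wire j k#} + N))"
    "closed (?L + ({#Sink {#i, j, m#}, Source {#k, l, m#}#} + N))"
    using closed_crossing[OF c] by (simp_all only: union_lcomm)
  have "ev (?L + add_mset (Crossing e m i j k l) N) =
     A_pow (2 * e) * ev (?L + ({#Wire i l, Wire j k#} + N)) -
     A_pow (- e) * ev (?L + ({#Sink {#i, j, m#}, Source {#k, l, m#}#} + N))"
    unfolding union_mset_add_mset_right ev_crossing by (simp only: union_lcomm)
  also have "\<dots> = bigon_value * ev ({#Wire d c#} + add_mset (Crossing e m i j k l) N)"
    unfolding crossing.IH(1)[OF c'(1)] crossing.IH(2)[OF c'(2)] union_mset_add_mset_right ev_crossing
    by (simp only: union_lcomm right_diff_distrib mult.left_commute)
  finally show ?case .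
qed
qed

lemma ev_quadrilateral:
  assumes "closed ({#Source {#a, d, e1#}, Sink {#a, b, e2#}, Source {#b, c, e3#}, Sink {#c, d, e4#}#} + N)"
    (is "closed (?L + N)")
  shows "ev (?L + N) = ev ({#Wire e2 e1, Wire e4 e3#} + N) + ev ({#Wire e2 e3, Wire e4 e1#} + N)" (is ?ev)
    and "closed ({#Wire e2 e1, Wire e4 e3#} + N)"
    and "closed ({#Wire e2 e3, Wire e4 e1#} + N)"
proof -
  show "closed ({#Wire e2 e1, Wire e4 e3#} + N)" "closed ({#Wire e2 e3, Wire e4 e1#} + N)"
    by (rule closed_reduce[OF assms, of _ "{#a, b, c, d#}"]; simp add: add_mset_commute)+
  show ?ev using assms
proof (induction N rule: crossing_induct)
  case (pure N)
  then show ?case using pval_quadrilateral[OF pure(1)] by (simp add: ev_pure)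
next
  case (crossing e m i j k l N)
  have c: "closed (add_mset (Crossing e m i j k l) (?L + N))"
    using crossing.prems unfolding union_mset_add_mset_right .
  have c': "closed (?L + ({#Wire i l, Wire j k#} + N))"
    "closed (?L + ({#Sink {#i, j, m#}, Source {#k, l, m#}#} + N))"
    using closed_crossing[OF c] by (simp_all only: union_lcomm)
  have "ev (?L + add_mset (Crossing e m i j k l) N) =
     A_pow (2 * e) * ev (?L + ({#Wire i l, Wire j k#} + N)) -
     A_pow (- e) * ev (?L + ({#Sink {#i, j, m#}, Source {#k, l, m#}#} + N))"
    unfolding union_mset_add_mset_right ev_crossing by (simp only: union_lcomm)
  also have "\<dots> = ev ({#Wire e2 e1, Wire e4 e3#} + add_mset (Crossing e m i j k l) N) +
      ev ({#Wire e2 e3, Wire e4 e1#} + add_mset (Crossing e m i j k l) N)"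
    unfolding crossing.IH(1)[OF c'(1)] crossing.IH(2)[OF c'(2)] union_mset_add_mset_right ev_crossing
    by (simp only: union_lcomm distrib_left) (simp only: diff_conv_add_uminus minus_add_distrib ac_simps)
  finally show ?case .
qed
qed

section \<open>Absorbing a wire into a neighbouring generator\<close>

lemma ev_wire_in:
  assumes c: "closed (add_mset (Wire a b) (L + N))" and b: "b \<in># ends_of L"
  shows "ev (add_mset (Wire a b) (L + N)) = ev (rename (id(b := a)) L + N)"
proof -
  have "a \<noteq> b" using closedD(2)[OF c] b by auto
  moreover have "b \<notin># ends_of N" "b \<notin># starts_of N"
    using closedD(1,2)[OF c] b no_dup_unionD[of "ends_of L" "ends_of N"] by auto
  then have "rename (id(b := a)) N = N" by (intro rename_fresh) auto
  ultimately show ?thesis using ev_wire[OF c] by simp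
qed

text \<open>Contraction keeps the name \<open>a\<close>, whereas here the outer label
  \<open>b\<close> must survive so that \<open>N\<close> is untouched. Hence the contracted label is
  renamed afterwards.\<close>

lemma ev_wire_out:
  assumes c: "closed (add_mset (Wire a b) (L + N))" and a: "a \<in># starts_of L"
  shows "ev (add_mset (Wire a b) (L + N)) = ev (rename (id(a := b)) L + N)"
proof -
  have ab: "a \<noteq> b" using closedD(1)[OF c] a by auto
  have "a \<notin># ends_of N" "a \<notin># starts_of N"
    using closedD(1,2)[OF c] a no_dup_unionD[of "starts_of L" "starts_of N"] by auto
  then have N: "rename (id(a := b)) N = N" by (intro rename_fresh) auto
  have "b \<notin># starts_of (L + N)" using closed_wire(2)[OF c ab] .
  then have inj: "inj_on (id(a := b)) (set_mset (starts_of (rename (id(b := a)) (L + N))))"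
    using ab by (auto simp: inj_on_def)
  \<comment> \<open>After the contraction \<open>b\<close> no longer occurs as a label, so renaming
    \<open>a\<close> to \<open>b\<close> is injective.\<close>
  have "ev (rename (id(a := b)) (rename (id(b := a)) (L + N))) = ev (add_mset (Wire a b) (L + N))"
    using ev_rename[OF closed_wire(1)[OF c ab] inj] ev_wire[OF c ab] by simp
  moreover have "rename (id(a := b)) (rename (id(b := a)) (L + N)) = rename (id(a := b)) (L + N)"
    unfolding multiset.map_comp gen.map_comp comp_def
    by (intro image_mset_cong gen.map_cong0) (auto simp: fun_eq_iff)
  ultimately show ?thesis using N by simp
qed

lemma ev_wire_sink:
  assumes "closed ({#Wire a b, Sink (add_mset b A)#} + N)"
  shows "ev ({#Wire a b, Sink (add_mset b A)#} + N) = ev ({#Sink (add_mset a A)#} + N)"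
    and "closed ({#Sink (add_mset a A)#} + N)"
proof -
  show "closed ({#Sink (add_mset a A)#} + N)"
    by (rule closed_reduce[OF assms, of _ "{#b#}"]) (use assms in \<open>simp_all add: closed_def\<close>)
  have "b \<notin># A" using closedD(2)[OF assms] no_dup_unionD[of A "ends_of N"] by auto
  then have "image_mset (id(b := a)) A = A" by (intro multiset.map_ident_strong) auto
  then show "ev ({#Wire a b, Sink (add_mset b A)#} + N) = ev ({#Sink (add_mset a A)#} + N)"
    using ev_wire_in[of a b "{#Sink (add_mset b A)#}" N] assms by simp
qed

lemma ev_wire_source:
  assumes "closed ({#Wire a b, Source (add_mset a A)#} + N)"
  shows "ev ({#Wire a b, Source (add_mset a A)#} + N) = ev ({#Source (add_mset b A)#} + N)"
    and "closed ({#Source (add_mset b A)#} + N)"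
proof -
  show "closed ({#Source (add_mset b A)#} + N)"
    by (rule closed_reduce[OF assms, of _ "{#a#}"]) (use assms in \<open>simp_all add: closed_def\<close>)
  have "a \<notin># A" using closedD(1)[OF assms] no_dup_unionD[of A "starts_of N"] by auto
  then have "image_mset (id(a := b)) A = A" by (intro multiset.map_ident_strong) auto
  then show "ev ({#Wire a b, Source (add_mset a A)#} + N) = ev ({#Source (add_mset b A)#} + N)"
    using ev_wire_out[of a b "{#Source (add_mset a A)#}" N] assms by simp
qed

lemma ev_wire_wire:
  assumes "closed ({#Wire a b, Wire b c#} + N)"
  shows "ev ({#Wire a b, Wire b c#} + N) = ev ({#Wire a c#} + N)"
    and "closed ({#Wire a c#} + N)"
proof -
  show "closed ({#Wire a c#} + N)"
    by (rule closed_reduce[OF assms, of _ "{#b#}"]) simp_all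
  have "b \<noteq> c" using closedD(1)[OF assms] by auto
  then show "ev ({#Wire a b, Wire b c#} + N) = ev ({#Wire a c#} + N)"
    using ev_wire_in[of a b "{#Wire b c#}" N] assms by simp
qed

lemma ev_relabel:
  assumes "closed (L + N)" "inj_on \<phi> (set_mset (starts_of (L + N)))"
    and "\<forall>l \<in># starts_of N + ends_of N. \<phi> l = l"
  shows "ev (L + N) = ev (rename \<phi> L + N)"
  using ev_rename[OF assms(1,2)] rename_fresh[OF assms(3)] by simp

end


section \<open>Local relations\<close>

lemma A_pow_mult_left: "A_pow m * (A_pow n * x) = A_pow (m + n) * x"
  by (simp add: A_pow_add mult.assoc)

lemmas A_pow_simps = A_pow_add[symmetric] A_pow_mult_left A_pow_0 bigon_value_def circle_value_def

context kuperberg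
begin

text \<open>The oriented state splits off a circle and the unoriented one is a bigon. For
  \<open>e = 1\<close> the coefficients give A^2 (A^6 + 1 + A^-6) - A^-1 (A^3 + A^-3) = A^8, and
  \<open>e = -1\<close> is the same with A inverted.\<close>

lemma ev_kink:
  assumes e: "e = 1 \<or> e = -1" and c: "closed ({#Crossing e m i c c l#} + N)"
  shows "ev ({#Crossing e m i c c l#} + N) = A_pow (8 * e) * ev ({#Wire i l#} + N)"
proof -
  have 1: "closed ({#Wire c c, Wire i l#} + N)"
    by (rule closed_reduce[OF c, of _ "{#m#}"]) simp_all
  have 2: "closed ({#Source {#c, m, l#}, Sink {#c, m, i#}#} + N)"
    by (rule closed_reduce[OF c, of _ "{#}"]) (simp_all add: add_mset_commute)
  have "ev ({#Wire i l, Wire c c#} + N) = circle_value * ev ({#Wire i l#} + N)"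
    using ev_loop[of c "{#Wire i l#} + N"] 1 by (simp add: add_mset_commute)
  moreover have "ev ({#Sink {#i, c, m#}, Source {#c, l, m#}#} + N) = bigon_value * ev ({#Wire i l#} + N)"
    using ev_bigon[OF 2] by (simp add: add_mset_commute)
  ultimately have "ev ({#Crossing e m i c c l#} + N) =
      A_pow (2 * e) * (circle_value * ev ({#Wire i l#} + N)) - A_pow (- e) * (bigon_value * ev ({#Wire i l#} + N))"
    by (simp add: ev_crossing)
  then show ?thesis using e by (elim disjE) (simp_all add: A_pow_simps algebra_simps)
qed

text \<open>Only the name of the inner edge changes. It is needed when states of crossings with
  different inner labels are to be added or compared.\<close>

lemma ev_bond:
  assumes "closed ({#Sink {#i, j, m#}, Source {#k, l, m#}#} + N)"
    and "closed ({#Sink {#i, j, m'#}, Source {#k, l, m'#}#} + N)"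
  shows "ev ({#Sink {#i, j, m#}, Source {#k, l, m#}#} + N) = ev ({#Sink {#i, j, m'#}, Source {#k, l, m'#}#} + N)"
proof -
  have "ev (rename (id(m := m')) {#Sink {#i, j, m#}, Source {#k, l, m#}#} + N) =
      ev ({#Sink {#i, j, m#}, Source {#k, l, m#}#} + N)"
    by (rule ev_relabel[OF assms(1), symmetric])
      (use assms closedD(2)[OF assms(1)] in \<open>auto simp: closed_def inj_on_def\<close>)
  moreover have "i \<noteq> m" "j \<noteq> m" "k \<noteq> m" "l \<noteq> m" using assms(1) by (auto simp: closed_def)
  ultimately show ?thesis by simp
qed

lemma ev_two_crossings:
  "ev ({#Crossing e m i j k l, Crossing e' m' i' j' k' l'#} + N) =
    A_pow (2 * e) * (A_pow (2 * e') * ev ({#Wire i l, Wire j k, Wire i' l', Wire j' k'#} + N) -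
      A_pow (- e') * ev ({#Wire i l, Wire j k, Sink {#i', j', m'#}, Source {#k', l', m'#}#} + N)) -
    A_pow (- e) * (A_pow (2 * e') * ev ({#Sink {#i, j, m#}, Source {#k, l, m#}, Wire i' l', Wire j' k'#} + N) -
      A_pow (- e') * ev ({#Sink {#i, j, m#}, Source {#k, l, m#}, Sink {#i', j', m'#}, Source {#k', l', m'#}#} + N))"
proof -
  have "ev ({#Crossing e m i j k l, Crossing e' m' i' j' k' l'#} + N) =
      ev (add_mset (Crossing e m i j k l) (add_mset (Crossing e' m' i' j' k' l') N))"
    by simp
  also have "\<dots> = A_pow (2 * e) * ev (add_mset (Crossing e' m' i' j' k' l') ({#Wire i l, Wire j k#} + N)) -
      A_pow (- e) * ev (add_mset (Crossing e' m' i' j' k' l') ({#Sink {#i, j, m#}, Source {#k, l, m#}#} + N))"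
    unfolding ev_crossing[of e] by simp
  finally show ?thesis unfolding ev_crossing by (simp add: add_mset_commute)
qed

text \<open>The state with both crossings oriented is the right-hand side, with weight 1. The other
  three are multiples of one and the same bond: the mixed states have weights -A^(3e) and -A^(-3e),
  and the doubly unoriented one contains a bigon worth A^3 + A^-3, so they cancel.\<close>

lemma ev_R2_parallel:
  assumes e: "e = 1 \<or> e = -1"
    and c: "closed ({#Crossing e m i j c d, Crossing (- e) m' c d k l#} + N)"
  shows "ev ({#Crossing e m i j c d, Crossing (- e) m' c d k l#} + N) = ev ({#Wire i k, Wire j l#} + N)"
proof -
  have OO: "closed ({#Wire i d, Wire j c, Wire c l, Wire d k#} + N)"
    by (rule closed_reduce[OF c, of _ "{#m, m'#}"]) (simp_all add: add_mset_commute)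
  have OU: "closed ({#Wire i d, Wire j c, Sink {#c, d, m'#}, Source {#k, l, m'#}#} + N)"
    by (rule closed_reduce[OF c, of _ "{#m#}"]) (simp_all add: add_mset_commute)
  have UO: "closed ({#Sink {#i, j, m#}, Source {#c, d, m#}, Wire c l, Wire d k#} + N)"
    by (rule closed_reduce[OF c, of _ "{#m'#}"]) (simp_all add: add_mset_commute)
  have UU: "closed ({#Sink {#i, j, m#}, Source {#c, d, m#}, Sink {#c, d, m'#}, Source {#k, l, m'#}#} + N)"
    by (rule closed_reduce[OF c, of _ "{#}"]) simp_all
  have U: "closed ({#Sink {#i, j, m'#}, Source {#k, l, m'#}#} + N)" "closed ({#Sink {#i, j, m#}, Source {#k, l, m#}#} + N)"
    using closed_reduce[OF OU, of "{#Sink {#i, j, m'#}, Source {#k, l, m'#}#}" "{#c, d#}"]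
      closed_reduce[OF UO, of "{#Sink {#i, j, m#}, Source {#k, l, m#}#}" "{#c, d#}"]
    by (simp_all add: add_mset_commute)
  let ?U = "ev ({#Sink {#i, j, m'#}, Source {#k, l, m'#}#} + N)"
  have 1: "ev ({#Wire i d, Wire j c, Wire c l, Wire d k#} + N) = ev ({#Wire i k, Wire j l#} + N)"
    using ev_wire_wire[of i d k "{#Wire j c, Wire c l#} + N"] ev_wire_wire[of j c l "{#Wire i k#} + N"] OO
    by (simp add: add_mset_commute)
  have 2: "ev ({#Wire i d, Wire j c, Sink {#c, d, m'#}, Source {#k, l, m'#}#} + N) = ?U"
    using ev_wire_sink[of i d "{#c, m'#}" "{#Wire j c, Source {#k, l, m'#}#} + N"]
      ev_wire_sink[of j c "{#i, m'#}" "{#Source {#k, l, m'#}#} + N"] OU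
    by (simp add: add_mset_commute)
  have 3: "ev ({#Sink {#i, j, m#}, Source {#c, d, m#}, Wire c l, Wire d k#} + N) = ?U"
    using ev_wire_source[of c l "{#d, m#}" "{#Sink {#i, j, m#}, Wire d k#} + N"]
      ev_wire_source[of d k "{#l, m#}" "{#Sink {#i, j, m#}#} + N"] ev_bond[OF U] UO
    by (simp add: add_mset_commute)
  have 4: "ev ({#Sink {#i, j, m#}, Source {#c, d, m#}, Sink {#c, d, m'#}, Source {#k, l, m'#}#} + N) = bigon_value * ?U"
    using ev_bigon[of c d m m' "{#Sink {#i, j, m#}, Source {#k, l, m'#}#} + N"]
      ev_wire_sink[of m' m "{#i, j#}" "{#Source {#k, l, m'#}#} + N"] UU
    by (simp add: add_mset_commute)
  show ?thesis
    unfolding ev_two_crossings using 1 2 3 4 e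
    by (elim disjE) (simp_all add: add_mset_commute A_pow_simps algebra_simps)
qed

text \<open>The doubly unoriented state is a square and resolves into the right-hand side plus the
  crosswise connection \<open>?H\<close>. The coefficient of \<open>?H\<close> is d - b^2 + 1 = 0,
  where d is the circle and b the bigon value.\<close>

lemma ev_R2_antiparallel:
  assumes e: "e = 1 \<or> e = -1"
    and cl: "closed ({#Crossing e m i d c l, Crossing (- e) m' c j k d#} + N)"
  shows "ev ({#Crossing e m i d c l, Crossing (- e) m' c j k d#} + N) = ev ({#Wire i k, Wire j l#} + N)"
proof -
  let ?H = "ev ({#Wire i l, Wire j k#} + N)"
  have OO: "closed ({#Wire i l, Wire d c, Wire c d, Wire j k#} + N)"
    by (rule closed_reduce[OF cl, of _ "{#m, m'#}"]) (simp_all add: add_mset_commute)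
  have OU: "closed ({#Wire i l, Wire d c, Sink {#c, j, m'#}, Source {#k, d, m'#}#} + N)"
    by (rule closed_reduce[OF cl, of _ "{#m#}"]) (simp_all add: add_mset_commute)
  have UO: "closed ({#Sink {#i, d, m#}, Source {#c, l, m#}, Wire c d, Wire j k#} + N)"
    by (rule closed_reduce[OF cl, of _ "{#m'#}"]) (simp_all add: add_mset_commute)
  have UU: "closed ({#Sink {#i, d, m#}, Source {#c, l, m#}, Sink {#c, j, m'#}, Source {#k, d, m'#}#} + N)"
    by (rule closed_reduce[OF cl, of _ "{#}"]) simp_all
  have 1: "ev ({#Wire i l, Wire d c, Wire c d, Wire j k#} + N) = circle_value * ?H"
    using ev_wire_wire[of d c d "{#Wire i l, Wire j k#} + N"] ev_loop[of d "{#Wire i l, Wire j k#} + N"] OO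
    by (simp add: add_mset_commute)
  have 2: "ev ({#Wire i l, Wire d c, Sink {#c, j, m'#}, Source {#k, d, m'#}#} + N) = bigon_value * ?H"
    using ev_wire_sink[of d c "{#j, m'#}" "{#Wire i l, Source {#k, d, m'#}#} + N"]
      ev_bigon[of d m' k j "{#Wire i l#} + N"] OU
    by (simp add: add_mset_commute)
  have 3: "ev ({#Sink {#i, d, m#}, Source {#c, l, m#}, Wire c d, Wire j k#} + N) = bigon_value * ?H"
    using ev_wire_sink[of c d "{#i, m#}" "{#Source {#c, l, m#}, Wire j k#} + N"]
      ev_bigon[of c m l i "{#Wire j k#} + N"] UO
    by (simp add: add_mset_commute)
  have 4: "ev ({#Sink {#i, d, m#}, Source {#c, l, m#}, Sink {#c, j, m'#}, Source {#k, d, m'#}#} + N) =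
      ev ({#Wire i k, Wire j l#} + N) + ?H"
    using ev_quadrilateral[of c m l m' j d k i N] UU by (simp add: add_mset_commute)
  show ?thesis
    unfolding ev_two_crossings using 1 2 3 4 e
    by (elim disjE) (simp_all add: add_mset_commute A_pow_simps algebra_simps)
qed

text \<open>A strand that crosses two legs of a sink may cross the third leg instead; as seen along
  the strand this leg runs the other way, hence the sign \<open>- e\<close>. In the expansion
  \<open>?T1\<close> has coefficient A^(4e) - A^e (A^3 + A^-3) + A^(-2e) = 0. The labels
  \<open>b1\<close> and \<open>m2\<close> are recycled on the right, so no fresh names are
  needed.\<close>

lemma ev_slide_sink:
  assumes e: "e = 1 \<or> e = -1"
    and cl: "closed ({#Crossing e m1 s0 a0 s1 a1, Crossing e m2 s1 b0 s2 b1, Sink {#a1, b1, c#}#} + N)"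
  shows "ev ({#Crossing e m1 s0 a0 s1 a1, Crossing e m2 s1 b0 s2 b1, Sink {#a1, b1, c#}#} + N) =
    ev ({#Crossing (- e) b1 s0 c s2 m2, Sink {#a0, b0, m2#}#} + N)"
proof -
  let ?K = "Sink {#a1, b1, c#}"
  let ?T1 = "ev ({#Sink {#s0, a0, c#}, Wire b0 s2#} + N)" and ?T3 = "ev ({#Sink {#s0, a0, b0#}, Wire c s2#} + N)"
  let ?T2 = "ev ({#Sink {#a0, b0, m2#}, Source {#s2, b1, m2#}, Sink {#s0, b1, c#}#} + N)"
  have OO: "closed ({#Wire s0 a1, Wire a0 s1, Wire s1 b1, Wire b0 s2, ?K#} + N)"
    by (rule closed_reduce[OF cl, of _ "{#m1, m2#}"]) (simp_all add: add_mset_commute)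
  have OU: "closed ({#Wire s0 a1, Wire a0 s1, Sink {#s1, b0, m2#}, Source {#s2, b1, m2#}, ?K#} + N)"
    by (rule closed_reduce[OF cl, of _ "{#m1#}"]) (simp_all add: add_mset_commute)
  have UO: "closed ({#Sink {#s0, a0, m1#}, Source {#s1, a1, m1#}, Wire s1 b1, Wire b0 s2, ?K#} + N)"
    by (rule closed_reduce[OF cl, of _ "{#m2#}"]) (simp_all add: add_mset_commute)
  have UU: "closed ({#Sink {#s0, a0, m1#}, Source {#s1, a1, m1#}, Sink {#s1, b0, m2#}, Source {#s2, b1, m2#}, ?K#} + N)"
    by (rule closed_reduce[OF cl, of _ "{#}"]) (simp_all add: add_mset_commute)
  have O': "closed ({#Wire s0 m2, Wire c s2, Sink {#a0, b0, m2#}#} + N)"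
    by (rule closed_reduce[OF cl, of _ "{#m1, s1, a1, b1#}"]) (simp_all add: add_mset_commute)
  have 1: "ev ({#Wire s0 a1, Wire a0 s1, Wire s1 b1, Wire b0 s2, ?K#} + N) = ?T1"
    using ev_wire_sink[of s0 a1 "{#b1, c#}" "{#Wire a0 s1, Wire s1 b1, Wire b0 s2#} + N"]
      ev_wire_wire[of a0 s1 b1 "{#Wire b0 s2, Sink {#s0, b1, c#}#} + N"]
      ev_wire_sink[of a0 b1 "{#s0, c#}" "{#Wire b0 s2#} + N"] OO
    by (simp add: add_mset_commute)
  have 2: "ev ({#Wire s0 a1, Wire a0 s1, Sink {#s1, b0, m2#}, Source {#s2, b1, m2#}, ?K#} + N) = ?T2"
    using ev_wire_sink[of s0 a1 "{#b1, c#}" "{#Wire a0 s1, Sink {#s1, b0, m2#}, Source {#s2, b1, m2#}#} + N"]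
      ev_wire_sink[of a0 s1 "{#b0, m2#}" "{#Source {#s2, b1, m2#}, Sink {#s0, b1, c#}#} + N"] OU
    by (simp add: add_mset_commute)
  have 3: "ev ({#Sink {#s0, a0, m1#}, Source {#s1, a1, m1#}, Wire s1 b1, Wire b0 s2, ?K#} + N) = bigon_value * ?T1"
    using ev_wire_source[of s1 b1 "{#a1, m1#}" "{#Sink {#s0, a0, m1#}, Wire b0 s2, ?K#} + N"]
      ev_bigon[of a1 b1 m1 c "{#Sink {#s0, a0, m1#}, Wire b0 s2#} + N"]
      ev_wire_sink[of c m1 "{#s0, a0#}" "{#Wire b0 s2#} + N"] UO
    by (simp add: add_mset_commute)
  have 4: "ev ({#Sink {#s0, a0, m1#}, Source {#s1, a1, m1#}, Sink {#s1, b0, m2#}, Source {#s2, b1, m2#}, ?K#} + N) = ?T3 + ?T1"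
    using ev_quadrilateral[of s1 a1 m1 m2 b0 b1 s2 c "{#Sink {#s0, a0, m1#}#} + N"]
      ev_wire_sink[of b0 m1 "{#s0, a0#}" "{#Wire c s2#} + N"]
      ev_wire_sink[of c m1 "{#s0, a0#}" "{#Wire b0 s2#} + N"] UU
    by (simp add: add_mset_commute)
  have 5: "ev ({#Wire s0 m2, Wire c s2, Sink {#a0, b0, m2#}#} + N) = ?T3"
    using ev_wire_sink[of s0 m2 "{#a0, b0#}" "{#Wire c s2#} + N"] O' by (simp add: add_mset_commute)
  have "ev ({#Crossing (- e) b1 s0 c s2 m2, Sink {#a0, b0, m2#}#} + N) = A_pow (- 2 * e) * ?T3 - A_pow e * ?T2"
    using 5 by (simp add: ev_crossing add_mset_commute)
  moreover have "ev ({#Crossing e m1 s0 a0 s1 a1, Crossing e m2 s1 b0 s2 b1#} + ({#?K#} + N)) =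
      A_pow (2 * e) * (A_pow (2 * e) * ?T1 - A_pow (- e) * ?T2) -
      A_pow (- e) * (A_pow (2 * e) * (bigon_value * ?T1) - A_pow (- e) * (?T3 + ?T1))"
    unfolding ev_two_crossings using 1 2 3 4 by (simp add: add_mset_commute)
  moreover have "A_pow (2 * e) * (A_pow (2 * e) * ?T1 - A_pow (- e) * ?T2) -
      A_pow (- e) * (A_pow (2 * e) * (bigon_value * ?T1) - A_pow (- e) * (?T3 + ?T1)) =
      A_pow (- 2 * e) * ?T3 - A_pow e * ?T2"
    using e by (elim disjE) (simp_all add: A_pow_simps algebra_simps)
  ultimately show ?thesis by (simp add: add_mset_commute)
qed

text \<open>The counterpart of \<open>ev_slide_sink\<close> with all edges reversed; the term
  \<open>?T1\<close> cancels for the same reason. The recycled labels are now \<open>a0\<close> and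
  \<open>m1\<close>.\<close>

lemma ev_slide_source:
  assumes e: "e = 1 \<or> e = -1"
    and cl: "closed ({#Crossing e m1 s0 a0 s1 a1, Crossing e m2 s1 b0 s2 b1, Source {#a0, b0, c#}#} + N)"
  shows "ev ({#Crossing e m1 s0 a0 s1 a1, Crossing e m2 s1 b0 s2 b1, Source {#a0, b0, c#}#} + N) =
    ev ({#Crossing (- e) a0 s0 m1 s2 c, Source {#a1, b1, m1#}#} + N)"
proof -
  let ?K = "Source {#a0, b0, c#}"
  let ?T1 = "ev ({#Source {#s2, b1, c#}, Wire s0 a1#} + N)" and ?T3 = "ev ({#Source {#s2, b1, a1#}, Wire s0 c#} + N)"
  let ?T2 = "ev ({#Source {#b1, a1, m1#}, Source {#a0, s2, c#}, Sink {#s0, a0, m1#}#} + N)"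
  have OO: "closed ({#Wire s0 a1, Wire a0 s1, Wire s1 b1, Wire b0 s2, ?K#} + N)"
    by (rule closed_reduce[OF cl, of _ "{#m1, m2#}"]) (simp_all add: add_mset_commute)
  have OU: "closed ({#Wire s0 a1, Wire a0 s1, Sink {#s1, b0, m2#}, Source {#s2, b1, m2#}, ?K#} + N)"
    by (rule closed_reduce[OF cl, of _ "{#m1#}"]) (simp_all add: add_mset_commute)
  have UO: "closed ({#Sink {#s0, a0, m1#}, Source {#s1, a1, m1#}, Wire s1 b1, Wire b0 s2, ?K#} + N)"
    by (rule closed_reduce[OF cl, of _ "{#m2#}"]) (simp_all add: add_mset_commute)
  have UU: "closed ({#Sink {#s0, a0, m1#}, Source {#s1, a1, m1#}, Sink {#s1, b0, m2#}, Source {#s2, b1, m2#}, ?K#} + N)"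
    by (rule closed_reduce[OF cl, of _ "{#}"]) (simp_all add: add_mset_commute)
  have O': "closed ({#Wire s0 c, Wire m1 s2, Source {#a1, b1, m1#}#} + N)"
    by (rule closed_reduce[OF cl, of _ "{#m2, s1, a0, b0#}"]) (simp_all add: add_mset_commute)
  have 1: "ev ({#Wire s0 a1, Wire a0 s1, Wire s1 b1, Wire b0 s2, ?K#} + N) = ?T1"
    using ev_wire_source[of b0 s2 "{#a0, c#}" "{#Wire s0 a1, Wire a0 s1, Wire s1 b1#} + N"]
      ev_wire_wire[of a0 s1 b1 "{#Wire s0 a1, Source {#s2, a0, c#}#} + N"]
      ev_wire_source[of a0 b1 "{#s2, c#}" "{#Wire s0 a1#} + N"] OO
    by (simp add: add_mset_commute)
  have 2: "ev ({#Wire s0 a1, Wire a0 s1, Sink {#s1, b0, m2#}, Source {#s2, b1, m2#}, ?K#} + N) = bigon_value * ?T1"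
    using ev_wire_sink[of a0 s1 "{#b0, m2#}" "{#Wire s0 a1, Source {#s2, b1, m2#}, ?K#} + N"]
      ev_bigon[of a0 b0 c m2 "{#Wire s0 a1, Source {#s2, b1, m2#}#} + N"]
      ev_wire_source[of m2 c "{#s2, b1#}" "{#Wire s0 a1#} + N"] OU
    by (simp add: add_mset_commute)
  have 3: "ev ({#Sink {#s0, a0, m1#}, Source {#s1, a1, m1#}, Wire s1 b1, Wire b0 s2, ?K#} + N) = ?T2"
    using ev_wire_source[of s1 b1 "{#a1, m1#}" "{#Sink {#s0, a0, m1#}, Wire b0 s2, ?K#} + N"]
      ev_wire_source[of b0 s2 "{#a0, c#}" "{#Sink {#s0, a0, m1#}, Source {#b1, a1, m1#}#} + N"] UO
    by (simp add: add_mset_commute)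
  have 4: "ev ({#Sink {#s0, a0, m1#}, Source {#s1, a1, m1#}, Sink {#s1, b0, m2#}, Source {#s2, b1, m2#}, ?K#} + N) = ?T3 + ?T1"
    using ev_quadrilateral[of a0 b0 c m1 s0 s1 a1 m2 "{#Source {#s2, b1, m2#}#} + N"]
      ev_wire_source[of m2 a1 "{#s2, b1#}" "{#Wire s0 c#} + N"]
      ev_wire_source[of m2 c "{#s2, b1#}" "{#Wire s0 a1#} + N"] UU
    by (simp add: add_mset_commute)
  have 5: "ev ({#Wire s0 c, Wire m1 s2, Source {#a1, b1, m1#}#} + N) = ?T3"
    using ev_wire_source[of m1 s2 "{#a1, b1#}" "{#Wire s0 c#} + N"] O' by (simp add: add_mset_commute)
  have "ev ({#Crossing (- e) a0 s0 m1 s2 c, Source {#a1, b1, m1#}#} + N) = A_pow (- 2 * e) * ?T3 - A_pow e * ?T2"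
    using 5 by (simp add: ev_crossing add_mset_commute)
  moreover have "ev ({#Crossing e m1 s0 a0 s1 a1, Crossing e m2 s1 b0 s2 b1#} + ({#?K#} + N)) =
      A_pow (2 * e) * (A_pow (2 * e) * ?T1 - A_pow (- e) * (bigon_value * ?T1)) -
      A_pow (- e) * (A_pow (2 * e) * ?T2 - A_pow (- e) * (?T3 + ?T1))"
    unfolding ev_two_crossings using 1 2 3 4 by (simp add: add_mset_commute)
  moreover have "A_pow (2 * e) * (A_pow (2 * e) * ?T1 - A_pow (- e) * (bigon_value * ?T1)) -
      A_pow (- e) * (A_pow (2 * e) * ?T2 - A_pow (- e) * (?T3 + ?T1)) =
      A_pow (- 2 * e) * ?T3 - A_pow e * ?T2"
    using e by (elim disjE) (simp_all add: A_pow_simps algebra_simps)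
  ultimately show ?thesis by (simp add: add_mset_commute)
qed

end

section \<open>The third Reidemeister move for nets\<close>

context kuperberg
begin

lemma ev_transpose:
  assumes "closed (L + N)" "x \<in># starts_of L" "x \<in># ends_of L" "y \<in># starts_of L" "y \<in># ends_of L"
  shows "ev (L + N) = ev (rename (transpose x y) L + N)"
proof (rule ev_relabel[OF assms(1)])
  show "inj_on (transpose x y) (set_mset (starts_of (L + N)))"
    by (rule inj_on_subset[OF inj_transpose]) simp
  have "set_mset (starts_of L) \<inter> set_mset (starts_of N) = {}" "set_mset (ends_of L) \<inter> set_mset (ends_of N) = {}"
    using closedD(1,2)[OF assms(1)] no_dup_unionD[of "starts_of L" "starts_of N"] no_dup_unionD[of "ends_of L" "ends_of N"]
    by auto
  then show "\<forall>l \<in># starts_of N + ends_of N. transpose x y l = l"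
    using assms(2-5) by (auto simp: transpose_def)
qed

text \<open>The two sides of a third move meet the crossings on the top strand in opposite order, so
  their inner labels have to be exchanged.\<close>

lemma ev_mid_swap:
  assumes "closed ({#Crossing e m i j k l, Crossing e' m' i' j' k' l'#} + N)"
  shows "ev ({#Crossing e m i j k l, Crossing e' m' i' j' k' l'#} + N) =
    ev ({#Crossing e m' i j k l, Crossing e' m i' j' k' l'#} + N)"
proof -
  have "x \<noteq> m \<and> x \<noteq> m'" if "x \<in> {i, j, k, l, i', j', k', l'}" for x
    using closedD(1,2)[OF assms] that by auto
  moreover have "m \<noteq> m'" "m' \<noteq> m"
    using closedD(1,2)[OF assms] by auto
  ultimately show ?thesis
    using ev_transpose[OF assms, of m m'] by (simp add: transpose_def)
qed

lemma ev_wire_crossing_in1: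
  assumes "closed ({#Wire a b, Crossing e m b j k l#} + N)"
  shows "ev ({#Wire a b, Crossing e m b j k l#} + N) = ev ({#Crossing e m a j k l#} + N)"
    and "closed ({#Crossing e m a j k l#} + N)"
proof -
  show "closed ({#Crossing e m a j k l#} + N)"
    by (rule closed_reduce[OF assms, of _ "{#b#}"]) (simp_all add: add_mset_commute)
  have "m \<noteq> b" "j \<noteq> b" "k \<noteq> b" "l \<noteq> b"
    using closedD(1,2)[OF assms] by auto
  then show "ev ({#Wire a b, Crossing e m b j k l#} + N) = ev ({#Crossing e m a j k l#} + N)"
    using ev_wire_in[of a b "{#Crossing e m b j k l#}" N] assms by simp
qed

lemma ev_wire_crossing_in2:
  assumes "closed ({#Wire a b, Crossing e m i b k l#} + N)"
  shows "ev ({#Wire a b, Crossing e m i b k l#} + N) = ev ({#Crossing e m i a k l#} + N)"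
    and "closed ({#Crossing e m i a k l#} + N)"
proof -
  show "closed ({#Crossing e m i a k l#} + N)"
    by (rule closed_reduce[OF assms, of _ "{#b#}"]) (simp_all add: add_mset_commute)
  have "m \<noteq> b" "i \<noteq> b" "k \<noteq> b" "l \<noteq> b"
    using closedD(1,2)[OF assms] by auto
  then show "ev ({#Wire a b, Crossing e m i b k l#} + N) = ev ({#Crossing e m i a k l#} + N)"
    using ev_wire_in[of a b "{#Crossing e m i b k l#}" N] assms by simp
qed

lemma ev_wire_crossing_out2:
  assumes "closed ({#Wire l b, Crossing e m i j k l#} + N)"
  shows "ev ({#Wire l b, Crossing e m i j k l#} + N) = ev ({#Crossing e m i j k b#} + N)"
    and "closed ({#Crossing e m i j k b#} + N)"
proof -
  show "closed ({#Crossing e m i j k b#} + N)"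
    by (rule closed_reduce[OF assms, of _ "{#l#}"]) (simp_all add: add_mset_commute)
  have "m \<noteq> l" "i \<noteq> l" "j \<noteq> l" "k \<noteq> l"
    using closedD(1,2)[OF assms] by auto
  then show "ev ({#Wire l b, Crossing e m i j k l#} + N) = ev ({#Crossing e m i j k b#} + N)"
    using ev_wire_out[of l b "{#Crossing e m i j k l#}" N] assms by simp
qed

text \<open>
  The top strand runs from \<open>s0\<close> to \<open>s2\<close>.  The names say whether it meets the strands \<open>a\<close> and \<open>b\<close> before
  or after these cross each other; the sign \<open>h\<close> of that crossing is arbitrary.
\<close>

lemma ev_R3_before_before:
  assumes e: "e = 1 \<or> e = -1"
    and cl: "closed ({#Crossing h m3 a1 b1 a2 b2, Crossing e m1 s0 a0 s1 a1, Crossing e m2 s1 b0 s2 b1#} + N)"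
  shows "ev ({#Crossing h m3 a1 b1 a2 b2, Crossing e m1 s0 a0 s1 a1, Crossing e m2 s1 b0 s2 b1#} + N) =
    ev ({#Crossing h m3 a0 b0 a1 b1, Crossing e m2 s0 b1 s1 b2, Crossing e m1 s1 a1 s2 a2#} + N)"
proof -
  \<comment> \<open>Oriented state of the third crossing: once its wires are absorbed, both sides
    consist of the top strand crossing the same two strands, with inner labels exchanged.\<close>
  let ?DO = "{#Wire a1 b2, Wire b1 a2, Crossing e m1 s0 a0 s1 a1, Crossing e m2 s1 b0 s2 b1#} + N"
  have DOc: "closed ?DO"
    by (rule closed_reduce[OF cl, of _ "{#m3#}"]) (simp_all add: add_mset_commute)
  have DO: "ev ?DO = ev ({#Crossing e m1 s0 a0 s1 b2, Crossing e m2 s1 b0 s2 a2#} + N)"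
    using ev_wire_crossing_out2[of a1 b2 e m1 s0 a0 s1 "{#Wire b1 a2, Crossing e m2 s1 b0 s2 b1#} + N"]
      ev_wire_crossing_out2[of b1 a2 e m2 s1 b0 s2 "{#Crossing e m1 s0 a0 s1 b2#} + N"] DOc
    by (simp add: add_mset_commute)
  let ?EO = "{#Wire a0 b1, Wire b0 a1, Crossing e m2 s0 b1 s1 b2, Crossing e m1 s1 a1 s2 a2#} + N"
  have EOc: "closed ?EO"
    by (rule closed_reduce[OF cl, of _ "{#m3#}"]) (simp_all add: add_mset_commute)
  have EO: "ev ?EO = ev ({#Crossing e m2 s0 a0 s1 b2, Crossing e m1 s1 b0 s2 a2#} + N)"
    using ev_wire_crossing_in2[of a0 b1 e m2 s0 s1 b2 "{#Wire b0 a1, Crossing e m1 s1 a1 s2 a2#} + N"]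
      ev_wire_crossing_in2[of b0 a1 e m1 s1 s2 a2 "{#Crossing e m2 s0 a0 s1 b2#} + N"] EOc
    by (simp add: add_mset_commute)
  have "closed ({#Crossing e m1 s0 a0 s1 b2, Crossing e m2 s1 b0 s2 a2#} + N)"
    by (rule closed_reduce[OF DOc, of _ "{#a1, b1#}"]) (simp_all add: add_mset_commute)
  then have O: "ev ({#Crossing e m1 s0 a0 s1 b2, Crossing e m2 s1 b0 s2 a2#} + N)
      = ev ({#Crossing e m2 s0 a0 s1 b2, Crossing e m1 s1 b0 s2 a2#} + N)"
    by (rule ev_mid_swap)
  \<comment> \<open>Unoriented state: on the left the top strand slides over the sink, on the right
    over the source. Either way it ends up crossing the bond, and only inner labels differ.\<close>
  let ?DU = "{#Sink {#a1, b1, m3#}, Source {#a2, b2, m3#}, Crossing e m1 s0 a0 s1 a1, Crossing e m2 s1 b0 s2 b1#} + N"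
  have DUc: "closed ?DU"
    by (rule closed_reduce[OF cl, of _ "{#}"]) (simp_all add: add_mset_commute)
  have DU: "ev ?DU = ev ({#Crossing (- e) b1 s0 m3 s2 m2, Sink {#a0, b0, m2#}, Source {#a2, b2, m3#}#} + N)"
    using ev_slide_sink[OF e, of m1 s0 a0 s1 a1 m2 b0 s2 b1 m3 "{#Source {#a2, b2, m3#}#} + N"] DUc
    by (simp add: add_mset_commute)
  let ?EU = "{#Sink {#a0, b0, m3#}, Source {#a1, b1, m3#}, Crossing e m2 s0 b1 s1 b2, Crossing e m1 s1 a1 s2 a2#} + N"
  have EUc: "closed ?EU"
    by (rule closed_reduce[OF cl, of _ "{#}"]) (simp_all add: add_mset_commute)
  have EU: "ev ?EU = ev ({#Crossing (- e) b1 s0 m2 s2 m3, Source {#b2, a2, m2#}, Sink {#a0, b0, m3#}#} + N)"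
    using ev_slide_source[OF e, of m2 s0 b1 s1 b2 m1 a1 s2 a2 m3 "{#Sink {#a0, b0, m3#}#} + N"] EUc
    by (simp add: add_mset_commute)
  have PU: "closed ({#Crossing (- e) b1 s0 m3 s2 m2, Sink {#a0, b0, m2#}, Source {#a2, b2, m3#}#} + N)"
    by (rule closed_reduce[OF DUc, of _ "{#a1, s1, m1#}"]) (simp_all add: add_mset_commute)
  have "distinct [m2, m3]" "{m2, m3} \<inter> {a0, b0, a2, b2, s0, s2, b1} = {}"
    using closedD(1,2)[OF PU] by auto
  then have U: "ev ({#Crossing (- e) b1 s0 m3 s2 m2, Sink {#a0, b0, m2#}, Source {#a2, b2, m3#}#} + N) =
      ev ({#Crossing (- e) b1 s0 m2 s2 m3, Source {#b2, a2, m2#}, Sink {#a0, b0, m3#}#} + N)"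
    using ev_transpose[OF PU, of m2 m3] by (simp add: transpose_def add_mset_commute)
  show ?thesis
    using ev_crossing[of h m3 a1 b1 a2 b2 "{#Crossing e m1 s0 a0 s1 a1, Crossing e m2 s1 b0 s2 b1#} + N"]
      ev_crossing[of h m3 a0 b0 a1 b1 "{#Crossing e m2 s0 b1 s1 b2, Crossing e m1 s1 a1 s2 a2#} + N"] DO EO O DU EU U
    by (simp add: add_mset_commute)
qed

text \<open>With the third crossing oriented, both sides reduce by the parallel second move. With it
  unoriented, the four states on each side have weights 1, -A^(3e), -A^(-3e), 1 and match crosswise:
  the doubly oriented state of one side is a summand of the resolved square of the other, the mixed
  states agree up to inner labels, and the other square summand, a source and a sink, is common to
  both.\<close>

lemma ev_R3_before_after:
  assumes e: "e = 1 \<or> e = -1"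
    and cl: "closed ({#Crossing h m3 a1 b0 a2 b1, Crossing e m1 s0 a0 s1 a1, Crossing (- e) m2 s1 b1 s2 b2#} + N)"
  shows "ev ({#Crossing h m3 a1 b0 a2 b1, Crossing e m1 s0 a0 s1 a1, Crossing (- e) m2 s1 b1 s2 b2#} + N) =
    ev ({#Crossing h m3 a0 b1 a1 b2, Crossing (- e) m2 s0 b0 s1 b1, Crossing e m1 s1 a1 s2 a2#} + N)"
proof -
  have e': "- e = 1 \<or> - e = -1" using e by auto
  have clE: "closed ({#Crossing h m3 a0 b1 a1 b2, Crossing (- e) m2 s0 b0 s1 b1, Crossing e m1 s1 a1 s2 a2#} + N)"
    by (rule closed_reduce[OF cl, of _ "{#}"]) (simp_all add: add_mset_commute)
  let ?DO = "{#Wire a1 b1, Wire b0 a2, Crossing e m1 s0 a0 s1 a1, Crossing (- e) m2 s1 b1 s2 b2#} + N"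
  have DOc: "closed ?DO"
    by (rule closed_reduce[OF cl, of _ "{#m3#}"]) (simp_all add: add_mset_commute)
  have DO: "ev ?DO = ev ({#Wire s0 s2, Wire a0 b2, Wire b0 a2#} + N)"
    using ev_wire_crossing_in2[of a1 b1 "- e" m2 s1 s2 b2 "{#Wire b0 a2, Crossing e m1 s0 a0 s1 a1#} + N"]
      ev_R2_parallel[OF e, of m1 s0 a0 s1 a1 m2 s2 b2 "{#Wire b0 a2#} + N"] DOc
    by (simp add: add_mset_commute)
  let ?EO = "{#Wire a0 b2, Wire b1 a1, Crossing (- e) m2 s0 b0 s1 b1, Crossing e m1 s1 a1 s2 a2#} + N"
  have EOc: "closed ?EO"
    by (rule closed_reduce[OF cl, of _ "{#m3#}"]) (simp_all add: add_mset_commute)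
  have EO: "ev ?EO = ev ({#Wire s0 s2, Wire a0 b2, Wire b0 a2#} + N)"
    using ev_wire_crossing_in2[of b1 a1 e m1 s1 s2 a2 "{#Wire a0 b2, Crossing (- e) m2 s0 b0 s1 b1#} + N"]
      ev_R2_parallel[OF e', of m2 s0 b0 s1 b1 m1 s2 a2 "{#Wire a0 b2#} + N"] EOc
    by (simp add: add_mset_commute)
  \<comment> \<open>\<open>?D1\<close> to \<open>?D4\<close> are the four states of the two
    crossings on the top strand, each joined to the unoriented state of the third crossing.
    \<open>?E1\<close> to \<open>?E4\<close> play this role on the other side.\<close>
  let ?D1 = "{#Wire s0 a1, Wire a0 s1, Wire s1 b2, Wire b1 s2, Sink {#a1, b0, m3#}, Source {#a2, b1, m3#}#} + N"
  have D1c: "closed ?D1"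
    by (rule closed_reduce[OF cl, of _ "{#m1, m2#}"]) (simp_all add: add_mset_commute)
  have D1: "ev ?D1 = ev ({#Sink {#s0, b0, m3#}, Source {#a2, s2, m3#}, Wire a0 b2#} + N)"
    using ev_wire_sink[of s0 a1 "{#b0, m3#}" "{#Wire a0 s1, Wire s1 b2, Wire b1 s2, Source {#a2, b1, m3#}#} + N"]
      ev_wire_source[of b1 s2 "{#a2, m3#}" "{#Wire a0 s1, Wire s1 b2, Sink {#s0, b0, m3#}#} + N"]
      ev_wire_wire[of a0 s1 b2 "{#Sink {#s0, b0, m3#}, Source {#a2, s2, m3#}#} + N"] D1c
    by (simp add: add_mset_commute)
  let ?D2 = "{#Wire s0 a1, Wire a0 s1, Sink {#s1, b1, m2#}, Source {#s2, b2, m2#}, Sink {#a1, b0, m3#},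
      Source {#a2, b1, m3#}#} + N"
  have D2c: "closed ?D2"
    by (rule closed_reduce[OF cl, of _ "{#m1#}"]) (simp_all add: add_mset_commute)
  have D2: "ev ?D2 = ev ({#Sink {#s0, b0, m3#}, Sink {#a0, b1, m2#}, Source {#a2, b1, m3#}, Source {#s2, b2, m2#}#} + N)"
    using ev_wire_sink[of s0 a1 "{#b0, m3#}" "{#Wire a0 s1, Sink {#s1, b1, m2#}, Source {#s2, b2, m2#},
      Source {#a2, b1, m3#}#} + N"]
      ev_wire_sink[of a0 s1 "{#b1, m2#}" "{#Sink {#s0, b0, m3#}, Source {#s2, b2, m2#}, Source {#a2, b1, m3#}#} + N"] D2c
    by (simp add: add_mset_commute)
  let ?D3 = "{#Sink {#s0, a0, m1#}, Source {#s1, a1, m1#}, Wire s1 b2, Wire b1 s2, Sink {#a1, b0, m3#},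
      Source {#a2, b1, m3#}#} + N"
  have D3c: "closed ?D3"
    by (rule closed_reduce[OF cl, of _ "{#m2#}"]) (simp_all add: add_mset_commute)
  have D3: "ev ?D3 = ev ({#Source {#b2, a1, m1#}, Source {#a2, s2, m3#}, Sink {#a1, b0, m3#}, Sink {#s0, a0, m1#}#} + N)"
    using ev_wire_source[of s1 b2 "{#a1, m1#}" "{#Sink {#s0, a0, m1#}, Wire b1 s2, Sink {#a1, b0, m3#},
      Source {#a2, b1, m3#}#} + N"]
      ev_wire_source[of b1 s2 "{#a2, m3#}" "{#Sink {#s0, a0, m1#}, Source {#b2, a1, m1#}, Sink {#a1, b0, m3#}#} + N"] D3c
    by (simp add: add_mset_commute)
  let ?D4 = "{#Sink {#s0, a0, m1#}, Source {#s1, a1, m1#}, Sink {#s1, b1, m2#}, Source {#s2, b2, m2#}, Sink {#a1, b0, m3#},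
      Source {#a2, b1, m3#}#} + N"
  have D4c: "closed ?D4"
    by (rule closed_reduce[OF cl, of _ "{#}"]) (simp_all add: add_mset_commute)
  have D4: "ev ?D4 = ev ({#Sink {#s0, a0, m2#}, Source {#s2, b2, m2#}, Wire b0 a2#} + N) + ev ({#Source {#s2, b2, a2#},
      Sink {#s0, a0, b0#}#} + N)"
    using ev_quadrilateral[of s1 a1 m1 b1 m2 m3 a2 b0 "{#Sink {#s0, a0, m1#}, Source {#s2, b2, m2#}#} + N"]
      ev_wire_sink[of m2 m1 "{#s0, a0#}" "{#Source {#s2, b2, m2#}, Wire b0 a2#} + N"]
      ev_wire_source[of m2 a2 "{#s2, b2#}" "{#Sink {#s0, a0, m1#}, Wire b0 m1#} + N"]
      ev_wire_sink[of b0 m1 "{#s0, a0#}" "{#Source {#s2, b2, a2#}#} + N"] D4c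
    by (simp add: add_mset_commute)
  let ?E1 = "{#Wire s0 b1, Wire b0 s1, Wire s1 a2, Wire a1 s2, Sink {#a0, b1, m3#}, Source {#a1, b2, m3#}#} + N"
  have E1c: "closed ?E1"
    by (rule closed_reduce[OF clE, of _ "{#m1, m2#}"]) (simp_all add: add_mset_commute)
  have E1: "ev ?E1 = ev ({#Sink {#a0, s0, m3#}, Source {#s2, b2, m3#}, Wire b0 a2#} + N)"
    using ev_wire_sink[of s0 b1 "{#a0, m3#}" "{#Wire b0 s1, Wire s1 a2, Wire a1 s2, Source {#a1, b2, m3#}#} + N"]
      ev_wire_source[of a1 s2 "{#b2, m3#}" "{#Wire b0 s1, Wire s1 a2, Sink {#s0, a0, m3#}#} + N"]
      ev_wire_wire[of b0 s1 a2 "{#Sink {#s0, a0, m3#}, Source {#b2, s2, m3#}#} + N"] E1c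
    by (simp add: add_mset_commute)
  let ?E2 = "{#Wire s0 b1, Wire b0 s1, Sink {#s1, a1, m1#}, Source {#s2, a2, m1#}, Sink {#a0, b1, m3#},
      Source {#a1, b2, m3#}#} + N"
  have E2c: "closed ?E2"
    by (rule closed_reduce[OF clE, of _ "{#m2#}"]) (simp_all add: add_mset_commute)
  have E2: "ev ?E2 = ev ({#Sink {#a0, s0, m3#}, Source {#a1, b2, m3#}, Sink {#b0, a1, m1#}, Source {#s2, a2, m1#}#} + N)"
    using ev_wire_sink[of s0 b1 "{#a0, m3#}" "{#Wire b0 s1, Sink {#s1, a1, m1#}, Source {#s2, a2, m1#},
      Source {#a1, b2, m3#}#} + N"]
      ev_wire_sink[of b0 s1 "{#a1, m1#}" "{#Sink {#s0, a0, m3#}, Source {#s2, a2, m1#}, Source {#a1, b2, m3#}#} + N"] E2c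
    by (simp add: add_mset_commute)
  let ?E3 = "{#Sink {#s0, b0, m2#}, Source {#s1, b1, m2#}, Wire s1 a2, Wire a1 s2, Sink {#a0, b1, m3#},
      Source {#a1, b2, m3#}#} + N"
  have E3c: "closed ?E3"
    by (rule closed_reduce[OF clE, of _ "{#m1#}"]) (simp_all add: add_mset_commute)
  have E3: "ev ?E3 = ev ({#Source {#a2, b1, m2#}, Source {#s2, b2, m3#}, Sink {#a0, b1, m3#}, Sink {#s0, b0, m2#}#} + N)"
    using ev_wire_source[of s1 a2 "{#b1, m2#}" "{#Sink {#s0, b0, m2#}, Wire a1 s2, Sink {#a0, b1, m3#},
      Source {#a1, b2, m3#}#} + N"]
      ev_wire_source[of a1 s2 "{#b2, m3#}" "{#Sink {#s0, b0, m2#}, Source {#a2, b1, m2#}, Sink {#a0, b1, m3#}#} + N"] E3c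
    by (simp add: add_mset_commute)
  let ?E4 = "{#Sink {#s0, b0, m2#}, Source {#s1, b1, m2#}, Sink {#s1, a1, m1#}, Source {#s2, a2, m1#}, Sink {#a0, b1, m3#},
      Source {#a1, b2, m3#}#} + N"
  have E4c: "closed ?E4"
    by (rule closed_reduce[OF clE, of _ "{#}"]) (simp_all add: add_mset_commute)
  have E4: "ev ?E4 = ev ({#Sink {#s0, b0, m1#}, Source {#s2, a2, m1#}, Wire a0 b2#} + N) + ev ({#Source {#s2, b2, a2#},
      Sink {#s0, a0, b0#}#} + N)"
    using ev_quadrilateral[of s1 b1 m2 a1 m1 m3 b2 a0 "{#Sink {#s0, b0, m2#}, Source {#s2, a2, m1#}#} + N"]
      ev_wire_sink[of m1 m2 "{#s0, b0#}" "{#Source {#s2, a2, m1#}, Wire a0 b2#} + N"]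
      ev_wire_source[of m1 b2 "{#s2, a2#}" "{#Sink {#s0, b0, m2#}, Wire a0 m2#} + N"]
      ev_wire_sink[of a0 m2 "{#s0, b0#}" "{#Source {#s2, a2, b2#}#} + N"] E4c
    by (simp add: add_mset_commute)
  have c1: "closed ({#Sink {#s0, b0, m3#}, Source {#a2, s2, m3#}, Wire a0 b2#} + N)"
    by (rule closed_reduce[OF D1c, of _ "{#a1, s1, b1#}"]) (simp_all add: add_mset_commute)
  have c1e: "closed ({#Sink {#s0, b0, m1#}, Source {#s2, a2, m1#}, Wire a0 b2#} + N)"
    by (rule closed_reduce[OF E4c, of _ "{#s1, b1, a1, m2, m3#}"]) (simp_all add: add_mset_commute)
  have c4: "closed ({#Sink {#s0, a0, m2#}, Source {#s2, b2, m2#}, Wire b0 a2#} + N)"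
    by (rule closed_reduce[OF D4c, of _ "{#s1, a1, b1, m1, m3#}"]) (simp_all add: add_mset_commute)
  have c4e: "closed ({#Sink {#a0, s0, m3#}, Source {#s2, b2, m3#}, Wire b0 a2#} + N)"
    by (rule closed_reduce[OF E1c, of _ "{#b1, s1, a1#}"]) (simp_all add: add_mset_commute)
  have c2: "closed ({#Sink {#s0, b0, m3#}, Sink {#a0, b1, m2#}, Source {#a2, b1, m3#}, Source {#s2, b2, m2#}#} + N)"
    by (rule closed_reduce[OF D2c, of _ "{#a1, s1#}"]) (simp_all add: add_mset_commute)
  have c3: "closed ({#Source {#b2, a1, m1#}, Source {#a2, s2, m3#}, Sink {#a1, b0, m3#}, Sink {#s0, a0, m1#}#} + N)"
    by (rule closed_reduce[OF D3c, of _ "{#s1, b1#}"]) (simp_all add: add_mset_commute)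
  \<comment> \<open>The crosswise matching of the states; \<open>r2\<close> and \<open>r3\<close>
    exchange two inner labels, \<open>r1\<close> and \<open>r4\<close> rename one.\<close>
  have r1: "ev ({#Sink {#s0, b0, m3#}, Source {#a2, s2, m3#}, Wire a0 b2#} + N) = ev ({#Sink {#s0, b0, m1#},
      Source {#s2, a2, m1#}, Wire a0 b2#} + N)"
    using ev_bond[of s0 b0 m3 s2 a2 "{#Wire a0 b2#} + N" m1] c1 c1e by (simp add: add_mset_commute)
  have r4: "ev ({#Sink {#s0, a0, m2#}, Source {#s2, b2, m2#}, Wire b0 a2#} + N) = ev ({#Sink {#a0, s0, m3#},
      Source {#s2, b2, m3#}, Wire b0 a2#} + N)"
    using ev_bond[of s0 a0 m2 s2 b2 "{#Wire b0 a2#} + N" m3] c4 c4e by (simp add: add_mset_commute)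
  have "distinct [m2, m3]" "{m2, m3} \<inter> {s0, b0, a0, b1, a2, s2, b2} = {}"
    using closedD(1,2)[OF c2] by auto
  then have r2: "ev ({#Sink {#s0, b0, m3#}, Sink {#a0, b1, m2#}, Source {#a2, b1, m3#}, Source {#s2, b2, m2#}#} + N)
      = ev ({#Source {#a2, b1, m2#}, Source {#s2, b2, m3#}, Sink {#a0, b1, m3#}, Sink {#s0, b0, m2#}#} + N)"
    using ev_transpose[OF c2, of m2 m3] by (simp add: transpose_def add_mset_commute)
  have "distinct [m1, m3]" "{m1, m3} \<inter> {s0, b0, a0, a1, a2, s2, b2} = {}"
    using closedD(1,2)[OF c3] by auto
  then have r3: "ev ({#Source {#b2, a1, m1#}, Source {#a2, s2, m3#}, Sink {#a1, b0, m3#}, Sink {#s0, a0, m1#}#} + N)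
      = ev ({#Sink {#a0, s0, m3#}, Source {#a1, b2, m3#}, Sink {#b0, a1, m1#}, Source {#s2, a2, m1#}#} + N)"
    using ev_transpose[OF c3, of m1 m3] by (simp add: transpose_def add_mset_commute)
  have DU: "ev ({#Crossing e m1 s0 a0 s1 a1, Crossing (- e) m2 s1 b1 s2 b2#} + ({#Sink {#a1, b0, m3#},
      Source {#a2, b1, m3#}#} + N)) = A_pow (2 * e) * (A_pow (- 2 * e) * ev ({#Sink {#s0, b0, m3#},
      Source {#a2, s2, m3#}, Wire a0 b2#} + N) - A_pow e * ev ({#Sink {#s0, b0, m3#}, Sink {#a0, b1, m2#}, Source {#a2, b1, m3#},
      Source {#s2, b2, m2#}#} + N)) -
      A_pow (- e) * (A_pow (- 2 * e) * ev ({#Source {#b2, a1, m1#}, Source {#a2, s2, m3#}, Sink {#a1, b0, m3#},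
      Sink {#s0, a0, m1#}#} + N) - A_pow e * (ev ({#Sink {#s0, a0, m2#}, Source {#s2, b2, m2#}, Wire b0 a2#} + N)
      + ev ({#Source {#s2, b2, a2#}, Sink {#s0, a0, b0#}#} + N)))"
    unfolding ev_two_crossings using D1 D2 D3 D4 by (simp add: add_mset_commute)
  have EU: "ev ({#Crossing (- e) m2 s0 b0 s1 b1, Crossing e m1 s1 a1 s2 a2#} + ({#Sink {#a0, b1, m3#},
      Source {#a1, b2, m3#}#} + N)) = A_pow (- 2 * e) * (A_pow (2 * e) * ev ({#Sink {#a0, s0, m3#},
      Source {#s2, b2, m3#}, Wire b0 a2#} + N) - A_pow (- e) * ev ({#Sink {#a0, s0, m3#}, Source {#a1, b2, m3#},
      Sink {#b0, a1, m1#}, Source {#s2, a2, m1#}#} + N)) -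
      A_pow e * (A_pow (2 * e) * ev ({#Source {#a2, b1, m2#}, Source {#s2, b2, m3#}, Sink {#a0, b1, m3#},
      Sink {#s0, b0, m2#}#} + N) - A_pow (- e) * (ev ({#Sink {#s0, b0, m1#}, Source {#s2, a2, m1#}, Wire a0 b2#} + N)
      + ev ({#Source {#s2, b2, a2#}, Sink {#s0, a0, b0#}#} + N)))"
    unfolding ev_two_crossings using E1 E2 E3 E4 by (simp add: add_mset_commute)
  have U: "ev ({#Crossing e m1 s0 a0 s1 a1, Crossing (- e) m2 s1 b1 s2 b2#} + ({#Sink {#a1, b0, m3#},
      Source {#a2, b1, m3#}#} + N)) = ev ({#Crossing (- e) m2 s0 b0 s1 b1, Crossing e m1 s1 a1 s2 a2#} + ({#Sink {#a0, b1, m3#},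
      Source {#a1, b2, m3#}#} + N))"
    unfolding DU EU r1 r2 r3 r4 using e by (elim disjE) (simp_all add: A_pow_simps algebra_simps)
  show ?thesis
    using ev_crossing[of h m3 a1 b0 a2 b1 "{#Crossing e m1 s0 a0 s1 a1, Crossing (- e) m2 s1 b1 s2 b2#} + N"]
      ev_crossing[of h m3 a0 b1 a1 b2 "{#Crossing (- e) m2 s0 b0 s1 b1, Crossing e m1 s1 a1 s2 a2#} + N"] DO EO U
    by (simp add: add_mset_commute)
qed

text \<open>With the third crossing oriented, both sides reduce by the antiparallel second move.
  With it unoriented, each side has one wiring that occurs in a bigon state and in both square
  states, so its coefficient A^3 + A^-3 - A^(3e) - A^(-3e) vanishes. The other wirings coincide, and
  the doubly unoriented states are the same hexagon.\<close>

lemma ev_R3_after_before: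
  assumes e: "e = 1 \<or> e = -1"
    and cl: "closed ({#Crossing h m3 a0 b1 a1 b2, Crossing e m1 s0 a1 s1 a2, Crossing (- e) m2 s1 b0 s2 b1#} + N)"
  shows "ev ({#Crossing h m3 a0 b1 a1 b2, Crossing e m1 s0 a1 s1 a2, Crossing (- e) m2 s1 b0 s2 b1#} + N) =
    ev ({#Crossing h m3 a1 b0 a2 b1, Crossing (- e) m2 s0 b1 s1 b2, Crossing e m1 s1 a0 s2 a1#} + N)"
proof -
  have e': "- e = 1 \<or> - e = -1" using e by auto
  have clE: "closed ({#Crossing h m3 a1 b0 a2 b1, Crossing (- e) m2 s0 b1 s1 b2, Crossing e m1 s1 a0 s2 a1#} + N)"
    by (rule closed_reduce[OF cl, of _ "{#}"]) (simp_all add: add_mset_commute)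
  let ?DO = "{#Wire a0 b2, Wire b1 a1, Crossing e m1 s0 a1 s1 a2, Crossing (- e) m2 s1 b0 s2 b1#} + N"
  have DOc: "closed ?DO"
    by (rule closed_reduce[OF cl, of _ "{#m3#}"]) (simp_all add: add_mset_commute)
  have DO: "ev ?DO = ev ({#Wire s0 s2, Wire a0 b2, Wire b0 a2#} + N)"
    using ev_wire_crossing_in2[of b1 a1 e m1 s0 s1 a2 "{#Wire a0 b2, Crossing (- e) m2 s1 b0 s2 b1#} + N"]
      ev_R2_antiparallel[OF e, of m1 s0 b1 s1 a2 m2 b0 s2 "{#Wire a0 b2#} + N"] DOc
    by (simp add: add_mset_commute)
  let ?EO = "{#Wire a1 b1, Wire b0 a2, Crossing (- e) m2 s0 b1 s1 b2, Crossing e m1 s1 a0 s2 a1#} + N"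
  have EOc: "closed ?EO"
    by (rule closed_reduce[OF clE, of _ "{#m3#}"]) (simp_all add: add_mset_commute)
  have EO: "ev ?EO = ev ({#Wire s0 s2, Wire a0 b2, Wire b0 a2#} + N)"
    using ev_wire_crossing_in2[of a1 b1 "- e" m2 s0 s1 b2 "{#Wire b0 a2, Crossing e m1 s1 a0 s2 a1#} + N"]
      ev_R2_antiparallel[OF e', of m2 s0 a1 s1 b2 m1 a0 s2 "{#Wire b0 a2#} + N"] EOc
    by (simp add: add_mset_commute)
  let ?D1 = "{#Wire s0 a2, Wire a1 s1, Wire s1 b1, Wire b0 s2, Sink {#a0, b1, m3#}, Source {#a1, b2, m3#}#} + N"
  have D1c: "closed ?D1"
    by (rule closed_reduce[OF cl, of _ "{#m1, m2#}"]) (simp_all add: add_mset_commute)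
  have D1: "ev ?D1 = bigon_value * ev ({#Wire s0 a2, Wire b0 s2, Wire a0 b2#} + N)"
    using ev_wire_wire[of a1 s1 b1 "{#Wire s0 a2, Wire b0 s2, Sink {#a0, b1, m3#}, Source {#a1, b2, m3#}#} + N"]
      ev_wire_sink[of a1 b1 "{#a0, m3#}" "{#Wire s0 a2, Wire b0 s2, Source {#a1, b2, m3#}#} + N"]
      ev_bigon[of a1 m3 b2 a0 "{#Wire s0 a2, Wire b0 s2#} + N"] D1c
    by (simp add: add_mset_commute)
  let ?D2 = "{#Wire s0 a2, Wire a1 s1, Sink {#s1, b0, m2#}, Source {#s2, b1, m2#}, Sink {#a0, b1, m3#},
      Source {#a1, b2, m3#}#} + N"
  have D2c: "closed ?D2"
    by (rule closed_reduce[OF cl, of _ "{#m1#}"]) (simp_all add: add_mset_commute)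
  have D2: "ev ?D2 = ev ({#Wire s0 a2, Wire b0 b2, Wire a0 s2#} + N) + ev ({#Wire s0 a2, Wire b0 s2, Wire a0 b2#} + N)"
    using ev_wire_sink[of a1 s1 "{#b0, m2#}" "{#Wire s0 a2, Source {#s2, b1, m2#}, Sink {#a0, b1, m3#},
      Source {#a1, b2, m3#}#} + N"]
      ev_quadrilateral[of a1 m3 b2 m2 b0 b1 s2 a0 "{#Wire s0 a2#} + N"] D2c
    by (simp add: add_mset_commute)
  let ?D3 = "{#Sink {#s0, a1, m1#}, Source {#s1, a2, m1#}, Wire s1 b1, Wire b0 s2, Sink {#a0, b1, m3#},
      Source {#a1, b2, m3#}#} + N"
  have D3c: "closed ?D3"
    by (rule closed_reduce[OF cl, of _ "{#m2#}"]) (simp_all add: add_mset_commute)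
  have D3: "ev ?D3 = ev ({#Wire s0 b2, Wire b0 s2, Wire a0 a2#} + N) + ev ({#Wire s0 a2, Wire b0 s2, Wire a0 b2#} + N)"
    using ev_wire_source[of s1 b1 "{#a2, m1#}" "{#Sink {#s0, a1, m1#}, Wire b0 s2, Sink {#a0, b1, m3#},
      Source {#a1, b2, m3#}#} + N"]
      ev_quadrilateral[of b1 m1 a2 m3 a0 a1 b2 s0 "{#Wire b0 s2#} + N"] D3c
    by (simp add: add_mset_commute)
  let ?E1 = "{#Wire s0 b2, Wire b1 s1, Wire s1 a1, Wire a0 s2, Sink {#a1, b0, m3#}, Source {#a2, b1, m3#}#} + N"
  have E1c: "closed ?E1"
    by (rule closed_reduce[OF clE, of _ "{#m1, m2#}"]) (simp_all add: add_mset_commute)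
  have E1: "ev ?E1 = bigon_value * ev ({#Wire s0 b2, Wire a0 s2, Wire b0 a2#} + N)"
    using ev_wire_wire[of b1 s1 a1 "{#Wire s0 b2, Wire a0 s2, Sink {#a1, b0, m3#}, Source {#a2, b1, m3#}#} + N"]
      ev_wire_sink[of b1 a1 "{#b0, m3#}" "{#Wire s0 b2, Wire a0 s2, Source {#a2, b1, m3#}#} + N"]
      ev_bigon[of b1 m3 a2 b0 "{#Wire s0 b2, Wire a0 s2#} + N"] E1c
    by (simp add: add_mset_commute)
  let ?E2 = "{#Wire s0 b2, Wire b1 s1, Sink {#s1, a0, m1#}, Source {#s2, a1, m1#}, Sink {#a1, b0, m3#},
      Source {#a2, b1, m3#}#} + N"
  have E2c: "closed ?E2"
    by (rule closed_reduce[OF clE, of _ "{#m2#}"]) (simp_all add: add_mset_commute)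
  have E2: "ev ?E2 = ev ({#Wire s0 b2, Wire b0 s2, Wire a0 a2#} + N) + ev ({#Wire s0 b2, Wire a0 s2, Wire b0 a2#} + N)"
    using ev_wire_sink[of b1 s1 "{#a0, m1#}" "{#Wire s0 b2, Source {#s2, a1, m1#}, Sink {#a1, b0, m3#},
      Source {#a2, b1, m3#}#} + N"]
      ev_quadrilateral[of b1 m3 a2 m1 a0 a1 s2 b0 "{#Wire s0 b2#} + N"] E2c
    by (simp add: add_mset_commute)
  let ?E3 = "{#Sink {#s0, b1, m2#}, Source {#s1, b2, m2#}, Wire s1 a1, Wire a0 s2, Sink {#a1, b0, m3#},
      Source {#a2, b1, m3#}#} + N"
  have E3c: "closed ?E3"
    by (rule closed_reduce[OF clE, of _ "{#m1#}"]) (simp_all add: add_mset_commute)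
  have E3: "ev ?E3 = ev ({#Wire s0 a2, Wire b0 b2, Wire a0 s2#} + N) + ev ({#Wire s0 b2, Wire a0 s2, Wire b0 a2#} + N)"
    using ev_wire_source[of s1 a1 "{#b2, m2#}" "{#Sink {#s0, b1, m2#}, Wire a0 s2, Sink {#a1, b0, m3#},
      Source {#a2, b1, m3#}#} + N"]
      ev_quadrilateral[of a1 m2 b2 m3 b0 b1 a2 s0 "{#Wire a0 s2#} + N"] E3c
    by (simp add: add_mset_commute)
  let ?H = "{#Sink {#s0, a1, m1#}, Source {#s1, a2, m1#}, Sink {#s1, b0, m2#}, Source {#s2, b1, m2#}, Sink {#a0, b1, m3#},
      Source {#a1, b2, m3#}#} + N"
  have Hc: "closed ?H"
    by (rule closed_reduce[OF cl, of _ "{#}"]) (simp_all add: add_mset_commute)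
  \<comment> \<open>A hexagon admits no reduction, but on both sides its six legs come in the same
    cyclic order \<open>s0\<close>, \<open>a2\<close>, \<open>b0\<close>, \<open>s2\<close>,
    \<open>a0\<close>, \<open>b2\<close> up to reversal. Three transpositions of inner labels turn
    one into the other; the inequalities let them be computed.\<close>
  have "b1 \<noteq> m1" "s1 \<noteq> m1" "m3 \<noteq> m1" "m2 \<noteq> m1" "a1 \<noteq> m1" "s0 \<noteq> m1" "a0 \<noteq> m1"
      "b0 \<noteq> m1" "s2 \<noteq> m1" "a2 \<noteq> m1" "b2 \<noteq> m1" "m1 \<noteq> b1" "s1 \<noteq> b1" "m3 \<noteq> b1"
      "m2 \<noteq> b1" "a1 \<noteq> b1" "s0 \<noteq> b1" "a0 \<noteq> b1" "b0 \<noteq> b1" "s2 \<noteq> b1" "a2 \<noteq> b1"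
      "b2 \<noteq> b1" "m1 \<noteq> s1" "b1 \<noteq> s1" "m3 \<noteq> s1" "m2 \<noteq> s1" "a1 \<noteq> s1" "s0 \<noteq> s1"
      "a0 \<noteq> s1" "b0 \<noteq> s1" "s2 \<noteq> s1" "a2 \<noteq> s1" "b2 \<noteq> s1" "m1 \<noteq> m3" "b1 \<noteq> m3"
      "s1 \<noteq> m3" "m2 \<noteq> m3" "a1 \<noteq> m3" "s0 \<noteq> m3" "a0 \<noteq> m3" "b0 \<noteq> m3" "s2 \<noteq> m3"
      "a2 \<noteq> m3" "b2 \<noteq> m3" "m1 \<noteq> m2" "b1 \<noteq> m2" "s1 \<noteq> m2" "m3 \<noteq> m2" "a1 \<noteq> m2"
      "s0 \<noteq> m2" "a0 \<noteq> m2" "b0 \<noteq> m2" "s2 \<noteq> m2" "a2 \<noteq> m2" "b2 \<noteq> m2" "m1 \<noteq> a1"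
      "b1 \<noteq> a1" "s1 \<noteq> a1" "m3 \<noteq> a1" "m2 \<noteq> a1" "s0 \<noteq> a1" "a0 \<noteq> a1" "b0 \<noteq> a1"
      "s2 \<noteq> a1" "a2 \<noteq> a1" "b2 \<noteq> a1"
    using closedD(1,2)[OF Hc] by auto
  note dist = this
  let ?H' = "{#Sink {#s0, a1, b1#}, Source {#s1, a2, b1#}, Sink {#s1, b0, m2#}, Source {#s2, m1, m2#}, Sink {#a0, m1, m3#},
      Source {#a1, b2, m3#}#} + N"
  have h0: "ev ?H =
      ev ?H'"
    using ev_transpose[OF Hc, of m1 b1] dist by (simp add: transpose_def add_mset_commute)
  have Hc0: "closed ?H'"
    by (rule closed_reduce[OF Hc, of _ "{#}"]) (simp_all add: add_mset_commute)
  let ?H'' = "{#Sink {#s0, a1, b1#}, Source {#m3, a2, b1#}, Sink {#m3, b0, m2#}, Source {#s2, m1, m2#}, Sink {#a0, m1, s1#},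
      Source {#a1, b2, s1#}#} + N"
  have h1: "ev ?H' =
      ev ?H''"
    using ev_transpose[OF Hc0, of s1 m3] dist by (simp add: transpose_def add_mset_commute)
  have Hc1: "closed ?H''"
    by (rule closed_reduce[OF Hc, of _ "{#}"]) (simp_all add: add_mset_commute)
  have h2: "ev ?H'' =
      ev ({#Sink {#s0, m2, b1#}, Source {#m3, a2, b1#}, Sink {#m3, b0, a1#}, Source {#s2, m1, a1#}, Sink {#a0, m1, s1#},
      Source {#m2, b2, s1#}#} + N)"
    using ev_transpose[OF Hc1, of m2 a1] dist by (simp add: transpose_def add_mset_commute)
  have H: "ev ?H =
      ev ({#Sink {#s0, b1, m2#}, Source {#s1, b2, m2#}, Sink {#s1, a0, m1#}, Source {#s2, a1, m1#}, Sink {#a1, b0, m3#},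
      Source {#a2, b1, m3#}#} + N)"
    using h0 h1 h2 by (simp add: add_mset_commute)
  have DU: "ev ({#Crossing e m1 s0 a1 s1 a2, Crossing (- e) m2 s1 b0 s2 b1#} + ({#Sink {#a0, b1, m3#},
      Source {#a1, b2, m3#}#} + N)) = A_pow (2 * e)
      * (A_pow (- 2 * e) * (bigon_value * ev ({#Wire s0 a2, Wire b0 s2, Wire a0 b2#} + N))
      - A_pow e * (ev ({#Wire s0 a2, Wire b0 b2, Wire a0 s2#} + N) + ev ({#Wire s0 a2, Wire b0 s2, Wire a0 b2#} + N))) -
      A_pow (- e) * (A_pow (- 2 * e) * (ev ({#Wire s0 b2, Wire b0 s2, Wire a0 a2#} + N)
      + ev ({#Wire s0 a2, Wire b0 s2, Wire a0 b2#} + N)) - A_pow e * ev ?H)"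
    unfolding ev_two_crossings using D1 D2 D3 by (simp add: add_mset_commute)
  have EU: "ev ({#Crossing (- e) m2 s0 b1 s1 b2, Crossing e m1 s1 a0 s2 a1#} + ({#Sink {#a1, b0, m3#},
      Source {#a2, b1, m3#}#} + N)) = A_pow (- 2 * e)
      * (A_pow (2 * e) * (bigon_value * ev ({#Wire s0 b2, Wire a0 s2, Wire b0 a2#} + N))
      - A_pow (- e) * (ev ({#Wire s0 b2, Wire b0 s2, Wire a0 a2#} + N) + ev ({#Wire s0 b2, Wire a0 s2, Wire b0 a2#} + N))) -
      A_pow e * (A_pow (2 * e) * (ev ({#Wire s0 a2, Wire b0 b2, Wire a0 s2#} + N)
      + ev ({#Wire s0 b2, Wire a0 s2, Wire b0 a2#} + N)) - A_pow (- e) * ev ({#Sink {#s0, b1, m2#}, Source {#s1, b2, m2#},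
      Sink {#s1, a0, m1#}, Source {#s2, a1, m1#}, Sink {#a1, b0, m3#}, Source {#a2, b1, m3#}#} + N))"
    unfolding ev_two_crossings using E1 E2 E3 by (simp add: add_mset_commute)
  have U: "ev ({#Crossing e m1 s0 a1 s1 a2, Crossing (- e) m2 s1 b0 s2 b1#} + ({#Sink {#a0, b1, m3#},
      Source {#a1, b2, m3#}#} + N)) = ev ({#Crossing (- e) m2 s0 b1 s1 b2, Crossing e m1 s1 a0 s2 a1#} + ({#Sink {#a1, b0, m3#},
      Source {#a2, b1, m3#}#} + N))"
    unfolding DU EU H using e by (elim disjE) (simp_all add: A_pow_simps algebra_simps)
  show ?thesis
    using ev_crossing[of h m3 a0 b1 a1 b2 "{#Crossing e m1 s0 a1 s1 a2, Crossing (- e) m2 s1 b0 s2 b1#} + N"]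
      ev_crossing[of h m3 a1 b0 a2 b1 "{#Crossing (- e) m2 s0 b1 s1 b2, Crossing e m1 s1 a0 s2 a1#} + N"] DO EO U
    by (simp add: add_mset_commute)
qed

end


section \<open>The net of a diagram\<close>

text \<open>Every edge of a diagram is cut in two: \<open>Out p\<close> leaves the crossing and
  \<open>In q\<close> arrives at the next one, with a wire between them. Crossings and edges are
  then separate generators, and a move can alter one kind and keep the other. \<open>Mid c\<close>
  is the inner edge at \<open>c\<close>.\<close>

datatype point = In passage | Out passage | Mid nat

text \<open>Bijectivity is asked only on the passages: after \<open>erase\<close>, the successor map
  is in general not the identity at the passages that were removed.\<close>

definition wf_diagram :: "vdiagram \<Rightarrow> bool" where
  "wf_diagram D \<longleftrightarrow> finite (crossings D) \<and> bij_betw (nxt D) (passages D) (passages D)"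

definition virtual_passages :: "vdiagram \<Rightarrow> passage set" where
  "virtual_passages D = {p \<in> passages D. virtual D (fst p)}"

abbreviation wire_to_next :: "vdiagram \<Rightarrow> passage \<Rightarrow> point gen" where
  "wire_to_next D p \<equiv> Wire (Out p) (In (nxt D p))"

abbreviation wire_through :: "passage \<Rightarrow> point gen" where
  "wire_through p \<equiv> Wire (In p) (Out p)"

abbreviation chord :: "int \<Rightarrow> nat \<Rightarrow> passage \<Rightarrow> passage \<Rightarrow> point gen" where
  "chord e c p q \<equiv> Crossing e (Mid c) (In p) (In q) (Out p) (Out q)"

abbreviation chord_at :: "vdiagram \<Rightarrow> nat \<Rightarrow> point gen" where
  "chord_at D c \<equiv> chord (crossing_sign D c) c (c, True) (c, False)"

definition net :: "vdiagram \<Rightarrow> point gen multiset" where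
  "net D = image_mset (wire_to_next D) (mset_set (passages D)) +
     image_mset (chord_at D) (mset_set (classical D)) +
     image_mset wire_through (mset_set (virtual_passages D))"

definition smoothing :: "nat set \<Rightarrow> nat \<Rightarrow> point gen multiset" where
  "smoothing U c = (if c \<in> U
     then {#Sink {#In (c, True), In (c, False), Mid c#}, Source {#Out (c, True), Out (c, False), Mid c#}#}
     else {#Wire (In (c, True)) (Out (c, False)), Wire (In (c, False)) (Out (c, True))#})"

definition state_net :: "vdiagram \<Rightarrow> nat set \<Rightarrow> point gen multiset" where
  "state_net D U = image_mset (wire_to_next D) (mset_set (passages D)) +
     \<Sum>\<^sub># (image_mset (smoothing U) (mset_set (classical D))) +
     image_mset wire_through (mset_set (virtual_passages D))"

lemma starts_of_image: "starts_of (image_mset g A) = \<Sum>\<^sub># (image_mset (\<lambda>x. starts (g x)) A)"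
  by (induction A) auto

lemma ends_of_image: "ends_of (image_mset g A) = \<Sum>\<^sub># (image_mset (\<lambda>x. ends (g x)) A)"
  by (induction A) auto

lemma sum_mset_singletons: "(\<Sum>x\<in>#A. {#f x#}) = image_mset f A"
  by (induction A) auto

lemma image_mset_inj: "inj_on f A \<Longrightarrow> image_mset f (mset_set A) = mset_set (f ` A)"
  by (simp add: image_mset_mset_set)

lemma no_dup_mset_set: "no_dup (mset_set A)"
  by (simp add: no_dup_def count_mset_set')

lemma sum_mset_pairs:
  assumes "finite C"
  shows "(\<Sum>c\<in>#mset_set C. {#f (c, True), f (c, False)#}) = image_mset f (mset_set (C \<times> UNIV))"
  using assms
proof (induction C rule: finite_induct)
  case (insert c C)
  have "insert c C \<times> (UNIV :: bool set) = {(c, True), (c, False)} \<union> C \<times> UNIV"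
    by (auto simp: UNIV_bool)
  moreover have "mset_set ({(c, True), (c, False)} \<union> C \<times> UNIV) =
      {#(c, True), (c, False)#} + mset_set (C \<times> (UNIV :: bool set))"
    using insert by (subst mset_set_Union) auto
  ultimately show ?case using insert by simp
qed simp

lemma sum_mset_plus: "(\<Sum>c\<in>#A. f c + g c) = (\<Sum>c\<in>#A. f c) + (\<Sum>c\<in>#A. g c :: 'a multiset)"
  by (induction A) auto

lemma finite_diagram:
  assumes "wf_diagram D"
  shows "finite (crossings D)" "finite (passages D)" "finite (classical D)" "finite (virtual_passages D)"
  using assms by (auto simp: wf_diagram_def passages_def classical_def virtual_passages_def)

lemma mset_passages:
  assumes "wf_diagram D"
  shows "mset_set (classical D \<times> UNIV) + mset_set (virtual_passages D) = mset_set (passages D)"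
proof -
  have "passages D = classical D \<times> UNIV \<union> virtual_passages D"
    by (auto simp: passages_def classical_def virtual_passages_def)
  moreover have "(classical D \<times> UNIV) \<inter> virtual_passages D = {}"
    by (auto simp: classical_def virtual_passages_def)
  ultimately show ?thesis
    using finite_diagram[OF assms] by (simp add: mset_set_Union)
qed

lemma image_mset_nxt:
  assumes "wf_diagram D"
  shows "image_mset (\<lambda>p. f (nxt D p)) (mset_set (passages D)) = image_mset f (mset_set (passages D))"
proof -
  have "image_mset (nxt D) (mset_set (passages D)) = mset_set (passages D)"
    using assms by (simp add: image_mset_mset_set bij_betw_def wf_diagram_def)
  from arg_cong[OF this, of "image_mset f"] show ?thesis
    by (simp add: multiset.map_comp comp_def)
qed

text \<open>Every \<open>In p\<close>, every \<open>Out p\<close> and every \<open>Mid c\<close>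
  with \<open>c\<close> classical occurs once as a start and once as an end. For the labels
  \<open>In p\<close> as starts this is the bijectivity of \<open>nxt\<close>.\<close>

lemma closed_net:
  assumes D: "wf_diagram D"
  shows "closed (net D)"
proof -
  let ?I = "image_mset In (mset_set (passages D))" and ?O = "image_mset Out (mset_set (passages D))"
    and ?M = "image_mset Mid (mset_set (classical D))"
  have fin: "finite (classical D)" using finite_diagram[OF D] by simp
  have pairs: "image_mset f (mset_set (classical D \<times> UNIV)) + image_mset f (mset_set (virtual_passages D)) =
      image_mset f (mset_set (passages D))" for f :: "passage \<Rightarrow> point"
    by (simp add: mset_passages[OF D, symmetric])
  have 1: "(\<Sum>c\<in>#mset_set (classical D). {#f (c, True), f (c, False), Mid c#}) =
      image_mset f (mset_set (classical D \<times> UNIV)) + ?M" for f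
  proof -
    have "(\<Sum>c\<in>#mset_set (classical D). {#f (c, True), f (c, False), Mid c#}) =
        (\<Sum>c\<in>#mset_set (classical D). {#f (c, True), f (c, False)#} + {#Mid c#})"
      by (simp add: add_mset_commute)
    then show ?thesis
      by (simp only: sum_mset_plus sum_mset_pairs[OF fin] sum_mset_singletons)
  qed
  have "starts_of (net D) = ?I + ?O + ?M"
    using image_mset_nxt[OF D, of In] pairs[of Out]
    by (simp add: net_def starts_of_image sum_mset_singletons 1 ac_simps)
  moreover have "ends_of (net D) = ?I + ?O + ?M"
    using pairs[of In] by (simp add: net_def ends_of_image sum_mset_singletons 1 ac_simps)
  moreover have "?I + ?O + ?M = mset_set (In ` passages D \<union> Out ` passages D \<union> Mid ` classical D)"
  proof -
    have "(In ` passages D \<union> Out ` passages D) \<inter> Mid ` classical D = {}" "In ` passages D \<inter> Out ` passages D = {}"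
      by auto
    then show ?thesis
      using finite_diagram[OF D] image_mset_inj[of In "passages D"] image_mset_inj[of Out "passages D"]
        image_mset_inj[of Mid "classical D"]
      by (simp add: mset_set_Union inj_def inj_on_def)
  qed
  ultimately show ?thesis
    by (auto simp: closed_def no_dup_mset_set net_def)
qed

context kuperberg
begin

text \<open>The subsets of \<open>insert c C\<close> with and without \<open>c\<close> correspond to
  the two terms of the expansion at \<open>c\<close>. The smoothing of \<open>c\<close> joins the
  rest, which is why \<open>N\<close> is arbitrary in the induction.\<close>

lemma ev_expand_chords:
  assumes "finite C"
  shows "ev (image_mset (chord_at D) (mset_set C) + N) = (\<Sum>U\<in>Pow C.
     (\<Prod>c\<in>C. if c \<in> U then - A_pow (- crossing_sign D c) else A_pow (2 * crossing_sign D c)) *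
     ev (\<Sum>\<^sub># (image_mset (smoothing U) (mset_set C)) + N))"
  using assms
proof (induction C arbitrary: N rule: finite_induct)
  case (insert c C)
  let ?w = "\<lambda>U c. if c \<in> U then - A_pow (- crossing_sign D c) else A_pow (2 * crossing_sign D c)"
  let ?S = "\<lambda>U C. \<Sum>\<^sub># (image_mset (smoothing U) (mset_set C))"
  let ?T = "\<lambda>C U. (\<Prod>c\<in>C. ?w U c) * ev (?S U C + N)"
  have same: "(\<Prod>c\<in>C. ?w (insert c' U) c) = (\<Prod>c\<in>C. ?w U c)" "?S (insert c' U) C = ?S U C"
    if "c' \<notin> C" for c' U
  proof -
    show "(\<Prod>c\<in>C. ?w (insert c' U) c) = (\<Prod>c\<in>C. ?w U c)"
      by (rule prod.cong) (use that in auto)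
    have "image_mset (smoothing (insert c' U)) (mset_set C) = image_mset (smoothing U) (mset_set C)"
      by (rule image_mset_cong) (use that insert in \<open>auto simp: smoothing_def\<close>)
    then show "?S (insert c' U) C = ?S U C" by simp
  qed
  have "(\<Sum>U\<in>Pow (insert c C). ?T (insert c C) U) =
      (\<Sum>U\<in>Pow C. ?T (insert c C) U) + (\<Sum>U\<in>insert c ` Pow C. ?T (insert c C) U)"
    unfolding Pow_insert using insert by (intro sum.union_disjoint) auto
  also have "(\<Sum>U\<in>insert c ` Pow C. ?T (insert c C) U) = (\<Sum>U\<in>Pow C. ?T (insert c C) (insert c U))"
  proof (subst sum.reindex)
    show "inj_on (insert c) (Pow C)"
    proof (rule inj_onI)
      fix x y assume "x \<in> Pow C" "y \<in> Pow C" "insert c x = insert c y"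
      then show "x = y" using insert_ident[of c x y] insert(2) by auto
    qed
  qed simp
  also have "(\<Sum>U\<in>Pow C. ?T (insert c C) (insert c U)) =
      - A_pow (- crossing_sign D c) * (\<Sum>U\<in>Pow C. (\<Prod>c\<in>C. ?w U c) * ev (?S U C + (smoothing {c} c + N)))"
    unfolding sum_distrib_left
  proof (rule sum.cong)
    fix U assume "U \<in> Pow C"
    have "?S (insert c U) (insert c C) = smoothing {c} c + ?S U C"
      using insert(1,2) same(2)[OF insert(2), of U] by (simp add: smoothing_def)
    moreover have "(\<Prod>c'\<in>insert c C. ?w (insert c U) c') = - A_pow (- crossing_sign D c) * (\<Prod>c\<in>C. ?w U c)"
      unfolding prod.insert[OF insert(1,2)] same(1)[OF insert(2)] by simp
    ultimately show "?T (insert c C) (insert c U) = - A_pow (- crossing_sign D c) *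
        ((\<Prod>c\<in>C. ?w U c) * ev (?S U C + (smoothing {c} c + N)))"
      by (simp only: mult.assoc union_assoc union_lcomm)
  qed simp
  also have "(\<Sum>U\<in>Pow C. ?T (insert c C) U) =
      A_pow (2 * crossing_sign D c) * (\<Sum>U\<in>Pow C. (\<Prod>c\<in>C. ?w U c) * ev (?S U C + (smoothing {} c + N)))"
    unfolding sum_distrib_left
  proof (rule sum.cong)
    fix U assume "U \<in> Pow C"
    then have "c \<notin> U" using insert by auto
    then have "?S U (insert c C) = smoothing {} c + ?S U C"
      using insert(1,2) by (simp add: smoothing_def)
    moreover have "(\<Prod>c\<in>insert c C. ?w U c) = A_pow (2 * crossing_sign D c) * (\<Prod>c\<in>C. ?w U c)"
      unfolding prod.insert[OF insert(1,2)] using \<open>c \<notin> U\<close> by simp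
    ultimately show "?T (insert c C) U = A_pow (2 * crossing_sign D c) *
        ((\<Prod>c\<in>C. ?w U c) * ev (?S U C + (smoothing {} c + N)))"
      by (simp only: mult.assoc union_assoc union_lcomm)
  qed simp
  finally have sum: "(\<Sum>U\<in>Pow (insert c C). ?T (insert c C) U) =
      A_pow (2 * crossing_sign D c) * ev (image_mset (chord_at D) (mset_set C) + (smoothing {} c + N)) -
      A_pow (- crossing_sign D c) * ev (image_mset (chord_at D) (mset_set C) + (smoothing {c} c + N))"
    by (simp add: insert.IH)
  have "image_mset (chord_at D) (mset_set (insert c C)) + N =
      add_mset (chord_at D c) (image_mset (chord_at D) (mset_set C) + N)"
    using insert by simp
  then show ?case unfolding sum by (simp add: ev_crossing smoothing_def)
qed simp

end

section \<open>State graphs as webs of nets\<close>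

definition edge :: "passage \<Rightarrow> nat \<times> bool option" where
  "edge p = (fst p, Some (snd p))"

text \<open>The passage by which a strand arriving at \<open>p\<close> leaves unless the unoriented
  state is chosen: the same strand at a virtual crossing, the other one at a classical crossing. It
  is an involution, so it also gives the passage of arrival.\<close>

definition turn :: "vdiagram \<Rightarrow> passage \<Rightarrow> passage" where
  "turn D p = (fst p, snd p = virtual D (fst p))"

definition state_gluing :: "vdiagram \<Rightarrow> nat set \<Rightarrow> ((nat \<times> bool option) \<times> (nat \<times> bool option)) set" where
  "state_gluing D U = (\<lambda>p. (edge p, edge (turn D (nxt D p)))) ` {p \<in> passages D. fst (nxt D p) \<notin> U}"

definition state_edges :: "vdiagram \<Rightarrow> nat set \<Rightarrow> (nat \<times> bool option) set" where
  "state_edges D U = edge ` passages D \<union> U \<times> {None}"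

definition state_head :: "vdiagram \<Rightarrow> nat \<times> bool option \<Rightarrow> nat \<times> bool" where
  "state_head D e = (case snd e of None \<Rightarrow> fst e | Some b \<Rightarrow> fst (nxt D (fst e, b)), False)"

lemma inj_edge [simp]: "edge p = edge q \<longleftrightarrow> p = q"
  by (auto simp: edge_def prod_eq_iff)

lemma turn_turn [simp]: "turn D (turn D p) = p"
  by (cases p) (auto simp: turn_def)

lemma fst_turn [simp]: "fst (turn D p) = fst p"
  by (simp add: turn_def)

lemma turn_eq_iff [simp]: "turn D p = turn D q \<longleftrightarrow> p = q"
  by (metis turn_turn)

lemma turn_virtual: "virtual D (fst p) \<Longrightarrow> turn D p = p"
  by (simp add: turn_def)

lemma state_graph_eq:
  "state_graph D U =
    splice (U \<times> UNIV) (state_edges D U) (state_gluing D U) (\<lambda>e. (fst e, True)) (state_head D) (circles D)"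
proof -
  have R: "{((c, Some b), (c', Some (b' = virtual D c'))) | c b c' b'.
        c \<in> crossings D \<and> nxt D (c, b) = (c', b') \<and> c' \<notin> U} = state_gluing D U" (is "?L = _")
  proof (intro set_eqI iffI)
    fix x assume "x \<in> ?L"
    then obtain c b c' b' where "x = ((c, Some b), (c', Some (b' = virtual D c')))" "c \<in> crossings D"
      "nxt D (c, b) = (c', b')" "c' \<notin> U" by auto
    then show "x \<in> state_gluing D U"
      unfolding state_gluing_def by (intro image_eqI[of _ _ "(c, b)"]) (auto simp: edge_def turn_def passages_def)
  next
    fix x assume "x \<in> state_gluing D U"
    then obtain c b where cb: "x = (edge (c, b), edge (turn D (nxt D (c, b))))" "c \<in> crossings D" "fst (nxt D (c, b)) \<notin> U"
      by (auto simp: state_gluing_def passages_def)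
    obtain c' b' where "nxt D (c, b) = (c', b')" by (cases "nxt D (c, b)")
    then show "x \<in> ?L" using cb by (auto simp: edge_def turn_def)
  qed
  have E: "crossings D \<times> range Some \<union> U \<times> {None} = state_edges D U"
    by (auto simp: state_edges_def edge_def passages_def image_iff)
  have t: "(\<lambda>(c :: nat, i :: bool option). (c, True)) = (\<lambda>e. (fst e, True))" by auto
  have h: "(\<lambda>(c, i). (case i of None \<Rightarrow> c | Some b \<Rightarrow> fst (nxt D (c, b)), False)) = state_head D"
    by (auto simp: state_head_def fun_eq_iff split: option.split)
  show ?thesis unfolding state_graph_def R E t h ..
qed

lemma wf_diagram_nxt:
  assumes "wf_diagram D"
  shows "p \<in> passages D \<Longrightarrow> nxt D p \<in> passages D"
    and "p \<in> passages D \<Longrightarrow> q \<in> passages D \<Longrightarrow> nxt D p = nxt D q \<longleftrightarrow> p = q"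
    and "q \<in> passages D \<Longrightarrow> \<exists>p \<in> passages D. nxt D p = q"
proof -
  have "inj_on (nxt D) (passages D)" "nxt D ` passages D = passages D"
    using assms by (auto simp: wf_diagram_def bij_betw_def)
  then show "p \<in> passages D \<Longrightarrow> nxt D p \<in> passages D"
    and "p \<in> passages D \<Longrightarrow> q \<in> passages D \<Longrightarrow> nxt D p = nxt D q \<longleftrightarrow> p = q"
    and "q \<in> passages D \<Longrightarrow> \<exists>p \<in> passages D. nxt D p = q"
    by (blast, simp add: inj_on_eq_iff, metis imageE)
qed

lemma passages_fst: "p \<in> passages D \<longleftrightarrow> fst p \<in> crossings D"
  by (auto simp: passages_def mem_Times_iff)

lemma turn_in_passages: "turn D p \<in> passages D \<longleftrightarrow> p \<in> passages D"
  by (simp add: passages_fst)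

lemma gluing_state_graph:
  assumes D: "wf_diagram D" and U: "U \<subseteq> crossings D"
  shows "gluing (U \<times> UNIV) (state_edges D U) (state_gluing D U) (\<lambda>e. (fst e, True)) (state_head D)"
  unfolding gluing_def
proof (intro conjI)
  note n = wf_diagram_nxt[OF D]
  show "finite (state_edges D U)"
    using finite_diagram[OF D] U by (auto simp: state_edges_def intro: finite_subset)
  show "state_gluing D U \<subseteq> state_edges D U \<times> state_edges D U"
    using n(1) by (auto simp: state_gluing_def state_edges_def passages_fst)
  have sg: "(x, y) \<in> state_gluing D U \<longleftrightarrow>
      (\<exists>p \<in> passages D. fst (nxt D p) \<notin> U \<and> x = edge p \<and> y = edge (turn D (nxt D p)))" for x y
    unfolding state_gluing_def by blast
  show "single_valued (state_gluing D U)"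
    by (rule single_valuedI) (metis sg inj_edge)
  show "single_valued ((state_gluing D U)\<inverse>)"
    by (rule single_valuedI) (metis sg converse_iff inj_edge turn_eq_iff n(2))
  show "(\<lambda>e. (fst e, True)) ` (state_edges D U - Range (state_gluing D U)) \<subseteq> U \<times> UNIV"
  proof (intro image_subsetI)
    fix e assume e: "e \<in> state_edges D U - Range (state_gluing D U)"
    have "fst e \<in> U"
    proof (rule ccontr)
      assume nU: "fst e \<notin> U"
      then obtain q where q: "q \<in> passages D" "e = edge q" using e by (auto simp: state_edges_def)
      then obtain p where p: "p \<in> passages D" "nxt D p = turn D q" using n(3)[of "turn D q"] by (auto simp: passages_fst)
      then have "(edge p, edge (turn D (nxt D p))) \<in> state_gluing D U"
        unfolding state_gluing_def using nU q by (intro imageI) (simp add: edge_def)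
      then show False using e p q by auto
    qed
    then show "(fst e, True) \<in> U \<times> UNIV" by simp
  qed
  show "state_head D ` (state_edges D U - Domain (state_gluing D U)) \<subseteq> U \<times> UNIV"
  proof (intro image_subsetI)
    fix e assume e: "e \<in> state_edges D U - Domain (state_gluing D U)"
    then consider c where "e = (c, None)" "c \<in> U" | p where "p \<in> passages D" "e = edge p"
      by (auto simp: state_edges_def)
    then show "state_head D e \<in> U \<times> UNIV"
    proof cases
      case 2
      then have "fst (nxt D p) \<in> U" using e by (auto simp: state_gluing_def Domain_iff image_iff)
      then show ?thesis using 2 by (simp add: state_head_def edge_def)
    qed (simp add: state_head_def)
  qed
qed

lemma closed_smoothing:
  assumes "finite C" "closed (image_mset (chord_at D) (mset_set C) + N)"
  shows "closed (\<Sum>\<^sub># (image_mset (smoothing U) (mset_set C)) + N)"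
  using assms
proof (induction C arbitrary: N rule: finite_induct)
  case (insert c C)
  have "closed (add_mset (chord_at D c) (image_mset (chord_at D) (mset_set C) + N))"
    using insert by simp
  from closed_crossing[OF this] have "closed (image_mset (chord_at D) (mset_set C) + (smoothing U c + N))"
    by (cases "c \<in> U") (simp_all add: smoothing_def)
  from insert.IH[OF this] show ?case using insert by (simp add: ac_simps)
qed simp

lemma state_net_properties:
  assumes D: "wf_diagram D"
  shows "pure (state_net D U)" "closed (state_net D U)"
proof -
  show "pure (state_net D U)"
    using finite_diagram[OF D] by (auto simp: pure_def state_net_def smoothing_def)
  have "closed (image_mset (chord_at D) (mset_set (classical D)) +
     (image_mset (wire_to_next D) (mset_set (passages D)) + image_mset wire_through (mset_set (virtual_passages D))))"
    using closed_net[OF D] by (simp add: net_def ac_simps)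
  from closed_smoothing[OF finite_diagram(3)[OF D] this, of U]
  show "closed (state_net D U)" by (simp add: state_net_def ac_simps)
qed

abbreviation crossing_sink :: "nat \<Rightarrow> point gen" where
  "crossing_sink c \<equiv> Sink {#In (c, True), In (c, False), Mid c#}"

abbreviation crossing_source :: "nat \<Rightarrow> point gen" where
  "crossing_source c \<equiv> Source {#Out (c, True), Out (c, False), Mid c#}"

lemma in_state_net:
  assumes D: "wf_diagram D" and U: "U \<subseteq> classical D"
  shows "g \<in># state_net D U \<longleftrightarrow>
    (\<exists>p \<in> passages D. g = wire_to_next D p) \<or>
    (\<exists>c \<in> U. g = crossing_sink c \<or> g = crossing_source c) \<or>
    (\<exists>p \<in> passages D. fst p \<notin> U \<and> g = Wire (In p) (Out (turn D p)))"
proof -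
  have "g \<in># state_net D U \<longleftrightarrow> (\<exists>p \<in> passages D. g = wire_to_next D p) \<or>
      (\<exists>c \<in> classical D. g \<in># smoothing U c) \<or> (\<exists>p \<in> virtual_passages D. g = wire_through p)"
    using finite_diagram[OF D] by (auto simp: state_net_def)
  moreover have "(\<exists>c \<in> classical D. g \<in># smoothing U c) \<longleftrightarrow>
      (\<exists>c \<in> U. g = crossing_sink c \<or> g = crossing_source c) \<or>
      (\<exists>p \<in> passages D. fst p \<notin> U \<and> \<not> virtual D (fst p) \<and> g = Wire (In p) (Out (turn D p)))" (is "?L \<longleftrightarrow> ?R")
  proof
    assume ?L
    then obtain c where c: "c \<in> classical D" "g \<in># smoothing U c" by auto
    show ?R
    proof (cases "c \<in> U")
      case False
      then have "g = Wire (In (c, True)) (Out (turn D (c, True))) \<or> g = Wire (In (c, False)) (Out (turn D (c, False)))"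
        using c by (auto simp: smoothing_def turn_def classical_def)
      moreover have "(c, b) \<in> passages D" "\<not> virtual D c" for b using c by (auto simp: passages_fst classical_def)
      ultimately show ?thesis using False by (metis fst_conv)
    qed (use c in \<open>auto simp: smoothing_def\<close>)
  next
    assume ?R
    then consider c where "c \<in> U" "g = crossing_sink c \<or> g = crossing_source c"
      | p where "p \<in> passages D" "fst p \<notin> U" "\<not> virtual D (fst p)" "g = Wire (In p) (Out (turn D p))" by auto
    then show ?L
    proof cases
      case 1
      then show ?thesis using U by (intro bexI[of _ c]) (auto simp: smoothing_def)
    next
      case 2
      then show ?thesis
        by (intro bexI[of _ "fst p"]; cases p; cases "snd p")
          (auto simp: smoothing_def turn_def classical_def passages_fst)
    qed
  qed
  moreover have "(\<exists>p \<in> virtual_passages D. g = wire_through p) \<longleftrightarrow>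
      (\<exists>p \<in> passages D. fst p \<notin> U \<and> virtual D (fst p) \<and> g = Wire (In p) (Out (turn D p)))"
    using U by (auto simp: virtual_passages_def turn_virtual classical_def)
  ultimately show ?thesis by blast
qed

text \<open>Absorbing all labels \<open>In p\<close> leaves one label for each edge of the state
  graph: \<open>Out p\<close> is the edge that leaves \<open>p\<close>, and \<open>Mid c\<close> is
  the inner edge \<open>(c, None)\<close>. The components without crossings have no generators in
  the net, so their number is added separately.\<close>

lemma state_graph_iso:
  assumes D: "wf_diagram D" and U: "U \<subseteq> classical D"
  shows "web_iso (fst (net_web (state_net D U)), circles D + snd (net_web (state_net D U))) (state_graph D U)"
proof -
  let ?N = "state_net D U"
  let ?V = "vertices ?N" and ?E = "set_mset (starts_of ?N)" and ?R = "wires ?N"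
  let ?Y = "In ` passages D"
  let ?C = "\<lambda>e. (e, e) \<in> ?R\<^sup>+ \<and> ?R\<^sup>+ `` {e} \<subseteq> ?Y"
  note pure = state_net_properties(1)[OF D, of U] and cl = state_net_properties(2)[OF D, of U]
  note cD = closedD[OF cl] and n = wf_diagram_nxt[OF D] and inN = in_state_net[OF D U]
  have g: "gluing ?V ?E ?R (out_gen ?N) (in_gen ?N)" using gluing_net[OF pure cl] .
  have UC: "U \<subseteq> crossings D" using U by (auto simp: classical_def)
  have UP: "(c, b) \<in> passages D" if "c \<in> U" for c b
    using that UC by (auto simp: passages_def)
  have R: "?R = {(Out p, In (nxt D p)) | p. p \<in> passages D} \<union>
      {(In p, Out (turn D p)) | p. p \<in> passages D \<and> fst p \<notin> U}"
    by (auto simp: wires_def inN)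
  have V: "?V = crossing_sink ` U \<union> crossing_source ` U"
    by (auto simp: vertices_def inN)
  have E: "?E = In ` passages D \<union> Out ` passages D \<union> Mid ` U"
  proof (intro set_eqI iffI)
    fix l assume "l \<in> ?E"
    then show "l \<in> In ` passages D \<union> Out ` passages D \<union> Mid ` U"
      using n(1) UP by (auto simp: in_starts_of inN turn_in_passages)
  next
    fix l assume "l \<in> In ` passages D \<union> Out ` passages D \<union> Mid ` U"
    then consider p where "p \<in> passages D" "l = In p" | p where "p \<in> passages D" "l = Out p" | c where "c \<in> U" "l = Mid c"
      by auto
    then show "l \<in> ?E"
    proof cases
      case 1
      then obtain q where "q \<in> passages D" "p = nxt D q" using n(3)[of p] by metis
      then have "wire_to_next D q \<in># ?N" "l \<in># starts (wire_to_next D q)" using 1 by (auto simp: inN)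
      then show ?thesis unfolding in_starts_of by blast
    next
      case 2
      show ?thesis
      proof (cases "fst p \<in> U")
        case True
        then have "crossing_source (fst p) \<in># ?N" by (auto simp: inN)
        moreover have "l \<in># starts (crossing_source (fst p))"
          using 2 by (cases p; cases "snd p") auto
        ultimately show ?thesis unfolding in_starts_of by blast
      next
        case False
        then have "Wire (In (turn D p)) (Out (turn D (turn D p))) \<in># ?N"
          unfolding inN using 2 by (intro disjI2 bexI[of _ "turn D p"]) (auto simp: passages_fst)
        then show ?thesis using 2 unfolding in_starts_of by (force simp: turn_turn)
      qed
    next
      case 3
      then have "crossing_source c \<in># ?N" by (auto simp: inN)
      then show ?thesis using 3 unfolding in_starts_of by force
    qed
  qed
  have in_sink: "in_gen ?N l = crossing_sink c" if "c \<in> U" "l \<in># {#In (c, True), In (c, False), Mid c#}" for c l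
    by (rule in_gen_eq[OF cD(2)]) (use that in \<open>auto simp: inN\<close>)
  have out_source: "out_gen ?N l = crossing_source c" if "c \<in> U" "l \<in># {#Out (c, True), Out (c, False), Mid c#}" for c l
    by (rule out_gen_eq[OF cD(1)]) (use that in \<open>auto simp: inN\<close>)
  \<comment> \<open>An edge that runs into an unoriented crossing ends with the absorbed label
    \<open>In (nxt D p)\<close>, whose head passes to \<open>Out p\<close>.\<close>
  define h' where "h' l = (case l of Out p \<Rightarrow> in_gen ?N (In (nxt D p)) | _ \<Rightarrow> in_gen ?N l)" for l
  define R' where "R' = {(u, v). (u, v) \<in> ?R O (?R \<inter> ?Y \<times> UNIV)\<^sup>* \<and> u \<notin> ?Y \<and> v \<notin> ?Y}"
  have after: "(Out p, z) \<in> ?R O (?R \<inter> ?Y \<times> UNIV)\<^sup>* \<longleftrightarrow>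
      p \<in> passages D \<and> (z = In (nxt D p) \<or> fst (nxt D p) \<notin> U \<and> z = Out (turn D (nxt D p)))" for p z
  proof
    assume "(Out p, z) \<in> ?R O (?R \<inter> ?Y \<times> UNIV)\<^sup>*"
    then obtain y where y: "(Out p, y) \<in> ?R" "(y, z) \<in> (?R \<inter> ?Y \<times> UNIV)\<^sup>*" by (elim relcompE) simp
    then have p: "p \<in> passages D" "y = In (nxt D p)" by (auto simp: R)
    from y(2) show "p \<in> passages D \<and> (z = In (nxt D p) \<or> fst (nxt D p) \<notin> U \<and> z = Out (turn D (nxt D p)))"
    proof (cases rule: converse_rtranclE)
      case (step w)
      then have w: "fst (nxt D p) \<notin> U" "w = Out (turn D (nxt D p))" using p by (auto simp: R)
      from step(2) have "w = z" by (cases rule: converse_rtranclE) (use w in auto)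
      then show ?thesis using p w by simp
    qed (use p in simp)
  next
    assume h: "p \<in> passages D \<and> (z = In (nxt D p) \<or> fst (nxt D p) \<notin> U \<and> z = Out (turn D (nxt D p)))"
    then have "(Out p, In (nxt D p)) \<in> ?R" unfolding R by blast
    moreover have "(In (nxt D p), z) \<in> (?R \<inter> ?Y \<times> UNIV)\<^sup>*"
    proof (cases "z = In (nxt D p)")
      case False
      then have "(In (nxt D p), z) \<in> ?R \<inter> ?Y \<times> UNIV" using h n(1) unfolding R by blast
      then show ?thesis by (rule r_into_rtrancl)
    qed simp
    ultimately show "(Out p, z) \<in> ?R O (?R \<inter> ?Y \<times> UNIV)\<^sup>*" by (rule relcompI)
  qed
  have mid: "(Mid c, z) \<notin> ?R" for c z by (auto simp: R)
  have R'_eq: "R' = (\<lambda>p. (Out p, Out (turn D (nxt D p)))) ` {p \<in> passages D. fst (nxt D p) \<notin> U}"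
  proof -
    have "(u, v) \<in> R' \<longleftrightarrow> (\<exists>p \<in> passages D. fst (nxt D p) \<notin> U \<and> u = Out p \<and> v = Out (turn D (nxt D p)))" for u v
    proof (cases u)
      case (In p)
      then show ?thesis using n(1) by (auto simp: R'_def R)
    next
      case (Out p)
      then show ?thesis unfolding R'_def mem_Collect_eq prod.case by (auto simp only: after Out) (auto simp: n(1))
    next
      case (Mid c)
      then show ?thesis using mid unfolding R'_def by auto
    qed
    then show ?thesis by (auto simp: image_iff)
  qed
  have Y: "?Y \<subseteq> Range ?R" using n(3) by (force simp: R Range_iff)
  have h'1: "h' e = in_gen ?N e" if "e \<in> ?E - ?Y - Domain ?R" for e
    using that unfolding E by (auto simp: h'_def R)
  have h'2: "h' e = in_gen ?N z"
    if e: "e \<in> ?E - ?Y" and ez: "(e, z) \<in> ?R O (?R \<inter> ?Y \<times> UNIV)\<^sup>*" and z: "z \<in> ?Y - Domain ?R" for e z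
  proof -
    have "e \<notin> range Mid" using ez mid by auto
    then obtain p where p: "e = Out p" using e unfolding E by blast
    then have "z = In (nxt D p)" using ez[unfolded p after] z by auto
    then show ?thesis by (simp add: p h'_def)
  qed
  \<comment> \<open>A label \<open>In p\<close> is never glued to another label \<open>In q\<close>,
    hence no circle consists of absorbed labels alone.\<close>
  have noC: "{?R\<^sup>+ `` {e} | e. ?C e} = {}"
  proof (intro equals0I)
    fix X assume "X \<in> {?R\<^sup>+ `` {e} | e. ?C e}"
    then obtain e where e: "(e, e) \<in> ?R\<^sup>+" "?R\<^sup>+ `` {e} \<subseteq> ?Y" by auto
    then obtain y where y: "(e, y) \<in> ?R" by (meson tranclD)
    have "e \<in> ?Y" "y \<in> ?Y" using e y by auto
    then show False using y by (auto simp: R)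
  qed
  have abs: "web_iso (splice ?V ?E ?R (out_gen ?N) (in_gen ?N) (circles D))
      (splice ?V (?E - ?Y) R' (out_gen ?N) h' (circles D + card {?R\<^sup>+ `` {e} | e. ?C e}))"
    and g': "gluing ?V (?E - ?Y) R' (out_gen ?N) h'"
    using splice_absorb[OF g Y R'_def refl h'1 h'2] by blast+
  define \<phi> where "\<phi> l = (case l of Out p \<Rightarrow> edge p | Mid c \<Rightarrow> (c, None) | In p \<Rightarrow> edge p)" for l
  \<comment> \<open>The crossing to which a vertex belongs is read off from its unique label of the
    form \<open>Mid c\<close>.\<close>
  define \<psi> where "\<psi> g = ((THE c. Mid c \<in># starts g + ends g), is_Source g)" for g :: "point gen"
  have \<psi>: "\<psi> (crossing_sink c) = (c, False)" "\<psi> (crossing_source c) = (c, True)" for c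
    by (simp_all add: \<psi>_def)
  have EY: "?E - ?Y = Out ` passages D \<union> Mid ` U" unfolding E by auto
  have "web_iso (splice ?V (?E - ?Y) R' (out_gen ?N) h' (circles D)) (state_graph D U)"
    unfolding state_graph_eq
  proof (rule splice_iso[OF g', of \<psi> \<phi>])
    show "inj_on \<psi> ?V" unfolding V by (auto simp: inj_on_def \<psi>)
    show "inj_on \<phi> (?E - ?Y)" unfolding EY by (auto simp: inj_on_def \<phi>_def edge_def prod_eq_iff)
    show "U \<times> UNIV = \<psi> ` ?V"
      unfolding V image_Un image_image \<psi> by (auto simp: UNIV_bool)
    show "state_edges D U = \<phi> ` (?E - ?Y)"
      unfolding EY state_edges_def by (auto simp: \<phi>_def image_Un image_image)
    show "state_gluing D U = map_prod \<phi> \<phi> ` R'"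
      unfolding R'_eq state_gluing_def by (simp add: image_image \<phi>_def)
    show "(fst (\<phi> e), True) = \<psi> (out_gen ?N e)" if e: "e \<in> ?E - ?Y" "e \<notin> Range R'" for e
    proof -
      consider p where "p \<in> passages D" "e = Out p" | c where "c \<in> U" "e = Mid c" using e unfolding EY by auto
      then show ?thesis
      proof cases
        case 1
        have "fst p \<in> U"
        proof (rule ccontr)
          assume "fst p \<notin> U"
          moreover obtain q where "q \<in> passages D" "nxt D q = turn D p"
            using n(3)[of "turn D p"] 1 by (auto simp: passages_fst)
          ultimately have "(Out q, Out p) \<in> R'" unfolding R'_eq by (intro image_eqI[of _ _ q]) auto
          then show False using e 1 by auto
        qed
        then have "out_gen ?N e = crossing_source (fst p)"
          using out_source[of "fst p" e] 1 by (cases p; cases "snd p") auto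
        then show ?thesis using 1 by (simp add: \<psi> \<phi>_def edge_def)
      next
        case 2
        then show ?thesis using out_source[of c e] by (simp add: \<psi> \<phi>_def)
      qed
    qed
    show "state_head D (\<phi> e) = \<psi> (h' e)" if e: "e \<in> ?E - ?Y" "e \<notin> Domain R'" for e
    proof -
      consider p where "p \<in> passages D" "e = Out p" | c where "c \<in> U" "e = Mid c" using e unfolding EY by auto
      then show ?thesis
      proof cases
        case 1
        then have "fst (nxt D p) \<in> U" using e by (auto simp: R'_eq Domain_iff image_iff)
        then have "h' e = crossing_sink (fst (nxt D p))"
          using in_sink[of "fst (nxt D p)" "In (nxt D p)"] 1 by (cases "nxt D p"; cases "snd (nxt D p)") (auto simp: h'_def)
        then show ?thesis using 1 by (simp add: \<psi> \<phi>_def edge_def state_head_def)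
      next
        case 2
        then show ?thesis using in_sink[of c e] by (simp add: \<psi> \<phi>_def h'_def state_head_def)
      qed
    qed
  qed
  with abs have "web_iso (splice ?V ?E ?R (out_gen ?N) (in_gen ?N) (circles D)) (state_graph D U)"
    unfolding noC by (simp add: web_iso_trans)
  moreover have "splice ?V ?E ?R (out_gen ?N) (in_gen ?N) (circles D) =
      (fst (net_web ?N), circles D + snd (net_web ?N))"
    by (simp add: net_web_def splice_def)
  ultimately show ?thesis by simp
qed

context kuperberg
begin

lemma val_circles: "trivalent_bipartite G \<Longrightarrow> val (G, k + n) = circle_value ^ k * val (G, n)"
  by (induction k) (simp_all add: val_circle mult.assoc)

lemma f_state_graph:
  assumes "wf_diagram D" "U \<subseteq> classical D"
  shows "f (state_graph D U) = circle_value ^ circles D * ev (state_net D U)"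
    and "trivalent_bipartite (fst (state_graph D U))"
proof -
  let ?W = "net_web (state_net D U)"
  note st = state_net_properties[OF assms(1), of U]
  have triv: "trivalent_bipartite (fst ?W)" using trivalent_bipartite_net_web[OF st] .
  then have triv': "trivalent_bipartite (fst (fst ?W, circles D + snd ?W))" by simp
  show t: "trivalent_bipartite (fst (state_graph D U))"
    by (rule trivalent_bipartite_web_iso[OF triv' state_graph_iso[OF assms]])
  have "f (state_graph D U) = val (fst ?W, circles D + snd ?W)"
    using val_web[OF t] val_iso[OF triv' state_graph_iso[OF assms]] by simp
  also have "\<dots> = circle_value ^ circles D * ev (state_net D U)"
    using val_circles[OF triv] ev_pure[OF st(1)] by (simp add: pval_def)
  finally show "f (state_graph D U) = circle_value ^ circles D * ev (state_net D U)" .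
qed

text \<open>The bridge between diagrams and nets: the state sum is the expansion of all crossings of
  the net, and each component without crossings contributes a circle factor. Afterwards moves are
  compared by local rewriting of nets.\<close>

lemma bracket_net:
  assumes D: "wf_diagram D"
  shows "bracket f D = circle_value ^ circles D * ev (net D)"
proof -
  let ?w = "\<lambda>U. \<Prod>c\<in>classical D. if c \<in> U then - A_pow (- crossing_sign D c) else A_pow (2 * crossing_sign D c)"
  let ?N = "image_mset (wire_to_next D) (mset_set (passages D)) + image_mset wire_through (mset_set (virtual_passages D))"
  have "ev (net D) = ev (image_mset (chord_at D) (mset_set (classical D)) + ?N)"
    by (simp add: net_def ac_simps)
  also have "\<dots> = (\<Sum>U\<in>Pow (classical D). ?w U * ev (state_net D U))"
    unfolding ev_expand_chords[OF finite_diagram(3)[OF D]] by (simp add: state_net_def ac_simps)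
  finally have "circle_value ^ circles D * ev (net D) =
      (\<Sum>U\<in>Pow (classical D). ?w U * (circle_value ^ circles D * ev (state_net D U)))"
    by (simp add: sum_distrib_left ac_simps)
  also have "\<dots> = bracket f D"
    unfolding bracket_def using f_state_graph(1)[OF D] by (intro sum.cong) auto
  finally show ?thesis by simp
qed

end


section \<open>Erasing virtual crossings\<close>

text \<open>Stronger than \<open>wf_diagram\<close>: with a permutation on all of the type, the
  powers of \<open>nxt\<close> are injective and every orbit is a cycle, as the iteration in
  \<open>erase\<close> demands.\<close>

definition permutation_diagram :: "vdiagram \<Rightarrow> bool" where
  "permutation_diagram D \<longleftrightarrow> finite (crossings D) \<and> nxt D permutes passages D"

lemma permutation_diagram_wf: "permutation_diagram D \<Longrightarrow> wf_diagram D"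
  by (auto simp: permutation_diagram_def wf_diagram_def permutes_imp_bij)

lemma finite_passages: "finite (crossings D) \<Longrightarrow> finite (passages D)"
  by (simp add: passages_def)

lemma permutation_diagram_orbit:
  assumes "permutation_diagram D"
  shows "p \<in> orbit (nxt D) p"
  using assms finite_passages
  by (intro permutation_self_in_orbit) (auto simp: permutation_diagram_def permutation_permutes)

lemma funpow_in_passages:
  assumes "wf_diagram D" "p \<in> passages D"
  shows "(nxt D ^^ i) p \<in> passages D"
  using assms wf_diagram_nxt(1) by (induction i) auto

lemma erase_simps [simp]:
  "crossings (erase X D) = crossings D - X" "virtual (erase X D) = virtual D"
  "positive (erase X D) = positive D"
  "circles (erase X D) = circles D + card {S \<in> orbit (nxt D) ` passages D. fst ` S \<subseteq> X}"
  by (simp_all add: erase_def)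

lemma passages_erase: "passages (erase X D) = {p \<in> passages D. fst p \<notin> X}"
  by (auto simp: passages_def)

lemma turn_erase [simp]: "turn (erase X D) = turn D"
  by (simp add: turn_def fun_eq_iff)

text \<open>The least index in \<open>erase\<close> is attained, because the orbit of
  \<open>p\<close> returns to \<open>p\<close> itself, which lies outside \<open>X\<close>.\<close>

lemma nxt_erase:
  assumes D: "permutation_diagram D" and p: "p \<in> passages (erase X D)"
  obtains k where "0 < k" "nxt (erase X D) p = (nxt D ^^ k) p" "fst ((nxt D ^^ k) p) \<notin> X"
    "\<And>j. 0 < j \<Longrightarrow> j < k \<Longrightarrow> fst ((nxt D ^^ j) p) \<in> X"
proof -
  let ?Q = "\<lambda>i. 0 < i \<and> fst ((nxt D ^^ i) p) \<notin> X"
  obtain n where "0 < n" "(nxt D ^^ n) p = p"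
    using permutation_diagram_orbit[OF D, of p] unfolding orbit_altdef by auto
  then have "?Q n" using p by (simp add: passages_erase)
  then have "?Q (LEAST i. ?Q i)" by (rule LeastI)
  moreover have "fst ((nxt D ^^ j) p) \<in> X" if "0 < j" "j < (LEAST i. ?Q i)" for j
    using not_less_Least[OF that(2)] that(1) by auto
  moreover have "nxt (erase X D) p = (nxt D ^^ (LEAST i. ?Q i)) p" by (simp add: erase_def)
  ultimately show ?thesis using that by blast
qed

lemma nxt_erase_eqI:
  assumes "0 < i" "fst ((nxt D ^^ i) p) \<notin> X" "\<And>j. 0 < j \<Longrightarrow> j < i \<Longrightarrow> fst ((nxt D ^^ j) p) \<in> X"
  shows "nxt (erase X D) p = (nxt D ^^ i) p"
proof -
  have "(LEAST i. 0 < i \<and> fst ((nxt D ^^ i) p) \<notin> X) = i"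
    by (rule Least_equality) (use assms in \<open>auto simp: not_less[symmetric]\<close>)
  then show ?thesis by (simp add: erase_def)
qed

lemma wf_diagram_erase:
  assumes D: "permutation_diagram D"
  shows "wf_diagram (erase X D)"
proof -
  let ?P = "passages (erase X D)" and ?n = "nxt (erase X D)"
  note wf = permutation_diagram_wf[OF D]
  have fin: "finite ?P" using D by (simp add: finite_passages permutation_diagram_def)
  have inj: "inj (nxt D ^^ i)" for i
    using D by (intro inj_fn) (auto simp: permutation_diagram_def permutes_inj)
  have "?n ` ?P \<subseteq> ?P"
  proof (intro image_subsetI)
    fix p assume p: "p \<in> ?P"
    then obtain k where "?n p = (nxt D ^^ k) p" "fst ((nxt D ^^ k) p) \<notin> X" using nxt_erase[OF D] by metis
    then show "?n p \<in> ?P" using funpow_in_passages[OF wf] p by (simp add: passages_erase)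
  qed
  moreover have "inj_on ?n ?P"
  proof -
    \<comment> \<open>Cancelling the shorter run puts \<open>p\<close> on the run from
      \<open>q\<close>. It cannot be strictly inside, where all passages belong to \<open>X\<close>,
      so it is the beginning.\<close>
    have eq: "p = q" if "(nxt D ^^ k) p = (nxt D ^^ l) q" "k \<le> l" "0 < k" "fst p \<notin> X"
      "\<And>j. 0 < j \<Longrightarrow> j < l \<Longrightarrow> fst ((nxt D ^^ j) q) \<in> X" for p q k l
    proof -
      have "(nxt D ^^ l) q = (nxt D ^^ k) ((nxt D ^^ (l - k)) q)"
        using fun_cong[OF funpow_add[of k "l - k" "nxt D"], of q] that(2) by simp
      then have p: "p = (nxt D ^^ (l - k)) q" using that(1) inj[of k] by (simp add: inj_eq)
      then have "l - k = 0" using that(3,4) that(5)[of "l - k"] by (cases "l - k = 0") auto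
      then show ?thesis using p by simp
    qed
    show ?thesis
    proof (rule inj_onI)
      fix p q assume p: "p \<in> ?P" and q: "q \<in> ?P" and pq: "?n p = ?n q"
      obtain k where k: "0 < k" "?n p = (nxt D ^^ k) p" "\<And>j. 0 < j \<Longrightarrow> j < k \<Longrightarrow> fst ((nxt D ^^ j) p) \<in> X"
        using nxt_erase[OF D p] by metis
      obtain l where l: "0 < l" "?n q = (nxt D ^^ l) q" "\<And>j. 0 < j \<Longrightarrow> j < l \<Longrightarrow> fst ((nxt D ^^ j) q) \<in> X"
        using nxt_erase[OF D q] by metis
      show "p = q"
      proof (cases "k \<le> l")
        case True
        then show ?thesis using eq[of k p l q] k l pq p by (simp add: passages_erase)
      next
        case False
        then show ?thesis using eq[of l q k p] k l pq q by (simp add: passages_erase)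
      qed
    qed
  qed
  ultimately have "bij_betw ?n ?P ?P" using fin by (simp add: bij_betw_def endo_inj_surj)
  then show ?thesis using D by (simp add: wf_diagram_def permutation_diagram_def)
qed

text \<open>Strands go straight through the virtual crossings in \<open>X\<close>, so the edges
  leaving them can be absorbed. The circles formed by such edges alone are the orbits of
  \<open>nxt\<close> inside \<open>X\<close>, and these are what \<open>erase\<close> adds to
  \<open>circles\<close>.\<close>

lemma state_graph_erase:
  assumes D: "permutation_diagram D" and X: "X \<subseteq> crossings D" "\<forall>c \<in> X. virtual D c" and U: "U \<subseteq> classical D"
  shows "web_iso (state_graph D U) (state_graph (erase X D) U)"
proof -
  let ?E = "state_edges D U" and ?R = "state_gluing D U" and ?t = "\<lambda>e :: nat \<times> bool option. (fst e, True)"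
  let ?Y = "edge ` {p \<in> passages D. fst p \<in> X}" and ?D = "erase X D"
  note wf = permutation_diagram_wf[OF D]
  note n = wf_diagram_nxt[OF wf] and np = funpow_in_passages[OF wf]
  have UX: "c \<notin> U" if "c \<in> X" for c using that X U by (auto simp: classical_def)
  have UC: "U \<subseteq> crossings D" using U by (auto simp: classical_def)
  have vX: "turn D p = p" if "fst p \<in> X" for p using that X(2) by (intro turn_virtual) auto
  have g: "gluing (U \<times> UNIV) ?E ?R ?t (state_head D)" by (rule gluing_state_graph[OF wf UC])
  have R: "(x, y) \<in> ?R \<longleftrightarrow> (\<exists>p \<in> passages D. fst (nxt D p) \<notin> U \<and> x = edge p \<and> y = edge (turn D (nxt D p)))" for x y
    unfolding state_gluing_def by blast
  have Rp: "(edge p, y) \<in> ?R \<longleftrightarrow> p \<in> passages D \<and> fst (nxt D p) \<notin> U \<and> y = edge (turn D (nxt D p))" for p y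
    by (auto simp: R)
  have eY: "edge p \<in> ?Y \<longleftrightarrow> p \<in> passages D \<and> fst p \<in> X" for p by auto
  define S where "S = ?R \<inter> ?Y \<times> UNIV"
  define R' where "R' = {(u, v). (u, v) \<in> ?R O S\<^sup>* \<and> u \<notin> ?Y \<and> v \<notin> ?Y}"
  \<comment> \<open>\<open>i\<close> steps lead from \<open>p\<close> only through \<open>X\<close>
    and then to a crossing outside \<open>U\<close>. The last passage may still belong to
    \<open>X\<close>: a run through absorbed edges can stop anywhere.\<close>
  define path where "path p i \<longleftrightarrow> 0 < i \<and> fst ((nxt D ^^ i) p) \<notin> U \<and> (\<forall>j. 0 < j \<and> j < i \<longrightarrow> fst ((nxt D ^^ j) p) \<in> X)" for p i
  have after: "(edge p, z) \<in> ?R O S\<^sup>* \<longleftrightarrow> (\<exists>i. path p i \<and> z = edge (turn D ((nxt D ^^ i) p)))" if p: "p \<in> passages D" for p z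
  proof
    assume "(edge p, z) \<in> ?R O S\<^sup>*"
    then obtain y where y: "(edge p, y) \<in> ?R" "(y, z) \<in> S\<^sup>*" by (elim relcompE) simp
    from y(2) show "\<exists>i. path p i \<and> z = edge (turn D ((nxt D ^^ i) p))"
    proof (induction rule: rtrancl_induct)
      case base
      have "path p 1" using y(1) by (simp add: path_def Rp)
      then show ?case using y(1) by (intro exI[of _ 1]) (simp add: Rp)
    next
      case (step z z')
      then obtain i where i: "path p i" "z = edge (turn D ((nxt D ^^ i) p))" by auto
      have "fst ((nxt D ^^ i) p) \<in> X" using step(2) i(2) by (auto simp: S_def eY)
      then have z: "z = edge ((nxt D ^^ i) p)" using i(2) vX by simp
      have "(z, z') \<in> ?R" using step(2) by (simp add: S_def)
      then have "fst ((nxt D ^^ Suc i) p) \<notin> U" "z' = edge (turn D ((nxt D ^^ Suc i) p))"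
        unfolding z Rp by auto
      moreover from this have "path p (Suc i)"
        using i(1) \<open>fst ((nxt D ^^ i) p) \<in> X\<close> unfolding path_def by (auto simp: less_Suc_eq)
      ultimately show ?case by blast
    qed
  next
    assume "\<exists>i. path p i \<and> z = edge (turn D ((nxt D ^^ i) p))"
    then obtain i where i: "path p i" "z = edge (turn D ((nxt D ^^ i) p))" by auto
    have "(edge p, edge (turn D ((nxt D ^^ i) p))) \<in> ?R O S\<^sup>*" if "path p i" for i
      using that
    proof (induction i)
      case (Suc i)
      show ?case
      proof (cases "i = 0")
        case True
        then have "(edge p, edge (turn D ((nxt D ^^ Suc i) p))) \<in> ?R"
          using Suc.prems p by (simp add: Rp path_def)
        then show ?thesis by auto
      next
        case False
        then have iX: "fst ((nxt D ^^ i) p) \<in> X" using Suc.prems by (simp add: path_def)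
        then have "path p i" using Suc.prems False UX by (auto simp: path_def)
        then have "(edge p, edge ((nxt D ^^ i) p)) \<in> ?R O S\<^sup>*" using Suc.IH vX[OF iX] by simp
        moreover have "(edge ((nxt D ^^ i) p), edge (turn D ((nxt D ^^ Suc i) p))) \<in> S"
          using Suc.prems np[OF p] iX by (auto simp: S_def Rp path_def)
        ultimately show ?thesis by (auto intro: rtrancl_into_rtrancl)
      qed
    qed (simp add: path_def)
    then show "(edge p, z) \<in> ?R O S\<^sup>*" using i by simp
  qed
  have first: "path p i \<Longrightarrow> fst ((nxt D ^^ i) p) \<notin> X \<Longrightarrow> (nxt D ^^ i) p = nxt ?D p" for p i
    using nxt_erase_eqI[of i D p X] by (simp add: path_def)
  have first': "\<exists>i. path p i \<and> (nxt D ^^ i) p = nxt ?D p \<and> fst (nxt ?D p) \<notin> X"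
    if "p \<in> passages ?D" "fst (nxt ?D p) \<notin> U" for p
    using nxt_erase[OF D that(1)] that(2) unfolding path_def by metis
  have R'_eq: "R' = state_gluing ?D U"
  proof -
    have "(u, v) \<in> R' \<longleftrightarrow> (\<exists>p \<in> passages ?D. fst (nxt ?D p) \<notin> U \<and> u = edge p \<and> v = edge (turn D (nxt ?D p)))" (is "_ \<longleftrightarrow> ?A") for u v
    proof
      assume uv: "(u, v) \<in> R'"
      then obtain p where p: "p \<in> passages D" "u = edge p" "fst p \<notin> X" by (auto simp: R'_def R eY)
      then obtain i where i: "path p i" "v = edge (turn D ((nxt D ^^ i) p))" using uv after by (auto simp: R'_def)
      have "fst ((nxt D ^^ i) p) \<notin> X" using uv i(2) np[OF p(1)] by (auto simp: R'_def eY turn_in_passages)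
      then have "(nxt D ^^ i) p = nxt ?D p" using first i(1) by blast
      then show ?A using p i by (intro bexI[of _ p]) (auto simp: path_def passages_erase)
    next
      assume ?A
      then obtain p where p: "p \<in> passages ?D" "fst (nxt ?D p) \<notin> U" "u = edge p" "v = edge (turn D (nxt ?D p))" by auto
      then obtain i where "path p i" "(nxt D ^^ i) p = nxt ?D p" "fst (nxt ?D p) \<notin> X" using first' by blast
      then show "(u, v) \<in> R'"
        using after[of p v] p by (auto simp: R'_def eY passages_erase)
    qed
    then have "x \<in> R' \<longleftrightarrow> x \<in> state_gluing ?D U" for x
      unfolding state_gluing_def turn_erase by (cases x) (simp only:, blast)
    then show ?thesis by blast
  qed
  have YR: "?Y \<subseteq> Range ?R"
  proof
    fix e assume "e \<in> ?Y"
    then obtain q where q: "e = edge q" "q \<in> passages D" "fst q \<in> X" by auto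
    then obtain p where "p \<in> passages D" "nxt D p = q" using n(3)[of q] by blast
    then have "(edge p, e) \<in> ?R" using q vX UX by (simp add: Rp)
    then show "e \<in> Range ?R" by blast
  qed
  have h1: "state_head ?D e = state_head D e" if e: "e \<in> ?E - ?Y - Domain ?R" for e
  proof -
    consider c where "e = (c, None)" | p where "p \<in> passages D" "e = edge p" "fst p \<notin> X"
      using e by (auto simp: state_edges_def)
    then show ?thesis
    proof cases
      case 2
      then have "fst (nxt D p) \<in> U" using e by (auto simp: Rp Domain_iff)
      then have "nxt ?D p = nxt D p" using nxt_erase_eqI[of 1 D p X] UX by auto
      then show ?thesis using 2 by (simp add: state_head_def edge_def)
    qed (simp add: state_head_def)
  qed
  have h2: "state_head ?D e = state_head D z"
    if e: "e \<in> ?E - ?Y" and ez: "(e, z) \<in> ?R O (?R \<inter> ?Y \<times> UNIV)\<^sup>*" and z: "z \<in> ?Y - Domain ?R" for e z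
  proof -
    have "e \<in> Domain ?R" using ez by blast
    then obtain p where p: "p \<in> passages D" "e = edge p" unfolding Domain_iff R by blast
    then have pX: "fst p \<notin> X" using e by auto
    from p obtain i where i: "path p i" "z = edge (turn D ((nxt D ^^ i) p))" using ez after unfolding S_def by blast
    have iX: "fst ((nxt D ^^ i) p) \<in> X" using z i(2) by (auto simp: eY)
    then have z': "z = edge ((nxt D ^^ i) p)" using i(2) vX by simp
    then have "fst (nxt D ((nxt D ^^ i) p)) \<in> U" using z np[OF p(1)] by (auto simp: Rp Domain_iff)
    moreover from this have "nxt ?D p = (nxt D ^^ Suc i) p"
      using i(1) iX UX by (intro nxt_erase_eqI) (auto simp: path_def less_Suc_eq)
    ultimately show ?thesis using p z' by (simp add: state_head_def edge_def)
  qed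
  \<comment> \<open>Inside \<open>X\<close> the gluing follows \<open>nxt\<close> exactly, because
    \<open>turn\<close> is the identity there and no crossing belongs to \<open>U\<close>. Cycles of
    absorbed edges are therefore images of orbits.\<close>
  have cycles: "{?R\<^sup>+ `` {e} | e. (e, e) \<in> ?R\<^sup>+ \<and> ?R\<^sup>+ `` {e} \<subseteq> ?Y} =
      image edge ` {S \<in> orbit (nxt D) ` passages D. fst ` S \<subseteq> X}"
  proof -
    have svR: "single_valued ?R" using g by (simp add: gluing_def)
    have reach: "?R\<^sup>+ `` {edge p} = edge ` orbit (nxt D) p" if p: "p \<in> passages D" and o: "fst ` orbit (nxt D) p \<subseteq> X" for p
    proof -
      have step: "(edge q, y) \<in> ?R \<longleftrightarrow> y = edge (nxt D q)" if "q \<in> passages D" "nxt D q \<in> orbit (nxt D) p" for q y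
      proof -
        have "fst (nxt D q) \<in> X" using o that(2) by auto
        then show ?thesis using that(1) vX UX by (simp add: Rp)
      qed
      have oP: "q \<in> passages D" if "q \<in> orbit (nxt D) p" for q
        using that np[OF p] unfolding orbit_altdef by auto
      show ?thesis
      proof (intro set_eqI iffI)
        fix y assume "y \<in> ?R\<^sup>+ `` {edge p}"
        then have "(edge p, y) \<in> ?R\<^sup>+" by simp
        then show "y \<in> edge ` orbit (nxt D) p"
        proof (induction rule: trancl_induct)
          case (base y)
          then show ?case using step[of p y] p orbit.base[of "nxt D" p] by auto
        next
          case (step y z)
          then obtain q where q: "q \<in> orbit (nxt D) p" "y = edge q" by auto
          have "nxt D q \<in> orbit (nxt D) p" using q(1) by (rule orbit.step)
          then show ?case using \<open>(y, z) \<in> ?R\<close> q oP[OF q(1)] \<open>\<And>q y. q \<in> passages D \<Longrightarrow> nxt D q \<in> orbit (nxt D) p \<Longrightarrow> ((edge q, y) \<in> ?R) = (y = edge (nxt D q))\<close> by auto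
        qed
      next
        fix y assume "y \<in> edge ` orbit (nxt D) p"
        then obtain q where q: "q \<in> orbit (nxt D) p" "y = edge q" by auto
        from q(1) have "(edge p, edge q) \<in> ?R\<^sup>+"
        proof (induction rule: orbit.induct)
          case base
          have "(edge p, edge (nxt D p)) \<in> ?R" using step[of p] p orbit.base[of "nxt D" p] by auto
          then show ?case by (rule r_into_trancl)
        next
          case (step q)
          then have "(edge q, edge (nxt D q)) \<in> ?R"
            using oP orbit.step[OF step(1)] \<open>\<And>q y. q \<in> passages D \<Longrightarrow> nxt D q \<in> orbit (nxt D) p \<Longrightarrow> ((edge q, y) \<in> ?R) = (y = edge (nxt D q))\<close> by blast
          then show ?case using step.IH by (auto intro: trancl_into_trancl)
        qed
        then show "y \<in> ?R\<^sup>+ `` {edge p}" using q by simp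
      qed
    qed
    have cycle_in_X: "\<exists>p \<in> passages D. e = edge p \<and> fst ` orbit (nxt D) p \<subseteq> X"
      if ee: "(e, e) \<in> ?R\<^sup>+" and inY: "?R\<^sup>+ `` {e} \<subseteq> ?Y" for e
    proof -
      have "e \<in> ?Y" using ee inY by auto
      then obtain p where p: "p \<in> passages D" "e = edge p" by auto
      have succ: "(e, edge q') \<in> ?R\<^sup>+ \<and> fst q' \<in> X"
        if q: "(e, edge q) \<in> ?R\<^sup>+" and q': "q' = nxt D q" for q q'
      proof -
        have "(edge q, e) \<in> ?R\<^sup>+" using cycle_back[OF svR ee q] ee by simp
        then obtain y where y: "(edge q, y) \<in> ?R" by (meson tranclD)
        then have y': "y = edge (turn D q')" by (simp add: Rp q')
        have ey: "(e, y) \<in> ?R\<^sup>+" using q y by (rule trancl_into_trancl)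
        then have "y \<in> ?Y" using inY by auto
        then have "fst q' \<in> X" by (auto simp: y' eY)
        then show ?thesis using ey y' vX by simp
      qed
      have "(e, edge q) \<in> ?R\<^sup>+ \<and> fst q \<in> X" if "q \<in> orbit (nxt D) p" for q
        using that
      proof (induction rule: orbit.induct)
        case base
        then show ?case using succ[of p] ee p by simp
      next
        case (step q)
        then show ?case using succ[of q] by simp
      qed
      then show ?thesis using p by auto
    qed
    show ?thesis
    proof (intro set_eqI iffI)
      fix Z assume "Z \<in> {?R\<^sup>+ `` {e} | e. (e, e) \<in> ?R\<^sup>+ \<and> ?R\<^sup>+ `` {e} \<subseteq> ?Y}"
      then obtain e where e: "Z = ?R\<^sup>+ `` {e}" "(e, e) \<in> ?R\<^sup>+" "?R\<^sup>+ `` {e} \<subseteq> ?Y" by auto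
      then obtain p where "p \<in> passages D" "e = edge p" "fst ` orbit (nxt D) p \<subseteq> X" using cycle_in_X by blast
      then show "Z \<in> image edge ` {S \<in> orbit (nxt D) ` passages D. fst ` S \<subseteq> X}"
        using reach e(1) by auto
    next
      fix Z assume "Z \<in> image edge ` {S \<in> orbit (nxt D) ` passages D. fst ` S \<subseteq> X}"
      then obtain p where p: "p \<in> passages D" "fst ` orbit (nxt D) p \<subseteq> X" "Z = edge ` orbit (nxt D) p" by auto
      have Z: "?R\<^sup>+ `` {edge p} = Z" using reach p by simp
      have "edge p \<in> Z" using permutation_diagram_orbit[OF D, of p] p by auto
      moreover have "Z \<subseteq> ?Y"
      proof -
        have "q \<in> passages D" if "q \<in> orbit (nxt D) p" for q
          using that np[OF p(1)] unfolding orbit_altdef by auto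
        then show ?thesis using p(2) unfolding p(3) by blast
      qed
      ultimately show "Z \<in> {?R\<^sup>+ `` {e} | e. (e, e) \<in> ?R\<^sup>+ \<and> ?R\<^sup>+ `` {e} \<subseteq> ?Y}"
        using Z by blast
    qed
  qed
  have "inj (image edge)" by (simp add: inj_image_eq_iff inj_def)
  then have card: "card {?R\<^sup>+ `` {e} | e. (e, e) \<in> ?R\<^sup>+ \<and> ?R\<^sup>+ `` {e} \<subseteq> ?Y} =
      card {S \<in> orbit (nxt D) ` passages D. fst ` S \<subseteq> X}"
    unfolding cycles by (simp add: card_image inj_on_subset)
  have E: "state_edges ?D U = ?E - ?Y"
    using UX by (auto simp: state_edges_def passages_erase edge_def)
  show ?thesis
    unfolding state_graph_eq E R'_eq[symmetric] erase_simps card[symmetric]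
    by (rule splice_absorb(1)[OF g YR R'_def[unfolded S_def] refl h1 h2])
qed

context kuperberg
begin

lemma bracket_erase:
  assumes D: "permutation_diagram D" and X: "X \<subseteq> crossings D" "\<forall>c \<in> X. virtual D c"
  shows "bracket f (erase X D) = bracket f D" and "writhe (erase X D) = writhe D"
proof -
  have cl: "classical (erase X D) = classical D" using X by (auto simp: classical_def)
  have sgn: "crossing_sign (erase X D) = crossing_sign D" by (simp add: crossing_sign_def fun_eq_iff)
  show "writhe (erase X D) = writhe D" by (simp add: writhe_def cl sgn)
  have "f (state_graph (erase X D) U) = f (state_graph D U)" if "U \<subseteq> classical D" for U
    using val_iso[OF f_state_graph(2) state_graph_erase[OF D X that]] f_state_graph(2)[OF _ that]
      f_state_graph(2)[OF wf_diagram_erase[OF D], of U X] permutation_diagram_wf[OF D] that cl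
    by (simp add: val_web)
  then show "bracket f (erase X D) = bracket f D"
    unfolding bracket_def cl sgn by (intro sum.cong) simp_all
qed

end


section \<open>Local relations on diagrams\<close>

text \<open>The edge of a face between two given passages, with its direction as a parameter, so
  that one statement covers all orientations of the face.\<close>

definition wire_between :: "bool \<Rightarrow> passage \<Rightarrow> passage \<Rightarrow> point gen" where
  "wire_between u p q = (if u then Wire (Out p) (In q) else Wire (Out q) (In p))"

context kuperberg
begin

lemma ev_wire_crossing_out1:
  assumes "closed ({#Wire k b, Crossing e m i j k l#} + N)"
  shows "ev ({#Wire k b, Crossing e m i j k l#} + N) = ev ({#Crossing e m i j b l#} + N)"
    and "closed ({#Crossing e m i j b l#} + N)"
proof -
  show "closed ({#Crossing e m i j b l#} + N)"
    by (rule closed_reduce[OF assms, of _ "{#k#}"]) (simp_all add: add_mset_commute)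
  have "m \<noteq> k" "i \<noteq> k" "j \<noteq> k" "l \<noteq> k"
    using closedD(1,2)[OF assms] by auto
  then show "ev ({#Wire k b, Crossing e m i j k l#} + N) = ev ({#Crossing e m i j b l#} + N)"
    using ev_wire_out[of k b "{#Crossing e m i j k l#}" N] assms by simp
qed

lemma ev_chord_swap: "ev (add_mset (chord e c p q) N) = ev (add_mset (chord e c q p) N)"
  by (rule ev_crossing_swap)

lemma closed_chord_swap: "closed (add_mset (chord e c p q) N) \<longleftrightarrow> closed (add_mset (chord e c q p) N)"
  by (simp add: closed_def add_mset_commute conj_commute conj_left_commute)

text \<open>The edges of the diagram stay and the crossing is exchanged for two straight strands.
  The right-hand net is thus that of the diagram in which the crossing has been made virtual, to be
  erased later.\<close>

lemma ev_local_kink: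
  assumes e: "e = 1 \<or> e = -1" and cl: "closed ({#Wire (Out p) (In q), chord e c p q#} + N)"
  shows "ev ({#Wire (Out p) (In q), chord e c p q#} + N) =
    A_pow (8 * e) * ev ({#Wire (Out p) (In q), wire_through p, wire_through q#} + N)"
proof -
  have cl': "closed ({#Wire (Out p) (In q), wire_through p, wire_through q#} + N)"
    by (rule closed_reduce[OF cl, of _ "{#Mid c#}"]) (simp_all add: add_mset_commute)
  have "ev ({#Wire (Out p) (In q), chord e c p q#} + N) = A_pow (8 * e) * ev ({#Wire (In p) (Out q)#} + N)"
    using ev_wire_crossing_in2[of "Out p" "In q" e "Mid c" "In p" "Out p" "Out q" N] cl
      ev_kink[OF e, of "Mid c" "In p" "Out p" "Out q" N] by simp
  moreover have "ev ({#Wire (Out p) (In q), wire_through p, wire_through q#} + N) = ev ({#Wire (In p) (Out q)#} + N)"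
    using ev_wire_wire[of "In p" "Out p" "In q" "{#wire_through q#} + N"]
      ev_wire_wire[of "In p" "In q" "Out q" N] cl' by (simp add: add_mset_commute)
  ultimately show ?thesis by simp
qed

lemma ev_two_strands:
  assumes "closed ({#Wire (Out p) (In p'), Wire (Out q) (In q'),
      wire_through p, wire_through p', wire_through q, wire_through q'#} + N)"
  shows "ev ({#Wire (Out p) (In p'), Wire (Out q) (In q'),
      wire_through p, wire_through p', wire_through q, wire_through q'#} + N) =
    ev ({#Wire (In p) (Out p'), Wire (In q) (Out q')#} + N)"
  using ev_wire_wire[of "In p" "Out p" "In p'" "{#Wire (Out q) (In q'), wire_through p', wire_through q, wire_through q'#} + N"]
    ev_wire_wire[of "In p" "In p'" "Out p'" "{#Wire (Out q) (In q'), wire_through q, wire_through q'#} + N"]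
    ev_wire_wire[of "In q" "Out q" "In q'" "{#Wire (In p) (Out p'), wire_through q'#} + N"]
    ev_wire_wire[of "In q" "In q'" "Out q'" "{#Wire (In p) (Out p')#} + N"] assms
  by (simp add: add_mset_commute)

lemma ev_local_R2_parallel:
  assumes e: "e = 1 \<or> e = -1"
    and cl: "closed ({#Wire (Out p) (In p'), Wire (Out q) (In q'), chord e c p q, chord (- e) d p' q'#} + N)"
  shows "ev ({#Wire (Out p) (In p'), Wire (Out q) (In q'), chord e c p q, chord (- e) d p' q'#} + N) =
    ev ({#Wire (Out p) (In p'), Wire (Out q) (In q'), wire_through p, wire_through p', wire_through q, wire_through q'#} + N)"
proof -
  have cl': "closed ({#Wire (Out p) (In p'), Wire (Out q) (In q'),
      wire_through p, wire_through p', wire_through q, wire_through q'#} + N)"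
    by (rule closed_reduce[OF cl, of _ "{#Mid c, Mid d#}"]) (simp_all add: add_mset_commute)
  show ?thesis
    using ev_wire_crossing_in1[of "Out p" "In p'" "- e" "Mid d" "In q'" "Out p'" "Out q'" "{#Wire (Out q) (In q'), chord e c p q#} + N"]
      ev_wire_crossing_in2[of "Out q" "In q'" "- e" "Mid d" "Out p" "Out p'" "Out q'" "{#chord e c p q#} + N"]
      ev_R2_parallel[OF e, of "Mid c" "In p" "In q" "Out p" "Out q" "Mid d" "Out p'" "Out q'" N]
      ev_two_strands[OF cl'] cl
    by (simp add: add_mset_commute)
qed

lemma ev_local_R2_antiparallel:
  assumes e: "e = 1 \<or> e = -1"
    and cl: "closed ({#Wire (Out p) (In p'), Wire (Out q) (In q'), chord e c p q', chord (- e) d p' q#} + N)"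
  shows "ev ({#Wire (Out p) (In p'), Wire (Out q) (In q'), chord e c p q', chord (- e) d p' q#} + N) =
    ev ({#Wire (Out p) (In p'), Wire (Out q) (In q'), wire_through p, wire_through p', wire_through q, wire_through q'#} + N)"
proof -
  have cl': "closed ({#Wire (Out p) (In p'), Wire (Out q) (In q'),
      wire_through p, wire_through p', wire_through q, wire_through q'#} + N)"
    by (rule closed_reduce[OF cl, of _ "{#Mid c, Mid d#}"]) (simp_all add: add_mset_commute)
  show ?thesis
    using ev_wire_crossing_in1[of "Out p" "In p'" "- e" "Mid d" "In q" "Out p'" "Out q" "{#Wire (Out q) (In q'), chord e c p q'#} + N"]
      ev_wire_crossing_in2[of "Out q" "In q'" e "Mid c" "In p" "Out p" "Out q'" "{#Crossing (- e) (Mid d) (Out p) (In q) (Out p') (Out q)#} + N"]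
      ev_R2_antiparallel[OF e, of "Mid c" "In p" "Out q" "Out p" "Out q'" "Mid d" "In q" "Out p'" N]
      ev_two_strands[OF cl'] cl
    by (simp add: add_mset_commute)
qed

text \<open>The edges are listed in the order in which they bound the bigon: equal directions mean
  that the strands run around it in the same sense and are antiparallel, different directions that
  they are parallel. The remaining cases follow by exchanging the two crossings, which negates
  \<open>e\<close>.\<close>

lemma ev_local_R2:
  assumes e: "e = 1 \<or> e = -1"
    and cl: "closed ({#wire_between u p p', wire_between v q q', chord e c p q', chord (- e) d p' q#} + N)"
  shows "ev ({#wire_between u p p', wire_between v q q', chord e c p q', chord (- e) d p' q#} + N) =
    ev ({#wire_between u p p', wire_between v q q', wire_through p, wire_through p', wire_through q, wire_through q'#} + N)"
proof -
  have e': "- e = 1 \<or> - e = -1" using e by auto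
  show ?thesis
    using ev_local_R2_antiparallel[OF e, of p p' q q' c d N] ev_local_R2_parallel[OF e, of p p' q' q c d N]
      ev_local_R2_parallel[OF e', of p' p q q' d c N] ev_local_R2_antiparallel[OF e', of p' p q' q d c N] cl
    by (cases u; cases v) (simp_all add: wire_between_def add_mset_commute)
qed

text \<open>The strand through \<open>q\<close> is just a wire, so it makes no difference whether
  the crossing sits at \<open>p\<close> or at \<open>q\<close>: both nets contract to the same
  crossing.\<close>

lemma ev_slide_chord:
  assumes cl: "closed ({#wire_between u p q, chord e c p r, wire_through q#} + N)"
  shows "ev ({#wire_between u p q, chord e c p r, wire_through q#} + N) =
    ev ({#wire_between u p q, chord e c q r, wire_through p#} + N)"
proof -
  have cl': "closed ({#wire_between u p q, chord e c q r, wire_through p#} + N)"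
    by (rule closed_reduce[OF cl, of _ "{#}"]) (simp_all add: add_mset_commute wire_between_def)
  show ?thesis
  proof (cases u)
    case True
    have "ev ({#wire_between u p q, chord e c p r, wire_through q#} + N) =
        ev ({#Crossing e (Mid c) (In p) (In r) (Out q) (Out r)#} + N)"
      using ev_wire_wire[of "Out p" "In q" "Out q" "{#chord e c p r#} + N"]
        ev_wire_crossing_out1[of "Out p" "Out q" e "Mid c" "In p" "In r" "Out r" N] cl True
      by (simp add: wire_between_def add_mset_commute)
    moreover have "ev ({#wire_between u p q, chord e c q r, wire_through p#} + N) =
        ev ({#Crossing e (Mid c) (In p) (In r) (Out q) (Out r)#} + N)"
      using ev_wire_wire[of "In p" "Out p" "In q" "{#chord e c q r#} + N"]
        ev_wire_crossing_in1[of "In p" "In q" e "Mid c" "In r" "Out q" "Out r" N] cl' True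
      by (simp add: wire_between_def add_mset_commute)
    ultimately show ?thesis by simp
  next
    case False
    have "ev ({#wire_between u p q, chord e c p r, wire_through q#} + N) =
        ev ({#Crossing e (Mid c) (In q) (In r) (Out p) (Out r)#} + N)"
      using ev_wire_wire[of "In q" "Out q" "In p" "{#chord e c p r#} + N"]
        ev_wire_crossing_in1[of "In q" "In p" e "Mid c" "In r" "Out p" "Out r" N] cl False
      by (simp add: wire_between_def add_mset_commute)
    moreover have "ev ({#wire_between u p q, chord e c q r, wire_through p#} + N) =
        ev ({#Crossing e (Mid c) (In q) (In r) (Out p) (Out r)#} + N)"
      using ev_wire_wire[of "Out q" "In p" "Out p" "{#chord e c q r#} + N"]
        ev_wire_crossing_out1[of "Out q" "Out p" e "Mid c" "In q" "In r" "Out r" N] cl' False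
      by (simp add: wire_between_def add_mset_commute)
    ultimately show ?thesis by simp
  qed
qed

text \<open>The first strand of the crossing slides along one edge of the bigon from
  \<open>p\<close> to \<open>p'\<close>, the strands are exchanged, and the other one slides from
  \<open>q'\<close> to \<open>q\<close>. The exchange is where the overpass becomes an
  underpass.\<close>

lemma ev_local_Z:
  assumes cl: "closed ({#wire_between u p p', wire_between v q q', chord e c p q', wire_through p', wire_through q#} + N)"
  shows "ev ({#wire_between u p p', wire_between v q q', chord e c p q', wire_through p', wire_through q#} + N) =
    ev ({#wire_between u p p', wire_between v q q', chord e c q p', wire_through q', wire_through p#} + N)"
proof -
  have flip: "wire_between v q q' = wire_between (\<not> v) q' q" by (simp add: wire_between_def)
  have 1: "closed ({#wire_between u p p', chord e c p q', wire_through p'#} + ({#wire_between v q q', wire_through q#} + N))"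
    using cl by (simp add: add_mset_commute)
  have "closed ({#wire_between u p p', wire_between v q q', chord e c q' p', wire_through q, wire_through p#} + N)"
    by (rule closed_reduce[OF cl, of _ "{#}"]) (simp_all add: add_mset_commute wire_between_def)
  then have 2: "closed ({#wire_between (\<not> v) q' q, chord e c q' p', wire_through q#} + ({#wire_between u p p', wire_through p#} + N))"
    by (simp add: add_mset_commute flip)
  have "ev ({#wire_between u p p', wire_between v q q', chord e c p q', wire_through p', wire_through q#} + N) =
      ev (add_mset (chord e c p' q') ({#wire_between u p p', wire_between v q q', wire_through p, wire_through q#} + N))"
    using ev_slide_chord[OF 1] by (simp add: add_mset_commute)
  also have "\<dots> = ev ({#wire_between (\<not> v) q' q, chord e c q' p', wire_through q#} + ({#wire_between u p p', wire_through p#} + N))"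
    unfolding ev_chord_swap[of e c p'] by (simp add: add_mset_commute flip)
  also have "\<dots> = ev ({#wire_between u p p', wire_between v q q', chord e c q p', wire_through q', wire_through p#} + N)"
    unfolding ev_slide_chord[OF 2] by (simp add: add_mset_commute flip)
  finally show ?thesis .
qed

text \<open>Absorbing the three edges of the triangle brings the net into the form of the lemmas on
  the third move. The flags \<open>u\<close> and \<open>v\<close> tell whether the strands
  \<open>a\<close> and \<open>b\<close> meet the top strand before or after their common
  crossing.\<close>

lemma ev_absorb_R3:
  assumes cl: "closed ({#Wire (Out t) (In t'), wire_between u a a', wire_between v b b',
      chord e m t a, chord e' m' t' b, chord h n a' b'#} + N)"
  shows "ev ({#Wire (Out t) (In t'), wire_between u a a', wire_between v b b',
      chord e m t a, chord e' m' t' b, chord h n a' b'#} + N) =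
    ev ({#Crossing h (Mid n) (if u then Out a else In a') (if v then Out b else In b') (Out a') (Out b'),
      Crossing e (Mid m) (In t) (if u then In a else Out a') (Out t) (Out a),
      Crossing e' (Mid m') (Out t) (if v then In b else Out b') (Out t') (Out b)#} + N)"
    and "closed ({#Crossing h (Mid n) (if u then Out a else In a') (if v then Out b else In b') (Out a') (Out b'),
      Crossing e (Mid m) (In t) (if u then In a else Out a') (Out t) (Out a),
      Crossing e' (Mid m') (Out t) (if v then In b else Out b') (Out t') (Out b)#} + N)"
proof -
  let ?X' = "Crossing e' (Mid m') (Out t) (In b) (Out t') (Out b)"
  let ?X = "Crossing e (Mid m) (In t) (if u then In a else Out a') (Out t) (Out a)"
  let ?N1 = "{#wire_between u a a', wire_between v b b', chord e m t a, chord h n a' b'#} + N"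
  let ?N2 = "{#?X', wire_between v b b'#} + N"
  let ?g = "Crossing h (Mid n) (if u then Out a else In a') (In b') (Out a') (Out b')"
  have 1: "closed ({#Wire (Out t) (In t'), chord e' m' t' b#} + ?N1)"
    using cl by (simp add: add_mset_commute)
  have 2: "closed ({#wire_between u a a', chord e m t a, chord h n a' b'#} + ?N2)"
    using ev_wire_crossing_in1(2)[OF 1] by (simp add: add_mset_commute)
  have a: "ev ({#wire_between u a a', chord e m t a, chord h n a' b'#} + ?N2) = ev ({#?X, ?g#} + ?N2)
      \<and> closed ({#?X, ?g#} + ?N2)"
  proof (cases u)
    case True
    have "closed ({#Wire (Out a) (In a'), chord h n a' b'#} + ({#chord e m t a#} + ?N2))"
      using 2 True by (simp add: wire_between_def add_mset_commute)
    from ev_wire_crossing_in1[OF this] show ?thesis using True by (simp add: wire_between_def add_mset_commute)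
  next
    case False
    have "closed ({#Wire (Out a') (In a), chord e m t a#} + ({#chord h n a' b'#} + ?N2))"
      using 2 False by (simp add: wire_between_def add_mset_commute)
    from ev_wire_crossing_in2[OF this] show ?thesis using False by (simp add: wire_between_def add_mset_commute)
  qed
  let ?L = "{#?X, ?g#} + ?N2"
  let ?R = "{#Crossing h (Mid n) (if u then Out a else In a') (if v then Out b else In b') (Out a') (Out b'), ?X,
      Crossing e' (Mid m') (Out t) (if v then In b else Out b') (Out t') (Out b)#} + N"
  have b: "ev ?L = ev ?R \<and> closed ?R"
  proof (cases v)
    case True
    have "closed ({#Wire (Out b) (In b'), ?g#} + ({#?X, ?X'#} + N))"
      using conjunct2[OF a] True by (simp add: wire_between_def add_mset_commute)
    from ev_wire_crossing_in2[OF this] show ?thesis using True by (simp add: wire_between_def add_mset_commute)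
  next
    case False
    have "closed ({#Wire (Out b') (In b), ?X'#} + ({#?X, ?g#} + N))"
      using conjunct2[OF a] False by (simp add: wire_between_def add_mset_commute)
    from ev_wire_crossing_in2[OF this] show ?thesis using False by (simp add: wire_between_def add_mset_commute)
  qed
  have "ev ({#Wire (Out t) (In t'), wire_between u a a', wire_between v b b',
      chord e m t a, chord e' m' t' b, chord h n a' b'#} + N) =
      ev ({#wire_between u a a', chord e m t a, chord h n a' b'#} + ?N2)"
    using ev_wire_crossing_in1(1)[OF 1] by (simp add: add_mset_commute)
  then show "ev ({#Wire (Out t) (In t'), wire_between u a a', wire_between v b b',
      chord e m t a, chord e' m' t' b, chord h n a' b'#} + N) = ev ?R"
    using conjunct1[OF a] conjunct1[OF b] by (simp only:)
  show "closed ?R" using b by (rule conjunct2)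
qed

text \<open>The two lower strands cross the top strand from the same side exactly if
  \<open>u = v\<close>, which accounts for the relation between the signs. The four directions then
  reduce to the three lemmas on nets.\<close>

lemma ev_local_R3_aux:
  assumes e: "e = 1 \<or> e = -1" and e': "e' = (if u = v then e else - e)"
    and cl: "closed ({#Wire (Out t) (In t'), wire_between u a a', wire_between v b b',
      chord e m t a, chord e' m' t' b, chord h n a' b'#} + N)"
  shows "ev ({#Wire (Out t) (In t'), wire_between u a a', wire_between v b b',
      chord e m t a, chord e' m' t' b, chord h n a' b'#} + N) =
    ev ({#Wire (Out t) (In t'), wire_between u a a', wire_between v b b',
      chord e m t' a', chord e' m' t b', chord h n a b#} + N)"
proof -
  have flip: "wire_between w q q' = wire_between (\<not> w) q' q" for w q q' by (simp add: wire_between_def)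
  let ?L = "{#Wire (Out t) (In t'), wire_between u a a', wire_between v b b',
      chord e m t a, chord e' m' t' b, chord h n a' b'#} + N"
  let ?R = "{#Wire (Out t) (In t'), wire_between u a a', wire_between v b b',
      chord e m t' a', chord e' m' t b', chord h n a b#} + N"
  \<comment> \<open>The triangle after the move has again the shape of the one before, with
    \<open>b'\<close>, \<open>b\<close>, \<open>a'\<close>, \<open>a\<close> in the place of
    \<open>a\<close>, \<open>a'\<close>, \<open>b\<close>, \<open>b'\<close>. Hence
    \<open>ev_absorb_R3\<close> also treats the right-hand side.\<close>
  let ?F = "{#Wire (Out t) (In t'), wire_between (\<not> v) b' b, wire_between (\<not> u) a' a,
      chord e' m' t b', chord e m t' a', chord h n b a#} + N"
  have clR: "closed ?R"
    by (rule closed_reduce[OF cl, of _ "{#}"]) (simp_all add: add_mset_commute wire_between_def)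
  then have "closed (add_mset (chord h n a b) ({#Wire (Out t) (In t'), wire_between u a a', wire_between v b b',
      chord e m t' a', chord e' m' t b'#} + N))"
    by (simp add: add_mset_commute)
  then have clF: "closed ?F"
    unfolding closed_chord_swap[of h n a] by (simp add: add_mset_commute flip[of u] flip[of v])
  have F: "ev ?R = ev ?F"
  proof -
    have "ev ?R = ev (add_mset (chord h n a b) ({#Wire (Out t) (In t'), wire_between u a a', wire_between v b b',
      chord e m t' a', chord e' m' t b'#} + N))"
      by (simp add: add_mset_commute)
    also have "\<dots> = ev ?F"
      unfolding ev_chord_swap[of h n a] by (simp add: add_mset_commute flip[of u] flip[of v])
    finally show ?thesis .
  qed
  note l = ev_absorb_R3[OF cl] and r = ev_absorb_R3[OF clF]
  have eR: "ev ?R = ev (add_mset (Crossing h (Mid n) (if v then In b else Out b') (if u then In a else Out a') (Out b) (Out a))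
      ({#Crossing e' (Mid m') (In t) (if v then Out b else In b') (Out t) (Out b'),
        Crossing e (Mid m) (Out t) (if u then Out a else In a') (Out t') (Out a')#} + N))"
    unfolding F r(1) by (cases u; cases v) simp_all
  have eR: "ev ?R = ev ({#Crossing h (Mid n) (if u then In a else Out a') (if v then In b else Out b') (Out a) (Out b),
      Crossing e' (Mid m') (In t) (if v then Out b else In b') (Out t) (Out b'),
      Crossing e (Mid m) (Out t) (if u then Out a else In a') (Out t') (Out a')#} + N)"
    unfolding eR ev_crossing_swap[of h "Mid n" "if v then In b else Out b'"] by (simp add: add_mset_commute)
  consider "u" "v" | "u" "\<not> v" | "\<not> u" "v" | "\<not> u" "\<not> v" by blast
  then show ?thesis
  proof cases
    case 1
    show ?thesis unfolding l(1) eR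
      using ev_R3_before_before[OF e, of h "Mid n" "Out a" "Out b" "Out a'" "Out b'" "Mid m" "In t" "In a" "Out t" "Mid m'" "In b" "Out t'" N]
        l(2) e' 1 by simp
  next
    case 2
    show ?thesis unfolding l(1) eR
      using ev_R3_before_after[OF e, of h "Mid n" "Out a" "In b'" "Out a'" "Out b'" "Mid m" "In t" "In a" "Out t" "Mid m'" "Out t'" "Out b" N]
        l(2) e' 2 by simp
  next
    case 3
    show ?thesis unfolding l(1) eR
      using ev_R3_after_before[OF e, of h "Mid n" "In a'" "Out b" "Out a'" "Out b'" "Mid m" "In t" "Out t" "Out a" "Mid m'" "In b" "Out t'" N]
        l(2) e' 3 by simp
  next
    \<comment> \<open>If both strands meet the top strand after their common crossing, this is the
      case of meeting it before, read from right to left.\<close>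
    case 4
    have "closed ({#Crossing h (Mid n) (Out b') (Out a') (Out b) (Out a), Crossing e (Mid m') (In t) (In b') (Out t) (Out b'),
        Crossing e (Mid m) (Out t) (In a') (Out t') (Out a')#} + N)"
      using r(2) e' 4 by simp
    from ev_R3_before_before[OF e this] show ?thesis unfolding l(1) F r(1)
      using e' 4 ev_crossing_swap[of h "Mid n" "In b'" "In a'" "Out b'" "Out a'"
          "{#Crossing e (Mid m) (In t) (Out a') (Out t) (Out a), Crossing e (Mid m') (Out t) (Out b') (Out t') (Out b)#} + N"]
      by (simp add: add_mset_commute)
  qed
qed

lemma ev_local_R3:
  assumes e: "e = 1 \<or> e = -1" and e': "e' = (if u = v then e else - e)"
    and cl: "closed ({#wire_between w t t', wire_between u a a', wire_between v b b',
      chord e m t a, chord e' m' t' b, chord h n a' b'#} + N)"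
  shows "ev ({#wire_between w t t', wire_between u a a', wire_between v b b',
      chord e m t a, chord e' m' t' b, chord h n a' b'#} + N) =
    ev ({#wire_between w t t', wire_between u a a', wire_between v b b',
      chord e m t' a', chord e' m' t b', chord h n a b#} + N)"
proof (cases w)
  case True
  then show ?thesis using ev_local_R3_aux[OF e e', of t t' a a' b b' m m' h n N] cl
    by (simp add: wire_between_def)
next
  \<comment> \<open>With the top strand reversed it meets \<open>b\<close> first, so the roles of
    \<open>a\<close> and \<open>b\<close> are exchanged.\<close>
  case False
  then have w: "wire_between w t t' = Wire (Out t') (In t)" by (simp add: wire_between_def)
  have f: "e' = 1 \<or> e' = -1" "e = (if v = u then e' else - e')" using e e' by auto
  let ?N = "{#wire_between w t t', wire_between u a a', wire_between v b b', chord e m t a, chord e' m' t' b#} + N"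
  have "closed (add_mset (chord h n a' b') ?N)" using cl by (simp add: add_mset_commute)
  then have cl': "closed ({#Wire (Out t') (In t), wire_between v b b', wire_between u a a',
      chord e' m' t' b, chord e m t a, chord h n b' a'#} + N)"
    unfolding closed_chord_swap[of h n a'] 
    by (simp add: add_mset_commute w)
  have "ev ({#wire_between w t t', wire_between u a a', wire_between v b b',
      chord e m t a, chord e' m' t' b, chord h n a' b'#} + N) = ev (add_mset (chord h n a' b') ?N)"
    by (simp add: add_mset_commute)
  also have "\<dots> = ev ({#Wire (Out t') (In t), wire_between v b b', wire_between u a a',
      chord e' m' t' b, chord e m t a, chord h n b' a'#} + N)"
    unfolding ev_chord_swap[of h n a'] by (simp add: add_mset_commute w)
  also have "\<dots> = ev (add_mset (chord h n b a) ({#Wire (Out t') (In t), wire_between v b b', wire_between u a a',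
      chord e' m' t b', chord e m t' a'#} + N))"
    unfolding ev_local_R3_aux[OF f cl'] by (simp add: add_mset_commute)
  also have "\<dots> = ev ({#wire_between w t t', wire_between u a a', wire_between v b b',
      chord e m t' a', chord e' m' t b', chord h n a b#} + N)"
    unfolding ev_chord_swap[of h n b] by (simp add: add_mset_commute w)
  finally show ?thesis .
qed

end


section \<open>Relabelling and conjugation\<close>

text \<open>Weaker than \<open>diagram_iso\<close>: it does not record which strand is over at a
  classical crossing, nor the position of the strands at a virtual one. By the symmetry of crossings
  this is enough for bracket and writhe.\<close>

definition sign_iso :: "(passage \<Rightarrow> passage) \<Rightarrow> vdiagram \<Rightarrow> vdiagram \<Rightarrow> bool" where
  "sign_iso h D D' \<longleftrightarrow> bij_betw h (passages D) (passages D') \<and> circles D = circles D' \<and>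
     (\<forall>p \<in> passages D. h (nxt D p) = nxt D' (h p)) \<and>
     (\<forall>c \<in> crossings D. fst (h (c, False)) = fst (h (c, True)) \<and>
        virtual D' (fst (h (c, True))) = virtual D c \<and>
        (\<not> virtual D c \<longrightarrow> positive D' (fst (h (c, True))) = positive D c))"

lemma sign_iso_diagram_iso:
  assumes h: "diagram_iso h D D'"
  shows "sign_iso h D D'"
proof -
  have c: "h (nxt D (c, b)) = nxt D' (h (c, b))" "fst (h (c, b)) = fst (h (c, True))"
    "virtual D' (fst (h (c, b))) = virtual D c" "positive D' (fst (h (c, b))) = (positive D c = snd (h (c, True)))"
    "\<not> virtual D c \<Longrightarrow> snd (h (c, b)) = b" if "c \<in> crossings D" for c b
    using h that unfolding diagram_iso_def by blast+
  have "positive D' (fst (h (c, True))) = positive D c" if "c \<in> crossings D" "\<not> virtual D c" for c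
    using c(4)[OF that(1), of True] c(5)[OF that, of True] by simp
  moreover have "\<forall>p \<in> passages D. h (nxt D p) = nxt D' (h p)"
    using c(1) by (auto simp: passages_def)
  moreover have "bij_betw h (passages D) (passages D')" "circles D = circles D'"
    using h by (auto simp: diagram_iso_def)
  ultimately show ?thesis
    using c(2)[of _ False] c(3)[of _ True] by (simp add: sign_iso_def)
qed

lemma sign_iso_cong:
  assumes "sign_iso h D1 D'" "crossings D1 = crossings D" "circles D1 = circles D" "nxt D1 = nxt D"
    "\<And>c. c \<in> crossings D \<Longrightarrow> virtual D1 c = virtual D c" "positive D1 = positive D"
  shows "sign_iso h D D'"
  using assms by (simp add: sign_iso_def passages_def)

lemma pair_of_fst_eq: "fst p = c \<Longrightarrow> fst q = c \<Longrightarrow> p \<noteq> q \<Longrightarrow> q = (c, \<not> snd p)"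
  by (cases p; cases q) auto

lemma sign_iso_crossings:
  assumes h: "sign_iso h D D'"
  defines "m \<equiv> \<lambda>c. fst (h (c, True))"
  shows "bij_betw m (crossings D) (crossings D')"
    and "bij_betw m (classical D) (classical D')"
    and "bij_betw h (virtual_passages D) (virtual_passages D')"
    and "c \<in> crossings D \<Longrightarrow> \<exists>b. h (c, True) = (m c, b) \<and> h (c, False) = (m c, \<not> b)"
proof -
  have bij: "inj_on h (passages D)" "h ` passages D = passages D'"
    using h by (auto simp: sign_iso_def bij_betw_def)
  have fst_h: "fst (h p) = m (fst p)" if "p \<in> passages D" for p
  proof -
    obtain c b where p: "p = (c, b)" by (cases p)
    then have "fst (h (c, False)) = m c" using h that by (simp add: sign_iso_def m_def passages_def)
    then show ?thesis by (cases b) (simp_all add: p m_def)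
  qed
  have v: "virtual D' (m c) = virtual D c" if "c \<in> crossings D" for c
    using h that by (simp add: sign_iso_def m_def)
  have pair: "\<exists>b. h (c, True) = (m c, b) \<and> h (c, False) = (m c, \<not> b)" if c: "c \<in> crossings D" for c
  proof -
    have "h (c, True) \<noteq> h (c, False)"
      using inj_on_eq_iff[OF bij(1), of "(c, True)" "(c, False)"] c by (simp add: passages_def)
    then have "h (c, False) = (m c, \<not> snd (h (c, True)))"
      using fst_h[of "(c, True)"] fst_h[of "(c, False)"] c by (intro pair_of_fst_eq) (auto simp: passages_def)
    then show ?thesis by (intro exI[of _ "snd (h (c, True))"]) (simp add: m_def)
  qed
  then show "c \<in> crossings D \<Longrightarrow> \<exists>b. h (c, True) = (m c, b) \<and> h (c, False) = (m c, \<not> b)" .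
  have inj: "inj_on m (crossings D)"
  proof (rule inj_onI)
    fix c d assume c: "c \<in> crossings D" and d: "d \<in> crossings D" and eq: "m c = m d"
    obtain b where b: "h (d, True) = (m d, b)" "h (d, False) = (m d, \<not> b)" using pair[OF d] by auto
    have "fst (h (c, True)) = m d" using eq by (simp add: m_def)
    then have "h (c, True) = (m d, snd (h (c, True)))" by (simp add: prod_eq_iff)
    then have "h (c, True) = h (d, True) \<or> h (c, True) = h (d, False)"
      using b by (cases "snd (h (c, True)) = b") auto
    then show "c = d"
      using inj_on_eq_iff[OF bij(1), of "(c, True)" "(d, True)"] inj_on_eq_iff[OF bij(1), of "(c, True)" "(d, False)"] c d
      by (auto simp: passages_def)
  qed
  moreover have im: "m ` crossings D = crossings D'"
  proof -
    have "m ` crossings D = fst ` h ` passages D"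
      using fst_h by (force simp: passages_def image_iff)
    also have "\<dots> = crossings D'" unfolding bij(2) by (auto simp: passages_def image_iff)
    finally show ?thesis .
  qed
  ultimately show "bij_betw m (crossings D) (crossings D')" by (simp add: bij_betw_def)
  have "m ` classical D = classical D'"
  proof -
    have "m ` classical D = {c \<in> m ` crossings D. \<not> virtual D' c}" using v by (auto simp: classical_def)
    then show ?thesis by (simp add: im classical_def)
  qed
  moreover have "inj_on m (classical D)" by (rule inj_on_subset[OF inj]) (auto simp: classical_def)
  ultimately show "bij_betw m (classical D) (classical D')" by (simp add: bij_betw_def)
  have "h ` virtual_passages D = {p \<in> h ` passages D. virtual D' (fst p)}"
    using v fst_h by (auto simp: virtual_passages_def passages_fst)
  then have "h ` virtual_passages D = virtual_passages D'" by (simp add: bij virtual_passages_def)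
  moreover have "inj_on h (virtual_passages D)"
    by (rule inj_on_subset[OF bij(1)]) (auto simp: virtual_passages_def)
  ultimately show "bij_betw h (virtual_passages D) (virtual_passages D')" by (simp add: bij_betw_def)
qed

fun map_point :: "(passage \<Rightarrow> passage) \<Rightarrow> (nat \<Rightarrow> nat) \<Rightarrow> point \<Rightarrow> point" where
  "map_point h m (In p) = In (h p)"
| "map_point h m (Out p) = Out (h p)"
| "map_point h m (Mid c) = Mid (m c)"

lemma starts_of_net:
  assumes D: "wf_diagram D"
  shows "set_mset (starts_of (net D)) \<subseteq> In ` passages D \<union> Out ` passages D \<union> Mid ` classical D"
proof
  note fin = finite_diagram[OF D]
  have sub: "virtual_passages D \<subseteq> passages D" "c \<in> classical D \<Longrightarrow> (c, b) \<in> passages D" for c b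
    by (auto simp: virtual_passages_def classical_def passages_def)
  fix l assume "l \<in># starts_of (net D)"
  then obtain g where g: "g \<in># net D" "l \<in># starts g" using in_starts_of by metis
  from g(1) fin consider p where "p \<in> passages D" "g = wire_to_next D p"
    | c where "c \<in> classical D" "g = chord_at D c"
    | p where "p \<in> virtual_passages D" "g = wire_through p"
    unfolding net_def by auto
  then show "l \<in> In ` passages D \<union> Out ` passages D \<union> Mid ` classical D"
  proof cases
    case 1
    then show ?thesis using wf_diagram_nxt(1)[OF D, of p] g(2) by simp
  next
    case 2
    then show ?thesis using sub(2)[of c] g(2) by auto
  next
    case 3
    then show ?thesis using sub(1) g(2) by auto
  qed
qed

context kuperberg
begin

text \<open>\<open>h\<close> need not respect the pairs of passages at a crossing. A renamed
  crossing may thus sit at passages of two different crossings, as happens for conjugated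
  diagrams.\<close>

lemma ev_net_map:
  assumes D: "wf_diagram D" and h: "inj_on h (passages D)" and m: "inj_on m (classical D)"
  shows "ev (net D) = ev (image_mset (\<lambda>p. Wire (Out (h p)) (In (h (nxt D p)))) (mset_set (passages D)) +
    image_mset (\<lambda>c. chord (crossing_sign D c) (m c) (h (c, True)) (h (c, False))) (mset_set (classical D)) +
    image_mset (\<lambda>p. wire_through (h p)) (mset_set (virtual_passages D)))"
proof -
  have "inj_on (map_point h m) (In ` passages D \<union> Out ` passages D \<union> Mid ` classical D)"
    using inj_on_eq_iff[OF h] inj_on_eq_iff[OF m] by (intro inj_onI) auto
  then have "inj_on (map_point h m) (set_mset (starts_of (net D)))"
    by (rule inj_on_subset) (rule starts_of_net[OF D])
  from ev_rename[OF closed_net[OF D] this, symmetric] show ?thesis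
    unfolding net_def image_mset_union multiset.map_comp comp_def by simp
qed

text \<open>A relabelling may interchange the names of the two strands at some crossings; by
  symmetry each such chord can be put back in its standard order.\<close>

lemma ev_chords_swap:
  assumes "finite C" "inj_on m C"
    "\<And>c. c \<in> C \<Longrightarrow> \<exists>b. h (c, True) = (m c, b) \<and> h (c, False) = (m c, \<not> b)"
    "\<And>c. c \<in> C \<Longrightarrow> s c = s' (m c)"
  shows "ev (image_mset (\<lambda>c. chord (s c) (m c) (h (c, True)) (h (c, False))) (mset_set C) + N) =
    ev (image_mset (\<lambda>c. chord (s' c) c (c, True) (c, False)) (mset_set (m ` C)) + N)"
  using assms
proof (induction C arbitrary: N rule: finite_induct)
  case (insert c C)
  let ?A = "image_mset (\<lambda>c. chord (s c) (m c) (h (c, True)) (h (c, False))) (mset_set C)"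
  let ?B = "image_mset (\<lambda>c. chord (s' c) c (c, True) (c, False)) (mset_set (m ` C))"
  have IH: "ev (?A + N) = ev (?B + N)" for N using insert by (intro insert.IH) auto
  obtain b where b: "h (c, True) = (m c, b)" "h (c, False) = (m c, \<not> b)" using insert.prems(2)[of c] by auto
  have s: "s c = s' (m c)" using insert.prems by simp
  have "ev (add_mset (chord (s c) (m c) (h (c, True)) (h (c, False))) (?A + N)) =
      ev (add_mset (chord (s' (m c)) (m c) (m c, True) (m c, False)) (?A + N))"
    unfolding b s using ev_chord_swap by (cases b) auto
  also have "\<dots> = ev (add_mset (chord (s' (m c)) (m c) (m c, True) (m c, False)) (?B + N))"
    using IH[of "add_mset (chord (s' (m c)) (m c) (m c, True) (m c, False)) N"] by simp
  moreover have "m c \<notin> m ` C" using insert by auto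
  ultimately show ?case using insert by simp
qed simp

lemma bracket_sign_iso:
  assumes D: "wf_diagram D" and D': "wf_diagram D'" and h: "sign_iso h D D'"
  shows "bracket f D = bracket f D'" and "writhe D = writhe D'"
proof -
  define m where "m c = fst (h (c, True))" for c
  note iso = sign_iso_crossings[OF h, folded m_def]
  have n: "h (nxt D p) = nxt D' (h p)" if "p \<in> passages D" for p
    using h that by (simp add: sign_iso_def)
  have bij: "bij_betw h (passages D) (passages D')" and circ: "circles D = circles D'"
    using h by (auto simp: sign_iso_def)
  have s: "crossing_sign D c = crossing_sign D' (m c)" if "c \<in> classical D" for c
    using h that by (simp add: sign_iso_def classical_def crossing_sign_def m_def)
  have im: "image_mset k (mset_set (g ` A)) = image_mset (\<lambda>x. k (g x)) (mset_set A)"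
    if "inj_on g A" for k :: "'x \<Rightarrow> 'y" and g :: "'z \<Rightarrow> 'x" and A
    by (simp add: image_mset_inj[OF that, symmetric] multiset.map_comp comp_def)
  let ?W = "image_mset (\<lambda>p. Wire (Out (h p)) (In (h (nxt D p)))) (mset_set (passages D))"
  let ?T = "image_mset (\<lambda>p. wire_through (h p)) (mset_set (virtual_passages D))"
  have "?W = image_mset (\<lambda>p. wire_to_next D' (h p)) (mset_set (passages D))"
    using n finite_diagram[OF D] by (intro image_mset_cong) simp
  also have "\<dots> = image_mset (wire_to_next D') (mset_set (passages D'))"
    using im[of h "passages D" "wire_to_next D'"] bij by (simp add: bij_betw_def)
  finally have W: "?W = image_mset (wire_to_next D') (mset_set (passages D'))" .
  have T: "?T = image_mset wire_through (mset_set (virtual_passages D'))"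
    using im[of h "virtual_passages D" wire_through] iso(3) by (simp add: bij_betw_def)
  have inj: "inj_on h (passages D)" "inj_on m (classical D)" and cl: "m ` classical D = classical D'"
    using bij iso(2) by (auto simp: bij_betw_def)
  have "ev (net D) = ev (image_mset (\<lambda>c. chord (crossing_sign D c) (m c) (h (c, True)) (h (c, False))) (mset_set (classical D)) + (?W + ?T))"
    by (simp add: ev_net_map[OF D inj] ac_simps)
  also have "\<dots> = ev (image_mset (chord_at D') (mset_set (m ` classical D)) + (?W + ?T))"
    by (rule ev_chords_swap) (use finite_diagram[OF D] inj iso(4) s in \<open>auto simp: classical_def\<close>)
  also have "\<dots> = ev (net D')" by (simp add: W T cl net_def ac_simps)
  finally show "bracket f D = bracket f D'" by (simp add: bracket_net D D' circ)
  show "writhe D = writhe D'"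
    using sum.reindex_bij_betw[OF iso(2), of "crossing_sign D'"] s by (simp add: writhe_def)
qed

text \<open>
  Removing classical crossings amounts to making them virtual first, which replaces each by two wires.
\<close>

lemma bracket_erase_classical:
  assumes D: "permutation_diagram D" and X: "X \<subseteq> classical D"
  shows "bracket f (erase X D) = circle_value ^ circles D *
      ev (image_mset (wire_to_next D) (mset_set (passages D)) +
        image_mset (chord_at D) (mset_set (classical D - X)) +
        image_mset wire_through (mset_set (virtual_passages D)) +
        image_mset wire_through (mset_set (X \<times> UNIV)))"
    and "writhe (erase X D) = writhe D - (\<Sum>c\<in>X. crossing_sign D c)"
proof -
  define Dv where "Dv = D\<lparr>virtual := \<lambda>c. c \<in> X \<or> virtual D c\<rparr>"
  have s: "crossings Dv = crossings D" "passages Dv = passages D" "nxt Dv = nxt D" "circles Dv = circles D"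
    "positive Dv = positive D" "virtual Dv = (\<lambda>c. c \<in> X \<or> virtual D c)"
    by (simp_all add: Dv_def passages_def)
  have p: "permutation_diagram Dv" using D by (simp add: permutation_diagram_def s)
  note wf = permutation_diagram_wf[OF D]
  have fin: "finite (classical D)" "finite (virtual_passages D)" "finite X"
    using finite_diagram[OF wf] X finite_subset by auto
  have cl: "classical Dv = classical D - X" by (auto simp: classical_def s)
  have vp: "virtual_passages Dv = virtual_passages D \<union> X \<times> UNIV" "virtual_passages D \<inter> X \<times> UNIV = {}"
    using X by (auto simp: virtual_passages_def s passages_def classical_def)
  have sign: "crossing_sign Dv = crossing_sign D" by (simp add: crossing_sign_def s fun_eq_iff)
  \<comment> \<open>\<open>erase X D\<close> and \<open>erase X Dv\<close> differ only in the flags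
    of crossings that are no longer present.\<close>
  have "sign_iso id (erase X Dv) (erase X Dv)"
    by (simp add: sign_iso_def)
  then have "sign_iso id (erase X D) (erase X Dv)"
    by (rule sign_iso_cong[of _ "erase X Dv"]) (auto simp: s erase_def)
  note iso = bracket_sign_iso[OF wf_diagram_erase[OF D] wf_diagram_erase[OF p] this]
  have X': "X \<subseteq> crossings Dv" "\<forall>c \<in> X. virtual Dv c" using X by (auto simp: s classical_def)
  note er = bracket_erase[OF p X']
  show "bracket f (erase X D) = circle_value ^ circles D *
      ev (image_mset (wire_to_next D) (mset_set (passages D)) +
        image_mset (chord_at D) (mset_set (classical D - X)) +
        image_mset wire_through (mset_set (virtual_passages D)) +
        image_mset wire_through (mset_set (X \<times> UNIV)))"
    unfolding iso(1) er(1) bracket_net[OF permutation_diagram_wf[OF p]]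
    using fin vp(2) by (simp add: net_def s cl vp(1) sign mset_set_Union ac_simps)
  show "writhe (erase X D) = writhe D - (\<Sum>c\<in>X. crossing_sign D c)"
    unfolding iso(2) er(2) using fin X sum.subset_diff[OF X fin(1), of "crossing_sign D"] by (simp add: writhe_def cl sign)
qed

text \<open>Relabelling the new diagram by the involution \<open>s\<close> restores the old edges
  and moves the crossings to the passages given by \<open>s\<close>. A move that interchanges
  passages thereby becomes a change of crossings over fixed edges.\<close>

lemma ev_net_conjugate:
  assumes D: "wf_diagram D" and s: "s permutes passages D" "\<And>p. s (s p) = p"
  defines "D' \<equiv> D\<lparr>nxt := s \<circ> nxt D \<circ> s\<rparr>"
  shows "wf_diagram D'"
    and "ev (net D') = ev (image_mset (wire_to_next D) (mset_set (passages D)) +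
      image_mset (\<lambda>c. chord (crossing_sign D c) c (s (c, True)) (s (c, False))) (mset_set (classical D)) +
      image_mset (\<lambda>p. wire_through (s p)) (mset_set (virtual_passages D)))"
    and "writhe D' = writhe D" and "circles D' = circles D"
proof -
  have eq: "crossings D' = crossings D" "passages D' = passages D" "classical D' = classical D"
    "virtual_passages D' = virtual_passages D" "crossing_sign D' = crossing_sign D"
    "nxt D' = s \<circ> nxt D \<circ> s"
    by (simp_all add: D'_def passages_def classical_def virtual_passages_def crossing_sign_def fun_eq_iff)
  have n: "bij_betw (nxt D) (passages D) (passages D)" using D by (simp add: wf_diagram_def)
  note bij_s = permutes_imp_bij[OF s(1)]
  have "bij_betw (s \<circ> nxt D \<circ> s) (passages D) (passages D)"
    by (rule bij_betw_trans[OF bij_s bij_betw_trans[OF n bij_s]])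
  then show wf: "wf_diagram D'"
    using D by (simp add: wf_diagram_def eq)
  have "inj_on s (passages D')" "inj_on id (classical D')"
    using permutes_inj_on[OF s(1)] by auto
  note ev = ev_net_map[OF wf this]
  have "image_mset (\<lambda>p. Wire (Out (s p)) (In (s (nxt D' p)))) (mset_set (passages D)) =
      image_mset (wire_to_next D) (image_mset s (mset_set (passages D)))"
    by (simp add: eq s(2) multiset.map_comp comp_def)
  also have "image_mset s (mset_set (passages D)) = mset_set (passages D)"
    using permutes_image[OF s(1)] image_mset_inj[OF permutes_inj_on[OF s(1)], of "passages D"] by simp
  finally show "ev (net D') = ev (image_mset (wire_to_next D) (mset_set (passages D)) +
      image_mset (\<lambda>c. chord (crossing_sign D c) c (s (c, True)) (s (c, False))) (mset_set (classical D)) +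
      image_mset (\<lambda>p. wire_through (s p)) (mset_set (virtual_passages D)))"
    using ev by (simp add: eq(2-5))
  show "writhe D' = writhe D" by (simp add: writhe_def eq)
  show "circles D' = circles D" by (simp add: D'_def)
qed

end


section \<open>Invariance under the moves\<close>

text \<open>An edge is named by the passage that it leaves, which is at the far end when the dart is
  an incoming one.\<close>

definition side :: "vdiagram \<Rightarrow> dart \<Rightarrow> passage" where
  "side D x = (if snd x then fst x else fst (opp D x))"

lemma side_cases: "side D x = fst x \<or> side D x = fst (opp D x)"
  by (simp add: side_def)

lemma dart_wire:
  assumes D: "permutation_diagram D" and x: "x \<in> darts D"
  shows "side D x \<in> passages D" "fst (opp D x) \<in> passages D"
    "wire_to_next D (side D x) = wire_between (snd x) (fst x) (fst (opp D x))"
proof -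
  obtain p o' where po: "x = (p, o')" and p: "p \<in> passages D" using x by (cases x) (simp add: darts_def)
  have n: "nxt D permutes passages D" using D by (simp add: permutation_diagram_def)
  have "nxt D p \<in> passages D" "inv (nxt D) p \<in> passages D" "nxt D (inv (nxt D) p) = p"
    using p permutes_in_image[OF n] permutes_in_image[OF permutes_inv[OF n]] permutes_inverses(1)[OF n] by auto
  then show "side D x \<in> passages D" "fst (opp D x) \<in> passages D"
    "wire_to_next D (side D x) = wire_between (snd x) (fst x) (fst (opp D x))"
    using p by (simp_all add: side_def po opp_def wire_between_def)
qed

lemma snd_opp: "snd (opp D x) = (\<not> snd x)"
  by (simp add: opp_def split: prod.split)

text \<open>This extracts the planar geometry used by the moves: a face is continued on the other
  strand of the far crossing, in a direction fixed by the sign there. Going once around a bigon or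
  triangle yields relations between signs and directions.\<close>

lemma face_step_eq:
  assumes "face_step D x = y"
  shows "fst y = (fst (fst (opp D x)), \<not> snd (fst (opp D x)))"
    and "snd y \<longleftrightarrow> snd x \<noteq> (snd (fst (opp D x)) = positive D (fst (fst (opp D x))))"
  using assms snd_opp[of D x] by (auto simp: face_step_def rot_def split: prod.splits if_splits)

lemma face_step_darts:
  assumes "permutation_diagram D" "x \<in> darts D"
  shows "face_step D x \<in> darts D"
  using dart_wire(2)[OF assms] face_step_eq(1)[of D x] by (cases "face_step D x") (auto simp: darts_def passages_fst)

lemma mset_set_split:
  assumes "finite A" "B \<subseteq> A"
  shows "image_mset k (mset_set A) = image_mset k (mset_set B) + image_mset k (mset_set (A - B))"
proof -
  have "mset_set (B \<union> (A - B)) = mset_set B + mset_set (A - B)"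
    using assms finite_subset by (intro mset_set_Union) auto
  moreover have "B \<union> (A - B) = A" using assms by auto
  ultimately show ?thesis by simp
qed

lemma crossing_sign_cases: "crossing_sign D c = 1 \<or> crossing_sign D c = -1"
  by (simp add: crossing_sign_def)

context kuperberg
begin

lemma chord_level:
  "ev (add_mset (chord e c (c, True) (c, False)) N) = ev (add_mset (chord e c (c, b) (c, \<not> b)) N)"
  "closed (add_mset (chord e c (c, True) (c, False)) N) \<longleftrightarrow> closed (add_mset (chord e c (c, b) (c, \<not> b)) N)"
  using ev_chord_swap closed_chord_swap by (cases b; simp)+

lemma normalized_bracket_isotopic:
  assumes "wf_diagram D" "wf_diagram D'" "isotopic D D'"
  shows "normalized_bracket f D = normalized_bracket f D'"
proof -
  obtain h where "diagram_iso h D D'" using assms(3) unfolding isotopic_def by blast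
  from bracket_sign_iso[OF assms(1,2) sign_iso_diagram_iso[OF this]] show ?thesis
    by (simp only: normalized_bracket_def)
qed

text \<open>Erasing the virtual arcs preserves bracket and writhe of each diagram, and what remains
  of the two diagrams is isotopic.\<close>

lemma normalized_bracket_detour:
  assumes D: "permutation_diagram D" and D': "permutation_diagram D'" and d: "detour D D'"
  shows "normalized_bracket f D = normalized_bracket f D'"
proof -
  obtain X X' e h where X: "virtual_arc D X e" "virtual_arc D' X' (map_option h e)"
    and iso: "diagram_iso h (erase X D) (erase X' D')"
    using d unfolding detour_def by blast
  have v: "X \<subseteq> crossings D" "\<forall>c\<in>X. virtual D c" "X' \<subseteq> crossings D'" "\<forall>c\<in>X'. virtual D' c"
    using X unfolding virtual_arc_def by auto
  have "isotopic (erase X D) (erase X' D')" using iso unfolding isotopic_def by blast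
  from normalized_bracket_isotopic[OF wf_diagram_erase[OF D] wf_diagram_erase[OF D'] this]
  show ?thesis
    using bracket_erase[OF D v(1,2)] bracket_erase[OF D' v(3,4)] by (simp add: normalized_bracket_def)
qed

lemma normalized_bracket_R1:
  assumes D: "permutation_diagram D" and D': "permutation_diagram D'" and r: "reidemeister1 D D'"
  shows "normalized_bracket f D = normalized_bracket f D'"
proof -
  obtain x where x: "x \<in> darts D" "face_step D x = x" "cr x \<in> classical D" and iso: "isotopic (erase {cr x} D) D'"
    using r unfolding reidemeister1_def by blast
  define c p q where "c = cr x" and "p = side D x" and "q = nxt D (side D x)"
  note wf = permutation_diagram_wf[OF D]
  note fin = finite_diagram[OF wf]
  have wire: "wire_to_next D p = wire_between (snd x) (fst x) (fst (opp D x))" "p \<in> passages D"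
    using dart_wire[OF D x(1)] by (simp_all add: p_def)
  \<comment> \<open>A dart fixed by the face step lies on an edge that returns to its own crossing
    on the other strand.\<close>
  have "fst (opp D x) = (c, \<not> snd (fst x))" using face_step_eq(1)[OF x(2)] by (cases "fst (opp D x)") (auto simp: c_def cr_def)
  then obtain b where b: "p = (c, b)" "q = (c, \<not> b)"
    using wire(1) by (cases "snd x"; cases "fst x") (auto simp: wire_between_def q_def p_def[symmetric] c_def cr_def)
  define N where "N = image_mset (wire_to_next D) (mset_set (passages D - {p})) +
    image_mset (chord_at D) (mset_set (classical D - {c})) + image_mset wire_through (mset_set (virtual_passages D))"
  let ?e = "crossing_sign D c"
  have c: "{c} \<subseteq> classical D" using x(3) by (simp add: c_def)
  have W: "image_mset (wire_to_next D) (mset_set (passages D)) =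
      {#Wire (Out p) (In q)#} + image_mset (wire_to_next D) (mset_set (passages D - {p}))"
    using mset_set_split[of "passages D" "{p}" "wire_to_next D"] fin wire(2) by (simp add: q_def p_def)
  have net: "net D = add_mset (chord ?e c (c, True) (c, False)) ({#Wire (Out p) (In q)#} + N)"
    using mset_set_split[OF fin(3) c, of "chord_at D"] by (simp add: net_def W N_def ac_simps)
  have cl: "closed ({#Wire (Out p) (In q), chord ?e c p q#} + N)"
    using closed_net[OF wf] unfolding net chord_level(2)[of _ _ _ b] b by (simp add: add_mset_commute)
  have "ev (net D) = ev ({#Wire (Out p) (In q), chord ?e c p q#} + N)"
    unfolding net chord_level(1)[of _ _ _ b] b by (simp add: add_mset_commute)
  also have "\<dots> = A_pow (8 * ?e) * ev ({#Wire (Out p) (In q), wire_through p, wire_through q#} + N)"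
    by (rule ev_local_kink[OF crossing_sign_cases cl])
  also have "{#Wire (Out p) (In q), wire_through p, wire_through q#} + N =
      image_mset (wire_to_next D) (mset_set (passages D)) + image_mset (chord_at D) (mset_set (classical D - {c})) +
      image_mset wire_through (mset_set (virtual_passages D)) + image_mset wire_through (mset_set ({c} \<times> UNIV))"
  proof -
    have "{c} \<times> (UNIV :: bool set) = {p, q}" "p \<noteq> q" using b by (auto simp: UNIV_bool)
    then show ?thesis by (simp add: W N_def ac_simps add_mset_commute)
  qed
  finally have "bracket f D = A_pow (8 * ?e) * bracket f (erase {c} D)"
    by (simp add: bracket_net[OF wf] bracket_erase_classical(1)[OF D c] ac_simps)
  moreover have "writhe (erase {c} D) = writhe D - ?e"
    using bracket_erase_classical(2)[OF D c] by simp
  ultimately have "normalized_bracket f D = normalized_bracket f (erase {c} D)"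
    by (simp add: normalized_bracket_def A_pow_mult_left)
  then show ?thesis
    using normalized_bracket_isotopic[OF wf_diagram_erase[OF D] permutation_diagram_wf[OF D'] iso] by (simp add: c_def)
qed

lemma normalized_bracket_R2:
  assumes D: "permutation_diagram D" and D': "permutation_diagram D'" and r: "reidemeister2 D D'"
  shows "normalized_bracket f D = normalized_bracket f D'"
proof -
  obtain x y where x: "x \<in> darts D" "face_step D x = y" "face_step D y = x" "cr x \<noteq> cr y"
    and c: "{cr x, cr y} \<subseteq> classical D" and over: "over x = over (opp D x)"
    and iso: "isotopic (erase {cr x, cr y} D) D'"
    using r unfolding reidemeister2_def bigon_face_def by blast
  define cx cy where "cx = cr x" and "cy = cr y"
  define b where "b = over x"
  note wf = permutation_diagram_wf[OF D]
  note fin = finite_diagram[OF wf]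
  have y: "y \<in> darts D" using face_step_darts[OF D x(1)] x(2) by simp
  have p: "fst x = (cx, b)" "fst (opp D x) = (cy, b)" "fst y = (cy, \<not> b)" "fst (opp D y) = (cx, \<not> b)"
    using face_step_eq(1)[OF x(2)] face_step_eq(1)[OF x(3)] over
    by (auto simp: prod_eq_iff cx_def cy_def b_def cr_def over_def)
  \<comment> \<open>The direction flags cancel in the two face steps around the bigon. As the edge
    of \<open>x\<close> is on one level at both ends, opposite signs remain.\<close>
  have pos: "positive D cy = (\<not> positive D cx)"
    using face_step_eq(2)[OF x(2)] face_step_eq(2)[OF x(3)] p by auto
  let ?p = "(cx, b)" and ?p' = "(cy, b)" and ?q = "(cy, \<not> b)" and ?q' = "(cx, \<not> b)"
  let ?u = "wire_between (snd x) ?p ?p'" and ?v = "wire_between (snd y) ?q ?q'"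
  let ?e = "crossing_sign D cx"
  have e: "crossing_sign D cy = - ?e" using pos by (simp add: crossing_sign_def)
  have ne: "cx \<noteq> cy" using x(4) by (simp add: cx_def cy_def)
  let ?S = "{side D x, side D y}" and ?X = "{cx, cy}"
  have S: "side D x \<noteq> side D y" using side_cases[of D x] side_cases[of D y] p by auto
  have sub: "?S \<subseteq> passages D" "?X \<subseteq> classical D"
    using dart_wire(1)[OF D x(1)] dart_wire(1)[OF D y] c by (auto simp: cx_def cy_def)
  define N where "N = image_mset (wire_to_next D) (mset_set (passages D - ?S)) +
    image_mset (chord_at D) (mset_set (classical D - ?X)) + image_mset wire_through (mset_set (virtual_passages D))"
  have W: "image_mset (wire_to_next D) (mset_set (passages D)) =
      {#?u, ?v#} + image_mset (wire_to_next D) (mset_set (passages D - ?S))"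
    using mset_set_split[OF fin(2) sub(1), of "wire_to_next D"] S
      dart_wire(3)[OF D x(1)] dart_wire(3)[OF D y] p by simp
  have net: "net D = add_mset (chord ?e cx (cx, True) (cx, False))
      ({#?u, ?v, chord (- ?e) cy (cy, True) (cy, False)#} + N)"
    using mset_set_split[OF fin(3) sub(2), of "chord_at D"] ne e by (simp add: net_def W N_def ac_simps)
  \<comment> \<open>Brings the second chord to the front, so that its strands can be reordered by
    level as well.\<close>
  have lv: "add_mset A ({#B, C, E#} + N) = add_mset E ({#B, C, A#} + N)" for A B C E :: "point gen"
    by (simp add: add_mset_commute)
  have cl: "closed ({#?u, ?v, chord ?e cx ?p ?q', chord (- ?e) cy ?p' ?q#} + N)"
    using closed_net[OF wf] unfolding net chord_level(2)[of _ cx _ b]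
    unfolding lv chord_level(2)[of _ cy _ b] by (simp add: add_mset_commute)
  have "ev (net D) = ev ({#?u, ?v, chord ?e cx ?p ?q', chord (- ?e) cy ?p' ?q#} + N)"
    unfolding net chord_level(1)[of _ cx _ b]
    unfolding lv chord_level(1)[of _ cy _ b] by (simp add: add_mset_commute)
  also have "\<dots> = ev ({#?u, ?v, wire_through ?p, wire_through ?p', wire_through ?q, wire_through ?q'#} + N)"
    by (rule ev_local_R2[OF crossing_sign_cases cl])
  also have "{#?u, ?v, wire_through ?p, wire_through ?p', wire_through ?q, wire_through ?q'#} + N =
      image_mset (wire_to_next D) (mset_set (passages D)) + image_mset (chord_at D) (mset_set (classical D - ?X)) +
      image_mset wire_through (mset_set (virtual_passages D)) + image_mset wire_through (mset_set (?X \<times> UNIV))"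
  proof -
    have "?X \<times> (UNIV :: bool set) = {?p, ?p', ?q, ?q'}" by (auto simp: UNIV_bool)
    then show ?thesis using ne by (simp add: W N_def ac_simps add_mset_commute)
  qed
  finally have "bracket f D = bracket f (erase ?X D)"
    by (simp add: bracket_net[OF wf] bracket_erase_classical(1)[OF D sub(2)])
  moreover have "writhe (erase ?X D) = writhe D"
    using bracket_erase_classical(2)[OF D sub(2)] ne e by simp
  ultimately have "normalized_bracket f D = normalized_bracket f (erase ?X D)"
    by (simp add: normalized_bracket_def)
  then show ?thesis
    using normalized_bracket_isotopic[OF wf_diagram_erase[OF D] permutation_diagram_wf[OF D'] iso]
    by (simp add: cx_def cy_def)
qed

text \<open>Common end of the third move and the Z-move: conjugation keeps writhe and circles, so
  the two brackets agree as soon as moving the crossings by \<open>s\<close> over the fixed edges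
  keeps the value of the net.\<close>

lemma normalized_bracket_conjugate:
  assumes D: "permutation_diagram D" and D': "permutation_diagram D'"
    and s: "s permutes passages D" "\<And>p. s (s p) = p" and iso: "isotopic (D\<lparr>nxt := s \<circ> nxt D \<circ> s\<rparr>) D'"
    and ev: "ev (net D) = ev (image_mset (wire_to_next D) (mset_set (passages D)) +
      image_mset (\<lambda>c. chord (crossing_sign D c) c (s (c, True)) (s (c, False))) (mset_set (classical D)) +
      image_mset (\<lambda>p. wire_through (s p)) (mset_set (virtual_passages D)))"
  shows "normalized_bracket f D = normalized_bracket f D'"
proof -
  note wf = permutation_diagram_wf[OF D]
  note c = ev_net_conjugate[OF wf s]
  have "normalized_bracket f D = normalized_bracket f (D\<lparr>nxt := s \<circ> nxt D \<circ> s\<rparr>)"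
    unfolding normalized_bracket_def bracket_net[OF wf] bracket_net[OF c(1)] c(2-4) ev ..
  then show ?thesis
    using normalized_bracket_isotopic[OF c(1) permutation_diagram_wf[OF D'] iso] by simp
qed

lemma normalized_bracket_R3:
  assumes D: "permutation_diagram D" and D': "permutation_diagram D'" and r: "reidemeister3 D D'"
  shows "normalized_bracket f D = normalized_bracket f D'"
proof -
  obtain x y z where x: "x \<in> darts D" "face_step D x = y" "face_step D y = z" "face_step D z = x"
    and dist: "distinct [cr x, cr y, cr z]" and c: "{cr x, cr y, cr z} \<subseteq> classical D"
    and over: "over x" "over (opp D x)"
    and iso: "isotopic (D\<lparr>nxt := (swap_edge D x \<circ> swap_edge D y \<circ> swap_edge D z) \<circ> nxt D \<circ>
      (swap_edge D x \<circ> swap_edge D y \<circ> swap_edge D z)\<rparr>) D'"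
    using r unfolding reidemeister3_def Let_def by blast
  define s where "s = swap_edge D x \<circ> swap_edge D y \<circ> swap_edge D z"
  define cx cy cz b where "cx = cr x" and "cy = cr y" and "cz = cr z" and "b = over z"
  note wf = permutation_diagram_wf[OF D]
  note fin = finite_diagram[OF wf]
  have y: "y \<in> darts D" using face_step_darts[OF D x(1)] x(2) by simp
  have z: "z \<in> darts D" using face_step_darts[OF D y] x(3) by simp
  note f = face_step_eq(1)[OF x(2)] face_step_eq(1)[OF x(3)] face_step_eq(1)[OF x(4)]
  have p: "fst x = (cx, True)" "fst (opp D x) = (cy, True)" "fst y = (cy, False)" "fst (opp D y) = (cz, \<not> b)"
    "fst z = (cz, b)" "fst (opp D z) = (cx, False)"
    using f over by (auto simp: prod_eq_iff cx_def cy_def cz_def b_def cr_def over_def)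
  \<comment> \<open>Comes from the face steps that arrive at \<open>cy\<close> and at
    \<open>cx\<close>. The edge of \<open>z\<close> is read from its far end, from \<open>cx\<close>
    to \<open>cz\<close>, which is why its direction appears negated.\<close>
  have e: "crossing_sign D cy =
      (if (\<not> snd z) = snd y then crossing_sign D cx else - crossing_sign D cx)"
    using face_step_eq(2)[OF x(2)] face_step_eq(2)[OF x(4)] p by (auto simp: crossing_sign_def)
  have ne: "cx \<noteq> cy" "cy \<noteq> cz" "cx \<noteq> cz" using dist by (auto simp: cx_def cy_def cz_def)
  let ?X = "{cx, cy, cz}"
  have X: "?X \<subseteq> classical D" using c by (simp add: cx_def cy_def cz_def)
  then have pas: "(k, b') \<in> passages D" if "k \<in> ?X" for k b' using that by (auto simp: passages_def classical_def)
  have s_eq: "s = Transposition.transpose (cx, True) (cy, True) \<circ>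
      Transposition.transpose (cy, False) (cz, \<not> b) \<circ> Transposition.transpose (cz, b) (cx, False)"
    by (simp add: s_def swap_edge_def p)
  have s: "s (cx, True) = (cy, True)" "s (cy, True) = (cx, True)" "s (cy, False) = (cz, \<not> b)"
    "s (cz, \<not> b) = (cy, False)" "s (cz, b) = (cx, False)" "s (cx, False) = (cz, b)"
    using ne by (auto simp: s_eq transpose_def)
  have s_out: "s q = q" if "fst q \<notin> ?X" for q
    using that by (auto simp: s_eq transpose_def)
  have s_inv: "s (s q) = q" for q
  proof (cases "fst q \<in> ?X")
    case True
    then consider "q = (cx, True)" | "q = (cx, False)" | "q = (cy, True)" | "q = (cy, False)" | "q = (cz, b)" | "q = (cz, \<not> b)"
      by (cases q) auto
    then show ?thesis by cases (simp_all add: s)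
  qed (simp add: s_out)
  have perm: "s permutes passages D"
    unfolding s_eq using pas by (intro permutes_compose permutes_swap_id) auto
  let ?S = "{side D x, side D y, side D z}"
  let ?u = "wire_between (snd x) (cx, True) (cy, True)"
  let ?v = "wire_between (\<not> snd z) (cx, False) (cz, b)"
  let ?w = "wire_between (snd y) (cy, False) (cz, \<not> b)"
  have S: "distinct [side D x, side D y, side D z]"
    using side_cases[of D x] side_cases[of D y] side_cases[of D z] ne unfolding p by auto
  have sub: "?S \<subseteq> passages D"
    using dart_wire(1)[OF D x(1)] dart_wire(1)[OF D y] dart_wire(1)[OF D z] by auto
  define N where "N = image_mset (wire_to_next D) (mset_set (passages D - ?S)) +
    image_mset (chord_at D) (mset_set (classical D - ?X)) + image_mset wire_through (mset_set (virtual_passages D))"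
  have flip: "wire_between (snd z) (cz, b) (cx, False) = ?v" by (simp add: wire_between_def)
  have W: "image_mset (wire_to_next D) (mset_set (passages D)) =
      {#?u, ?v, ?w#} + image_mset (wire_to_next D) (mset_set (passages D - ?S))"
    using mset_set_split[OF fin(2) sub, of "wire_to_next D"] S
      dart_wire(3)[OF D x(1)] dart_wire(3)[OF D y] dart_wire(3)[OF D z] p flip by (simp add: add_mset_commute)
  let ?s = "crossing_sign D"
  let ?M = "{#?u, ?v, ?w, chord (?s cx) cx (cx, True) (cx, False), chord (?s cy) cy (cy, True) (cy, False)#} + N"
  let ?K = "{#?u, ?v, ?w, chord (?s cx) cx (cx, True) (cx, False), chord (?s cy) cy (cy, True) (cy, False),
      chord (?s cz) cz (cz, b) (cz, \<not> b)#} + N"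
  have net: "net D = add_mset (chord (?s cz) cz (cz, True) (cz, False)) ?M"
    using mset_set_split[OF fin(3) X, of "chord_at D"] ne by (simp add: net_def W N_def ac_simps add_mset_commute)
  have K: "add_mset (chord (?s cz) cz (cz, b) (cz, \<not> b)) ?M = ?K" by (simp add: add_mset_commute)
  have cl: "closed ?K" using closed_net[OF wf] unfolding net chord_level(2)[of _ cz _ b] K .
  have "ev (net D) = ev ?K" unfolding net chord_level(1)[of _ cz _ b] K ..
  also have "\<dots> = ev ({#?u, ?v, ?w, chord (?s cx) cx (cy, True) (cz, b), chord (?s cy) cy (cx, True) (cz, \<not> b),
      chord (?s cz) cz (cx, False) (cy, False)#} + N)"
    by (rule ev_local_R3[OF crossing_sign_cases e cl])
  also have "\<dots> = ev (add_mset (chord (?s cz) cz (cx, False) (cy, False))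
      ({#?u, ?v, ?w, chord (?s cx) cx (cy, True) (cz, b), chord (?s cy) cy (cx, True) (cz, \<not> b)#} + N))"
    by (simp add: add_mset_commute)
  \<comment> \<open>The level \<open>b\<close> of \<open>z\<close> at the third crossing is
    arbitrary, so the chord may have to exchange its strands.\<close>
  also have "\<dots> = ev (add_mset (chord (?s cz) cz (s (cz, True)) (s (cz, False)))
      ({#?u, ?v, ?w, chord (?s cx) cx (cy, True) (cz, b), chord (?s cy) cy (cx, True) (cz, \<not> b)#} + N))"
    using s(4,5) ev_chord_swap by (cases b) auto
  also have "\<dots> = ev (image_mset (wire_to_next D) (mset_set (passages D)) +
      image_mset (\<lambda>c. chord (?s c) c (s (c, True)) (s (c, False))) (mset_set (classical D)) +
      image_mset (\<lambda>p. wire_through (s p)) (mset_set (virtual_passages D)))"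
  proof -
    have "image_mset (\<lambda>c. chord (?s c) c (s (c, True)) (s (c, False))) (mset_set (classical D - ?X)) =
        image_mset (chord_at D) (mset_set (classical D - ?X))"
      using fin by (intro image_mset_cong) (simp add: s_out)
    moreover have "image_mset (\<lambda>p. wire_through (s p)) (mset_set (virtual_passages D)) =
        image_mset wire_through (mset_set (virtual_passages D))"
    proof (intro image_mset_cong)
      fix q assume "q \<in># mset_set (virtual_passages D)"
      then have "fst q \<notin> ?X" using fin X by (auto simp: virtual_passages_def classical_def)
      then have "s q = q" by (rule s_out)
      then show "wire_through (s q) = wire_through q" by simp
    qed
    ultimately show ?thesis
      using mset_set_split[OF fin(3) X, of "\<lambda>c. chord (?s c) c (s (c, True)) (s (c, False))"] ne
      by (simp add: W N_def s ac_simps add_mset_commute)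
  qed
  finally show ?thesis
    by (rule normalized_bracket_conjugate[OF D D' perm s_inv iso[folded s_def]])
qed

lemma normalized_bracket_Z:
  assumes D: "permutation_diagram D" and D': "permutation_diagram D'" and r: "z_move D D'"
  shows "normalized_bracket f D = normalized_bracket f D'"
proof -
  obtain x y where x: "x \<in> darts D" "face_step D x = y" "face_step D y = x" "cr x \<noteq> cr y"
    and c: "cr x \<in> classical D" "cr y \<in> crossings D - classical D"
    and iso: "isotopic (D\<lparr>nxt := (Transposition.transpose (fst x) (fst y) \<circ>
        Transposition.transpose (fst (opp D x)) (fst (opp D y))) \<circ> nxt D \<circ>
      (Transposition.transpose (fst x) (fst y) \<circ> Transposition.transpose (fst (opp D x)) (fst (opp D y)))\<rparr>) D'"
    using r unfolding z_move_def bigon_face_def Let_def by blast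
  define s where "s = Transposition.transpose (fst x) (fst y) \<circ> Transposition.transpose (fst (opp D x)) (fst (opp D y))"
  define cx cy b d where "cx = cr x" and "cy = cr y" and "b = over x" and "d = over (opp D x)"
  note wf = permutation_diagram_wf[OF D]
  note fin = finite_diagram[OF wf]
  have y: "y \<in> darts D" using face_step_darts[OF D x(1)] x(2) by simp
  have p: "fst x = (cx, b)" "fst (opp D x) = (cy, d)" "fst y = (cy, \<not> d)" "fst (opp D y) = (cx, \<not> b)"
    using face_step_eq(1)[OF x(2)] face_step_eq(1)[OF x(3)]
    by (auto simp: prod_eq_iff cx_def cy_def b_def d_def cr_def over_def)
  have ne: "cx \<noteq> cy" using x(4) by (simp add: cx_def cy_def)
  have cX: "{cx} \<subseteq> classical D" and cY: "{(cy, d), (cy, \<not> d)} \<subseteq> virtual_passages D"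
    using c by (auto simp: cx_def cy_def virtual_passages_def passages_def classical_def)
  have pas: "(cx, b') \<in> passages D" "(cy, b') \<in> passages D" for b'
    using c by (auto simp: cx_def cy_def passages_def classical_def)
  let ?p = "(cx, b)" and ?p' = "(cy, d)" and ?q = "(cy, \<not> d)" and ?q' = "(cx, \<not> b)"
  have s_eq: "s = Transposition.transpose ?p ?q \<circ> Transposition.transpose ?p' ?q'"
    by (simp add: s_def p)
  have s: "s ?p = ?q" "s ?q = ?p" "s ?p' = ?q'" "s ?q' = ?p'"
    using ne by (auto simp: s_eq transpose_def)
  have s_out: "s r = r" if "r \<notin> {?p, ?p', ?q, ?q'}" for r
    using that by (auto simp: s_eq transpose_def)
  have s_inv: "s (s r) = r" for r
    by (cases "r \<in> {?p, ?p', ?q, ?q'}") (auto simp: s s_out)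
  have perm: "s permutes passages D"
    unfolding s_eq using pas by (intro permutes_compose permutes_swap_id) auto
  let ?u = "wire_between (snd x) ?p ?p'" and ?v = "wire_between (snd y) ?q ?q'"
  let ?S = "{side D x, side D y}" and ?Y = "{?p', ?q}"
  have S: "side D x \<noteq> side D y" using side_cases[of D x] side_cases[of D y] p ne by auto
  have sub: "?S \<subseteq> passages D"
    using dart_wire(1)[OF D x(1)] dart_wire(1)[OF D y] by auto
  define N where "N = image_mset (wire_to_next D) (mset_set (passages D - ?S)) +
    image_mset (chord_at D) (mset_set (classical D - {cx})) + image_mset wire_through (mset_set (virtual_passages D - ?Y))"
  have W: "image_mset (wire_to_next D) (mset_set (passages D)) =
      {#?u, ?v#} + image_mset (wire_to_next D) (mset_set (passages D - ?S))"
    using mset_set_split[OF fin(2) sub, of "wire_to_next D"] S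
      dart_wire(3)[OF D x(1)] dart_wire(3)[OF D y] p by simp
  let ?s = "crossing_sign D"
  let ?M = "{#?u, ?v, wire_through ?p', wire_through ?q#} + N"
  let ?K = "{#?u, ?v, chord (?s cx) cx ?p ?q', wire_through ?p', wire_through ?q#} + N"
  have net: "net D = add_mset (chord (?s cx) cx (cx, True) (cx, False)) ?M"
    using mset_set_split[OF fin(3) cX, of "chord_at D"] mset_set_split[OF fin(4) cY, of wire_through]
    by (simp add: net_def W N_def ac_simps add_mset_commute)
  have K: "add_mset (chord (?s cx) cx (cx, b) (cx, \<not> b)) ?M = ?K" by (simp add: add_mset_commute)
  have cl: "closed ?K" using closed_net[OF wf] unfolding net chord_level(2)[of _ cx _ b] K .
  have "ev (net D) = ev ?K" unfolding net chord_level(1)[of _ cx _ b] K ..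
  also have "\<dots> = ev ({#?u, ?v, chord (?s cx) cx ?q ?p', wire_through ?q', wire_through ?p#} + N)"
    by (rule ev_local_Z[OF cl])
  also have "\<dots> = ev (add_mset (chord (?s cx) cx ?q ?p') ({#?u, ?v, wire_through ?q', wire_through ?p#} + N))"
    by (simp add: add_mset_commute)
  \<comment> \<open>The involution exchanges the passages of the two edges, so the strand that was
    over is now under; the symmetry of crossings brings the chord into the required order.\<close>
  also have "\<dots> = ev (add_mset (chord (?s cx) cx (s (cx, True)) (s (cx, False))) ({#?u, ?v, wire_through ?q', wire_through ?p#} + N))"
    using s(1,4) ev_chord_swap by (cases b) auto
  also have "\<dots> = ev (image_mset (wire_to_next D) (mset_set (passages D)) +
      image_mset (\<lambda>c. chord (?s c) c (s (c, True)) (s (c, False))) (mset_set (classical D)) +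
      image_mset (\<lambda>p. wire_through (s p)) (mset_set (virtual_passages D)))"
  proof -
    have "image_mset (\<lambda>c. chord (?s c) c (s (c, True)) (s (c, False))) (mset_set (classical D - {cx})) =
        image_mset (chord_at D) (mset_set (classical D - {cx}))"
    proof (intro image_mset_cong)
      fix c' assume "c' \<in># mset_set (classical D - {cx})"
      then have "c' \<noteq> cx" "c' \<noteq> cy" using fin c by (auto simp: cy_def)
      then show "chord (?s c') c' (s (c', True)) (s (c', False)) = chord_at D c'" by (simp add: s_out)
    qed
    moreover have "image_mset (\<lambda>p. wire_through (s p)) (mset_set (virtual_passages D - ?Y)) =
        image_mset wire_through (mset_set (virtual_passages D - ?Y))"
    proof (intro image_mset_cong)
      fix q assume "q \<in># mset_set (virtual_passages D - ?Y)"
      then have "q \<notin> ?Y" "fst q \<noteq> cx" using fin cX by (auto simp: virtual_passages_def classical_def)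
      then have "q \<notin> {?p, ?p', ?q, ?q'}" by auto
      then have "s q = q" by (rule s_out)
      then show "wire_through (s q) = wire_through q" by simp
    qed
    ultimately show ?thesis
      using mset_set_split[OF fin(3) cX, of "\<lambda>c. chord (?s c) c (s (c, True)) (s (c, False))"]
        mset_set_split[OF fin(4) cY, of "\<lambda>p. wire_through (s p)"]
      by (simp add: W N_def s ac_simps add_mset_commute)
  qed
  finally show ?thesis
    by (rule normalized_bracket_conjugate[OF D D' perm s_inv iso[folded s_def]])
qed

end

theorem theorem2:
  fixes f :: "web \<Rightarrow> coeff" and K K' :: vdiagram
  assumes "kuperberg_map f"
    and "virtual_diagram K" and "virtual_diagram K'"
    and "virtual_move K K'"
  shows "normalized_bracket f K = normalized_bracket f K'"
proof -
  interpret kuperberg f by standard (rule assms(1))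
  have D: "permutation_diagram K" "permutation_diagram K'"
    using assms(2,3) by (simp_all add: virtual_diagram_def permutation_diagram_def)
  from assms(4) show ?thesis
    unfolding virtual_move_def
    using normalized_bracket_isotopic[OF permutation_diagram_wf[OF D(1)] permutation_diagram_wf[OF D(2)]]
      normalized_bracket_R1[OF D] normalized_bracket_R2[OF D] normalized_bracket_R3[OF D]
      normalized_bracket_detour[OF D] normalized_bracket_Z[OF D]
    by blast
qed

end
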